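(* Let $X_1,X_2\in\mathbb{C}[x_1,x_2]$ with $X_1\not\equiv0$, consider the polynomial differential equation $$\frac{dx_1}{dt}=X_1(x_1,x_2),\qquad \frac{dx_2}{dt}=X_2(x_1,x_2),$$ and let $\mathscr{X}=X_1\delta_1+X_2\delta_2$ be the corresponding differential operator. Then: (1) if $\mathrm{ord}(\mathscr{X})=0$, the equation has a first integral $\omega\in K$; (2) if $\mathrm{ord}(\mathscr{X})=1$, the equation has a first integral $\omega$ such that $(\delta_2\omega)^n\in K$ for some $n\in\mathbb{N}$ (positive); (3) if $\mathrm{ord}(\mathscr{X})=2$, the equation has a first integral $\omega$ such that $\delta_2^2\omega/\delta_2\omega\in K$; (4) if $\mathrm{ord}(\mathscr{X})=3$, the equation has a first integral $\omega$ such that $$\frac{2(\delta_2\omega)(\delta_2^3\omega)-3(\delta_2^2\omega)^2}{(\delta_2\omega)^2}\in K;$$ (5) if $\mathrm{ord}(\mathscr{X})=\infty$, then no first integral of the equation satisfies a differential equation of the form $\mathscr{D}_Ay=0$ with $A\in K\{y\}\setminus\{X\}$, where $\{X\}$ is the differential ideal generated by $X=\mathscr{X}y$.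
   Context: Let $K=\mathbb{C}(x_1,x_2)$ with the derivations $\delta_i=\partial/\partial x_i$ ($i=1,2$). $K\{y\}$ is the ring of differential polynomials in one differential indeterminate $y$, i.e. the polynomial ring over $K$ in the symbols $\delta_1^{i_1}\delta_2^{i_2}y$ ($i_1,i_2\ge 0$), with $\delta_1,\delta_2$ extended as commuting derivations in the obvious way. A differential ideal is an ideal closed under $\delta_1,\delta_2$. For $\Sigma\subseteq K\{y\}$, $\{\Sigma\}$ denotes the smallest differential ideal containing $\Sigma$ (no radical is taken). Put $X=\mathscr{X}y=X_1\delta_1y+X_2\delta_2y$. A first integral is a non-constant analytic function $\omega$ on some nonempty connected open subset of $\mathbb{C}^2$ with $\mathscr{X}\omega=0$; "$\in K$" means that the function coincides with a rational function on (the relevant part of) its domain. Rank. $\delta_1^{j_1}\delta_2^{j_2}y$ is higher than $\delta_1^{i_1}\delta_2^{i_2}y$ if $j_1>i_1$, or $j_1=i_1$ and $j_2>i_2$. The leader of a differential polynomial that effectively involves $y$ or its derivatives is the highest derivative of $y$ occurring in it. $A_2$ has higher rank than $A_1$ if $A_2$ has a higher leader, or they have the same leader and $A_2$ has larger degree in it; a differential polynomial effectively involving $y$ or its derivatives has higher rank than any element of $K$. Expansions. An expansion of $\mathscr{X}$ is a differential ideal $\Lambda\subseteq K\{y\}$ properly containing $\{X\}$. Let $A$ be a nonzero element of $\Lambda$ of lowest rank. Then either the leader of $A$ is $\delta_2^r y$ for some $r\ge 0$, and one puts $\mathrm{ord}(\Lambda)=r$, or $A\in K$ (so $\Lambda=K\{y\}$),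 and one puts $\mathrm{ord}(\Lambda)=\infty$. Nontriviality. For $A\in K\{y\}$ and an analytic function $u$ on an open set $\Omega\subseteq\mathbb{C}^2$, $\mathscr{D}_Au$ is the function obtained by substituting $y=u$ in $A$; it is defined on $\Omega\setminus S(\mathscr{D}_A)$, where $S(\mathscr{D}_A)$ is the set of singular points (poles) of the coefficients of $A$. An expansion $\Lambda$ is nontrivial if there are a nonempty connected open set $\Omega\subseteq\mathbb{C}^2$ and a non-constant analytic function $\omega$ on $\Omega$ with $\mathscr{D}_A\omega=0$ on $\Omega\setminus S(\mathscr{D}_A)$ for all $A\in\Lambda$; by convention the unit ideal $K\{y\}$ (of order $\infty$) is also admitted. Order of the operator. $\mathrm{ord}(\mathscr{X})$ is the lowest order of a nontrivial expansion of $\mathscr{X}$. Thus $\mathrm{ord}(\mathscr{X})=\infty$ exactly when no nontrivial expansion has finite order. *)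

theory Defs
  imports
    "HOL-Analysis.Analysis"
    "HOL-Computational_Algebra.Computational_Algebra"
    "HOL-Library.Poly_Mapping"
    "HOL-Library.Extended_Nat"
begin

section \<open>The differential field of rational functions in two variables\<close>

text \<open>
  A bivariate polynomial is a polynomial in \<open>x\<^sub>2\<close> whose coefficients are polynomials in \<open>x\<^sub>1\<close>:
  \<open>x\<^sub>1 = [:[:0, 1:]:]\<close> and \<open>x\<^sub>2 = [:0, 1:]\<close>.
\<close>

type_synonym bipoly = "complex poly poly"
type_synonym ratfun = "complex poly poly fract"

definition eval2 :: "bipoly \<Rightarrow> complex \<times> complex \<Rightarrow> complex" where
  "eval2 p z = poly (poly p [:snd z:]) (fst z)"

definition bipoly_d1 :: "bipoly \<Rightarrow> bipoly" where
  "bipoly_d1 p = map_poly pderiv p"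

definition bipoly_d2 :: "bipoly \<Rightarrow> bipoly" where
  "bipoly_d2 p = pderiv p"

lemma coeff_bipoly_d1: "coeff (bipoly_d1 p) n = pderiv (coeff p n)"
  by (simp add: bipoly_d1_def coeff_map_poly)

lemma bipoly_d1_mult: "bipoly_d1 (p * q) = bipoly_d1 p * q + p * bipoly_d1 q"
proof -
  have pderiv_sum': "pderiv (sum f A) = (\<Sum>i\<in>A. pderiv (f i))"
    for f :: "nat \<Rightarrow> complex poly" and A
    by (induction A rule: infinite_finite_induct) (simp_all add: pderiv_add)
  show ?thesis
    by (rule poly_eqI)
      (simp add: coeff_bipoly_d1 coeff_mult pderiv_sum' pderiv_mult sum.distrib,
       simp add: ac_simps)
qed

lemma bipoly_d2_mult: "bipoly_d2 (p * q) = bipoly_d2 p * q + p * bipoly_d2 q"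
  by (simp add: bipoly_d2_def pderiv_mult algebra_simps)

definition fract_deriv :: "(bipoly \<Rightarrow> bipoly) \<Rightarrow> ratfun \<Rightarrow> ratfun" where
  "fract_deriv d f =
     (THE g. \<exists>p q. q \<noteq> 0 \<and> f = Fract p q \<and> g = Fract (d p * q - p * d q) (q * q))"

definition rat_d1 :: "ratfun \<Rightarrow> ratfun" where
  "rat_d1 = fract_deriv bipoly_d1"

definition rat_d2 :: "ratfun \<Rightarrow> ratfun" where
  "rat_d2 = fract_deriv bipoly_d2"

lemma fract_deriv_Fract:
  assumes d: "\<And>p q. d (p * q) = d p * q + p * d q" and nz: "q \<noteq> 0"
  shows "fract_deriv d (Fract p q) = Fract (d p * q - p * d q) (q * q)"
  unfolding fract_deriv_def
proof (rule the_equality)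
  fix g assume "\<exists>a b. b \<noteq> 0 \<and> Fract p q = Fract a b \<and> g = Fract (d a * b - a * d b) (b * b)"
  then obtain a b where b: "b \<noteq> 0" and eqF: "Fract p q = Fract a b"
    and g: "g = Fract (d a * b - a * d b) (b * b)" by blast
  have eq: "a * q = p * b" using eqF b nz by (simp add: eq_fract)
  then have "d (a * q) = d (p * b)" by simp
  then have eq': "d a * q = d p * b + p * d b - a * d q" by (simp add: d algebra_simps)
  have "(d a * b - a * d b) * (q * q) = b * q * (d a * q) - (a * q) * d b * q"
    by (simp add: algebra_simps)
  also have "\<dots> = b * b * (d p * q) + (p * b) * q * d b - b * (a * q) * d q - (a * q) * d b * q"
    unfolding eq' by (simp add: algebra_simps)
  also have "\<dots> = (d p * q - p * d q) * (b * b)"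
    by (simp add: eq algebra_simps)
  finally show "g = Fract (d p * q - p * d q) (q * q)"
    using b nz by (simp add: g eq_fract)
qed (use nz in blast)

lemma rat_d1_Fract:
  "q \<noteq> 0 \<Longrightarrow> rat_d1 (Fract p q) = Fract (bipoly_d1 p * q - p * bipoly_d1 q) (q * q)"
  unfolding rat_d1_def by (rule fract_deriv_Fract[OF bipoly_d1_mult])

lemma rat_d2_Fract:
  "q \<noteq> 0 \<Longrightarrow> rat_d2 (Fract p q) = Fract (bipoly_d2 p * q - p * bipoly_d2 q) (q * q)"
  unfolding rat_d2_def by (rule fract_deriv_Fract[OF bipoly_d2_mult])

lemma bipoly_d1_add: "bipoly_d1 (p + q) = bipoly_d1 p + bipoly_d1 q"
  by (rule poly_eqI) (simp add: coeff_bipoly_d1 pderiv_add)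

lemma bipoly_d2_add: "bipoly_d2 (p + q) = bipoly_d2 p + bipoly_d2 q"
  by (simp add: bipoly_d2_def pderiv_add)

lemma fract_deriv_add:
  assumes d: "\<And>p q. d (p * q) = d p * q + p * d q" and a: "\<And>p q. d (p + q) = d p + d q"
  shows "fract_deriv d (f + g) = fract_deriv d f + fract_deriv d g"
  by (cases f; cases g)
    (simp add: fract_deriv_Fract[of d, OF d] add_fract eq_fract a d algebra_simps)

lemma fract_deriv_mult:
  assumes d: "\<And>p q. d (p * q) = d p * q + p * d q"
  shows "fract_deriv d (f * g) = fract_deriv d f * g + f * fract_deriv d g"
  by (cases f; cases g)
    (simp add: fract_deriv_Fract[of d, OF d] add_fract mult_fract eq_fract d algebra_simps)

lemma rat_d1_add: "rat_d1 (f + g) = rat_d1 f + rat_d1 g"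
  and rat_d1_mult: "rat_d1 (f * g) = rat_d1 f * g + f * rat_d1 g"
  and rat_d2_add: "rat_d2 (f + g) = rat_d2 f + rat_d2 g"
  and rat_d2_mult: "rat_d2 (f * g) = rat_d2 f * g + f * rat_d2 g"
  unfolding rat_d1_def rat_d2_def
  by (intro fract_deriv_add fract_deriv_mult bipoly_d1_mult bipoly_d2_mult bipoly_d1_add
      bipoly_d2_add)+

lemma rat_d1_one: "rat_d1 1 = 0" and rat_d2_one: "rat_d2 1 = 0"
  using rat_d1_mult[of 1 1] rat_d2_mult[of 1 1]
  by (simp_all only: mult_1_left mult_1_right add_cancel_right_right)

text \<open>
  The singular points of a rational function are the points at which no representation has a
  non-vanishing denominator; points of indeterminacy are therefore singular.
\<close>

definition rat_regular :: "ratfun \<Rightarrow> complex \<times> complex \<Rightarrow> bool" where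
  "rat_regular c z \<longleftrightarrow> (\<exists>p q. c = Fract p q \<and> eval2 q z \<noteq> 0)"

definition rat_val :: "ratfun \<Rightarrow> complex \<times> complex \<Rightarrow> complex" where
  "rat_val c z = (THE v. \<exists>p q. c = Fract p q \<and> eval2 q z \<noteq> 0 \<and> v = eval2 p z / eval2 q z)"

lemma rat_val_Fract:
  assumes "eval2 q z \<noteq> 0"
  shows "rat_val (Fract p q) z = eval2 p z / eval2 q z"
  unfolding rat_val_def
proof (rule the_equality)
  fix v assume "\<exists>p' q'. Fract p q = Fract p' q' \<and> eval2 q' z \<noteq> 0 \<and> v = eval2 p' z / eval2 q' z"
  then obtain p' q' where *: "Fract p q = Fract p' q'" "eval2 q' z \<noteq> 0"
    and v: "v = eval2 p' z / eval2 q' z" by blast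
  have "q \<noteq> 0" "q' \<noteq> 0" using assms *(2) by (auto simp: eval2_def)
  then have "p * q' = p' * q" using *(1) by (simp add: eq_fract)
  then have "eval2 (p * q') z = eval2 (p' * q) z" by simp
  then show "v = eval2 p z / eval2 q z"
    using assms *(2) by (simp add: v eval2_def field_simps)
qed (use assms in blast)


section \<open>Differential polynomials\<close>

text \<open>
  The index \<open>(i, j)\<close> stands for the symbol \<open>\<delta>\<^sub>1\<^sup>i \<delta>\<^sub>2\<^sup>j y\<close>. A monomial maps each symbol to its
  exponent, and a differential polynomial maps each monomial to its coefficient.
\<close>

type_synonym dmonom = "nat \<times> nat \<Rightarrow>\<^sub>0 nat"
type_synonym dpoly = "(nat \<times> nat \<Rightarrow>\<^sub>0 nat) \<Rightarrow>\<^sub>0 complex poly poly fract"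

definition dconst :: "ratfun \<Rightarrow> dpoly" where
  "dconst c = Poly_Mapping.single 0 c"

definition dvar :: "nat \<times> nat \<Rightarrow> dpoly" where
  "dvar \<theta> = Poly_Mapping.single (Poly_Mapping.single \<theta> 1) 1"

text \<open>
  The derivation of a term \<open>c \<cdot> m\<close>, when the derivation acts on coefficients by \<open>d\<close> and sends the
  symbol \<open>\<theta>\<close> to the symbol \<open>s \<theta>\<close>.
\<close>

definition dterm_deriv ::
  "(ratfun \<Rightarrow> ratfun) \<Rightarrow> (nat \<times> nat \<Rightarrow> nat \<times> nat) \<Rightarrow> dmonom \<Rightarrow> ratfun \<Rightarrow> dpoly" where
  "dterm_deriv d s m c =
     Poly_Mapping.single m (d c) +
     (\<Sum>\<theta>\<in>Poly_Mapping.keys m.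
        Poly_Mapping.single (m - Poly_Mapping.single \<theta> 1 + Poly_Mapping.single (s \<theta>) 1)
          (of_nat (Poly_Mapping.lookup m \<theta>) * c))"

definition dpoly_deriv ::
  "(ratfun \<Rightarrow> ratfun) \<Rightarrow> (nat \<times> nat \<Rightarrow> nat \<times> nat) \<Rightarrow> dpoly \<Rightarrow> dpoly" where
  "dpoly_deriv d s A =
     (\<Sum>m\<in>Poly_Mapping.keys A. dterm_deriv d s m (Poly_Mapping.lookup A m))"

definition dpoly_d1 :: "dpoly \<Rightarrow> dpoly" where
  "dpoly_d1 = dpoly_deriv rat_d1 (\<lambda>(i, j). (Suc i, j))"

definition dpoly_d2 :: "dpoly \<Rightarrow> dpoly" where
  "dpoly_d2 = dpoly_deriv rat_d2 (\<lambda>(i, j). (i, Suc j))"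

lemma dterm_deriv_add:
  assumes "\<And>f g. d (f + g) = d f + d g"
  shows "dterm_deriv d s m (a + b) = dterm_deriv d s m a + dterm_deriv d s m b"
  by (simp add: dterm_deriv_def assms Poly_Mapping.single_add sum.distrib algebra_simps)

lemma dterm_deriv_zero:
  assumes "\<And>f g. d (f + g) = d f + (d g :: ratfun)"
  shows "dterm_deriv d s m 0 = 0"
  using dterm_deriv_add[of d s m 0 0, OF assms] by simp

lemma dpoly_deriv_superset:
  assumes "\<And>f g. d (f + g) = d f + (d g :: ratfun)" "finite M" "Poly_Mapping.keys A \<subseteq> M"
  shows "dpoly_deriv d s A = (\<Sum>m\<in>M. dterm_deriv d s m (Poly_Mapping.lookup A m))"
  unfolding dpoly_deriv_def
  by (rule sum.mono_neutral_left)
    (use assms in \<open>auto simp: dterm_deriv_zero[of d, OF assms(1)] in_keys_iff\<close>)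

lemma dpoly_deriv_add:
  assumes "\<And>f g. d (f + g) = d f + (d g :: ratfun)"
  shows "dpoly_deriv d s (A + B) = dpoly_deriv d s A + dpoly_deriv d s B"
proof -
  let ?M = "Poly_Mapping.keys A \<union> Poly_Mapping.keys B"
  have M: "finite ?M" by simp
  show ?thesis
    unfolding dpoly_deriv_superset[of d, OF assms M Poly_Mapping.keys_add]
    by (subst (1 2) dpoly_deriv_superset[of d ?M, OF assms M])
      (auto simp: lookup_add dterm_deriv_add[of d, OF assms] sum.distrib)
qed

lemma dpoly_deriv_single:
  assumes "\<And>f g. d (f + g) = d f + (d g :: ratfun)"
  shows "dpoly_deriv d s (Poly_Mapping.single m c) = dterm_deriv d s m c"
  by (simp add: dpoly_deriv_def dterm_deriv_zero[of d, OF assms])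

lemma dterm_deriv_superset:
  assumes "finite T" "Poly_Mapping.keys m \<subseteq> T"
  shows "dterm_deriv d s m c = Poly_Mapping.single m (d c) +
     (\<Sum>\<theta>\<in>T. Poly_Mapping.single (m - Poly_Mapping.single \<theta> 1 + Poly_Mapping.single (s \<theta>) 1)
          (of_nat (Poly_Mapping.lookup m \<theta>) * c))"
  unfolding dterm_deriv_def
  by (intro arg_cong2[where f = "(+)"] refl sum.mono_neutral_left)
    (use assms in \<open>auto simp: in_keys_iff\<close>)

lemma dterm_deriv_mult:
  assumes "\<And>f g. d (f * g) = d f * g + f * d g"
  shows "dterm_deriv d s (m + n) (a * b) =
    dterm_deriv d s m a * Poly_Mapping.single n b + Poly_Mapping.single m a * dterm_deriv d s n b"
proof -
  let ?T = "Poly_Mapping.keys m \<union> Poly_Mapping.keys n"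
  let ?v = "\<lambda>\<theta>. Poly_Mapping.single \<theta> (1::nat)"
  let ?S = "Poly_Mapping.single :: dmonom \<Rightarrow> ratfun \<Rightarrow> dpoly"
  have T: "finite ?T" by simp
  have shift: "m' - ?v \<theta> + x + n' = m' + n' - ?v \<theta> + x" if "Poly_Mapping.lookup m' \<theta> \<noteq> 0"
    for m' n' x :: dmonom and \<theta>
    using that by (intro poly_mapping_eqI) (auto simp: lookup_add lookup_minus lookup_single when_def)
  have shift': "m' + (n' - ?v \<theta> + x) = m' + n' - ?v \<theta> + x" if "Poly_Mapping.lookup n' \<theta> \<noteq> 0"
    for m' n' x :: dmonom and \<theta>
    using that by (intro poly_mapping_eqI) (auto simp: lookup_add lookup_minus lookup_single when_def)
  have term_m: "?S (m - ?v \<theta> + ?v (s \<theta>)) (of_nat (Poly_Mapping.lookup m \<theta>) * a) * ?S n b =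
      ?S (m + n - ?v \<theta> + ?v (s \<theta>)) (of_nat (Poly_Mapping.lookup m \<theta>) * a * b)" for \<theta>
    by (cases "Poly_Mapping.lookup m \<theta> = 0") (simp_all add: mult_single shift del: One_nat_def)
  have term_n: "?S m a * ?S (n - ?v \<theta> + ?v (s \<theta>)) (of_nat (Poly_Mapping.lookup n \<theta>) * b) =
      ?S (m + n - ?v \<theta> + ?v (s \<theta>)) (of_nat (Poly_Mapping.lookup n \<theta>) * a * b)" for \<theta>
    by (cases "Poly_Mapping.lookup n \<theta> = 0")
      (simp_all add: mult_single shift' mult.left_commute mult.assoc del: One_nat_def)
  show ?thesis
    unfolding dterm_deriv_superset[OF T Poly_Mapping.keys_add]
      dterm_deriv_superset[OF T Un_upper1] dterm_deriv_superset[OF T Un_upper2]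
    unfolding distrib_left distrib_right sum_distrib_left sum_distrib_right term_m term_n assms
    by (simp add: mult_single Poly_Mapping.single_add lookup_add sum.distrib distrib_right
        mult.assoc add_ac del: One_nat_def)
qed

lemma dpoly_deriv_mult:
  assumes add: "\<And>f g. d (f + g) = d f + (d g :: ratfun)"
    and mult: "\<And>f g. d (f * g) = d f * g + f * d g"
  shows "dpoly_deriv d s (A * B) = dpoly_deriv d s A * B + A * dpoly_deriv d s B"
proof -
  note D_add = dpoly_deriv_add[of d, OF add]
  have D_zero: "dpoly_deriv d s 0 = 0" by (simp add: dpoly_deriv_def)
  have D_sum: "dpoly_deriv d s (sum f I) = (\<Sum>i\<in>I. dpoly_deriv d s (f i))"
    for f :: "dmonom \<Rightarrow> dpoly" and I
    by (induction I rule: infinite_finite_induct) (simp_all add: D_zero D_add)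
  have decomp: "C = (\<Sum>m\<in>Poly_Mapping.keys C. Poly_Mapping.single m (Poly_Mapping.lookup C m))"
    for C :: dpoly
    by (intro poly_mapping_eqI)
      (auto simp: lookup_sum lookup_single when_def in_keys_iff sum.delta)
  have mono: "dpoly_deriv d s (Poly_Mapping.single m a * Poly_Mapping.single n b) =
     dpoly_deriv d s (Poly_Mapping.single m a) * Poly_Mapping.single n b +
     Poly_Mapping.single m a * dpoly_deriv d s (Poly_Mapping.single n b)" for m n a b
    by (simp add: mult_single dpoly_deriv_single[of d, OF add] dterm_deriv_mult[of d, OF mult])
  have "dpoly_deriv d s (sum f I * sum g J) =
      dpoly_deriv d s (sum f I) * sum g J + sum f I * dpoly_deriv d s (sum g J)"
    if "\<And>i j. dpoly_deriv d s (f i * g j) = dpoly_deriv d s (f i) * g j + f i * dpoly_deriv d s (g j)"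
    for f g :: "dmonom \<Rightarrow> dpoly" and I J
    by (simp add: sum_product D_sum that sum.distrib)
  from this[of "\<lambda>m. Poly_Mapping.single m (Poly_Mapping.lookup A m)"
      "\<lambda>n. Poly_Mapping.single n (Poly_Mapping.lookup B n)"
      "Poly_Mapping.keys A" "Poly_Mapping.keys B", OF mono]
  show ?thesis unfolding decomp[symmetric] .
qed

lemma dpoly_deriv_dconst:
  assumes "\<And>f g. d (f + g) = d f + (d g :: ratfun)"
  shows "dpoly_deriv d s (dconst c) = dconst (d c)"
  by (simp add: dconst_def dpoly_deriv_single[of d, OF assms] dterm_deriv_def)

lemma dpoly_deriv_dvar:
  assumes "\<And>f g. d (f + g) = d f + (d g :: ratfun)" "d 1 = 0"
  shows "dpoly_deriv d s (dvar \<theta>) = dvar (s \<theta>)"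
  by (simp add: dvar_def dpoly_deriv_single[of d, OF assms(1)] dterm_deriv_def assms(2))

lemma dpoly_d1_derivation:
  "dpoly_d1 (A + B) = dpoly_d1 A + dpoly_d1 B"
  "dpoly_d1 (A * B) = dpoly_d1 A * B + A * dpoly_d1 B"
  "dpoly_d1 (dconst c) = dconst (rat_d1 c)"
  "dpoly_d1 (dvar (i, j)) = dvar (Suc i, j)"
  unfolding dpoly_d1_def
  using dpoly_deriv_dvar[where \<theta> = "(i, j)", OF rat_d1_add rat_d1_one]
  by (simp_all add: dpoly_deriv_add dpoly_deriv_mult dpoly_deriv_dconst rat_d1_add rat_d1_mult)

lemma dpoly_d2_derivation:
  "dpoly_d2 (A + B) = dpoly_d2 A + dpoly_d2 B"
  "dpoly_d2 (A * B) = dpoly_d2 A * B + A * dpoly_d2 B"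
  "dpoly_d2 (dconst c) = dconst (rat_d2 c)"
  "dpoly_d2 (dvar (i, j)) = dvar (i, Suc j)"
  unfolding dpoly_d2_def
  using dpoly_deriv_dvar[where \<theta> = "(i, j)", OF rat_d2_add rat_d2_one]
  by (simp_all add: dpoly_deriv_add dpoly_deriv_mult dpoly_deriv_dconst rat_d2_add rat_d2_mult)

definition differential_ideal :: "dpoly set \<Rightarrow> bool" where
  "differential_ideal I \<longleftrightarrow>
     0 \<in> I \<and> (\<forall>A\<in>I. \<forall>B\<in>I. A + B \<in> I) \<and> (\<forall>C. \<forall>A\<in>I. C * A \<in> I) \<and>
     (\<forall>A\<in>I. dpoly_d1 A \<in> I) \<and> (\<forall>A\<in>I. dpoly_d2 A \<in> I)"

definition diff_ideal_gen :: "dpoly set \<Rightarrow> dpoly set" where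
  "diff_ideal_gen \<Sigma> = differential_ideal hull \<Sigma>"

definition vf_dpoly :: "bipoly \<Rightarrow> bipoly \<Rightarrow> dpoly" where
  "vf_dpoly X1 X2 = dconst (Fract X1 1) * dvar (1, 0) + dconst (Fract X2 1) * dvar (0, 1)"


section \<open>Rank\<close>

definition occurring :: "dpoly \<Rightarrow> (nat \<times> nat) set" where
  "occurring A = (\<Union>m\<in>Poly_Mapping.keys A. Poly_Mapping.keys m)"

definition lower_deriv :: "nat \<times> nat \<Rightarrow> nat \<times> nat \<Rightarrow> bool" where
  "lower_deriv \<theta> \<eta> \<longleftrightarrow> fst \<theta> < fst \<eta> \<or> fst \<theta> = fst \<eta> \<and> snd \<theta> < snd \<eta>"

definition leader :: "dpoly \<Rightarrow> nat \<times> nat" where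
  "leader A = (THE \<theta>. \<theta> \<in> occurring A \<and> (\<forall>\<eta>\<in>occurring A. \<eta> \<noteq> \<theta> \<longrightarrow> lower_deriv \<eta> \<theta>))"

definition degree_in :: "nat \<times> nat \<Rightarrow> dpoly \<Rightarrow> nat" where
  "degree_in \<theta> A = Max ((\<lambda>m. Poly_Mapping.lookup m \<theta>) ` Poly_Mapping.keys A)"

text \<open>The condition \<open>occurring A = {}\<close> says that \<open>A\<close> is an element of the coefficient field.\<close>

definition lower_rank :: "dpoly \<Rightarrow> dpoly \<Rightarrow> bool" where
  "lower_rank A B \<longleftrightarrow> occurring B \<noteq> {} \<and>
     (occurring A = {} \<or>
      lower_deriv (leader A) (leader B) \<or>
      leader A = leader B \<and> degree_in (leader B) A < degree_in (leader B) B)"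

definition lowest_rank_in :: "dpoly \<Rightarrow> dpoly set \<Rightarrow> bool" where
  "lowest_rank_in A \<Lambda> \<longleftrightarrow> A \<in> \<Lambda> \<and> A \<noteq> 0 \<and> (\<forall>B\<in>\<Lambda>. B \<noteq> 0 \<longrightarrow> \<not> lower_rank B A)"


section \<open>Analytic functions and first integrals\<close>

definition analytic2_on :: "(complex \<times> complex \<Rightarrow> complex) \<Rightarrow> (complex \<times> complex) set \<Rightarrow> bool" where
  "analytic2_on u \<Omega> \<longleftrightarrow>
     (\<forall>p\<in>\<Omega>. \<exists>(a :: nat \<Rightarrow> nat \<Rightarrow> complex) r. r > 0 \<and>
        (\<forall>z. norm (fst z - fst p) < r \<and> norm (snd z - snd p) < r \<longrightarrow>
           ((\<lambda>(i, j). a i j * (fst z - fst p) ^ i * (snd z - snd p) ^ j) has_sum u z) UNIV))"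

definition pd1 :: "(complex \<times> complex \<Rightarrow> complex) \<Rightarrow> complex \<times> complex \<Rightarrow> complex" where
  "pd1 u z = deriv (\<lambda>w. u (w, snd z)) (fst z)"

definition pd2 :: "(complex \<times> complex \<Rightarrow> complex) \<Rightarrow> complex \<times> complex \<Rightarrow> complex" where
  "pd2 u z = deriv (\<lambda>w. u (fst z, w)) (snd z)"

definition nonconst_analytic_on ::
  "(complex \<times> complex \<Rightarrow> complex) \<Rightarrow> (complex \<times> complex) set \<Rightarrow> bool" where
  "nonconst_analytic_on \<omega> \<Omega> \<longleftrightarrow>
     open \<Omega> \<and> connected \<Omega> \<and> \<Omega> \<noteq> {} \<and> analytic2_on \<omega> \<Omega> \<and> \<not> \<omega> constant_on \<Omega>"

definition first_integral_on ::
  "bipoly \<Rightarrow> bipoly \<Rightarrow> (complex \<times> complex \<Rightarrow> complex) \<Rightarrow> (complex \<times> complex) set \<Rightarrow> bool" where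
  "first_integral_on X1 X2 \<omega> \<Omega> \<longleftrightarrow>
     nonconst_analytic_on \<omega> \<Omega> \<and>
     (\<forall>z\<in>\<Omega>. eval2 X1 z * pd1 \<omega> z + eval2 X2 z * pd2 \<omega> z = 0)"

text \<open>
  \<open>rational_on f D\<close>: the function \<open>f\<close>, whose domain of definition is \<open>D\<close>, belongs to \<open>K\<close>. For a
  quotient, \<open>D\<close> is the set where the denominator does not vanish; it is required to be nonempty, so
  that the quotient is meaningful.
\<close>

definition rational_on ::
  "(complex \<times> complex \<Rightarrow> complex) \<Rightarrow> (complex \<times> complex) set \<Rightarrow> bool" where
  "rational_on f D \<longleftrightarrow>
     D \<noteq> {} \<and> (\<exists>c. \<forall>z\<in>D. rat_regular c z \<longrightarrow> f z = rat_val c z)"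

definition diff_op :: "dpoly \<Rightarrow> (complex \<times> complex \<Rightarrow> complex) \<Rightarrow> complex \<times> complex \<Rightarrow> complex" where
  "diff_op A u z =
     (\<Sum>m\<in>Poly_Mapping.keys A. rat_val (Poly_Mapping.lookup A m) z *
        (\<Prod>\<theta>\<in>Poly_Mapping.keys m.
           ((pd1 ^^ fst \<theta>) ((pd2 ^^ snd \<theta>) u) z) ^ Poly_Mapping.lookup m \<theta>))"

definition sing_pts :: "dpoly \<Rightarrow> (complex \<times> complex) set" where
  "sing_pts A = {z. \<exists>m\<in>Poly_Mapping.keys A. \<not> rat_regular (Poly_Mapping.lookup A m) z}"

definition satisfies_on ::
  "(complex \<times> complex \<Rightarrow> complex) \<Rightarrow> dpoly \<Rightarrow> (complex \<times> complex) set \<Rightarrow> bool" where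
  "satisfies_on u A \<Omega> \<longleftrightarrow> (\<forall>z\<in>\<Omega> - sing_pts A. diff_op A u z = 0)"


section \<open>Expansions and their order\<close>

definition expansion :: "bipoly \<Rightarrow> bipoly \<Rightarrow> dpoly set \<Rightarrow> bool" where
  "expansion X1 X2 \<Lambda> \<longleftrightarrow> differential_ideal \<Lambda> \<and> diff_ideal_gen {vf_dpoly X1 X2} \<subset> \<Lambda>"

text \<open>
  All elements of lowest rank of an expansion have the same leader \<open>(0, r)\<close>, or all of them lie in
  the coefficient field, so the description below determines a unique value.
\<close>

definition expansion_ord :: "dpoly set \<Rightarrow> enat" where
  "expansion_ord \<Lambda> =
     (THE r. \<exists>A. lowest_rank_in A \<Lambda> \<and>
        (if occurring A = {} then r = \<infinity> else (\<exists>n. leader A = (0, n) \<and> r = enat n)))"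

definition nontrivial_expansion :: "bipoly \<Rightarrow> bipoly \<Rightarrow> dpoly set \<Rightarrow> bool" where
  "nontrivial_expansion X1 X2 \<Lambda> \<longleftrightarrow> expansion X1 X2 \<Lambda> \<and>
     (\<Lambda> = UNIV \<or>
      (\<exists>\<Omega> \<omega>. nonconst_analytic_on \<omega> \<Omega> \<and> (\<forall>A\<in>\<Lambda>. satisfies_on \<omega> A \<Omega>)))"

definition operator_ord :: "bipoly \<Rightarrow> bipoly \<Rightarrow> enat" where
  "operator_ord X1 X2 =
     (LEAST r. \<exists>\<Lambda>. nontrivial_expansion X1 X2 \<Lambda> \<and> expansion_ord \<Lambda> = r)"

end

theory Submission
  imports Defs "HOL-Complex_Analysis.Complex_Analysis"
begin

text \<open>
  Put \<open>g = X\<^sub>2 / X\<^sub>1\<close>, \<open>D = \<delta>\<^sub>1 + g \<delta>\<^sub>2\<close> and \<open>y\<^sub>j = \<delta>\<^sub>2\<^sup>j y\<close>. Modulo \<open>X\<close> every differential polynomial is a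
  polynomial in the \<open>y\<^sub>j\<close>, on which \<open>D\<close> acts by \<open>D y\<^sub>0 = 0\<close>, \<open>D y\<^sub>1 = - (\<delta>\<^sub>2 g) y\<^sub>1\<close> and so on. In an
  expansion of order \<open>r\<close> take a polynomial \<open>A\<close> in \<open>y\<^sub>0, \<dots>, y\<^sub>r\<close> of minimal degree in \<open>y\<^sub>r\<close>: since \<open>D A\<close> is
  proportional to \<open>A\<close> by minimality, its two leading coefficients give a solution of the equation
  satisfied by \<open>y\<^sub>r\<close> in the field \<open>K(y\<^sub>0, \<dots>, y\<^bsub>r-1\<^esub>)\<close>. The remaining variables are eliminated
  one after the other by writing the solution as a reduced fraction \<open>P / Q\<close>, so that \<open>Q\<close> divides \<open>D Q\<close>.
  There results a rational solution \<open>t\<close> of \<open>D t = - (\<delta>\<^sub>2 g) t - \<delta>\<^sub>2\<^sup>2 g\<close> for \<open>r = 2\<close>, or of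
  \<open>D t = - 2 (\<delta>\<^sub>2 g) t - 2 \<delta>\<^sub>2\<^sup>3 g\<close> for \<open>r = 3\<close>, or an element \<open>\<beta> \<noteq> 0\<close> of \<open>K\<close> with
  \<open>D \<beta> = - n (\<delta>\<^sub>2 g) \<beta>\<close>. These identities are the integrability conditions of the linear Pfaffian systems
  whose solutions are the first integrals with \<open>\<delta>\<^sub>2\<^sup>2 \<omega> / \<delta>\<^sub>2 \<omega> = t\<close>, with twice the Schwarzian derivative equal to \<open>t\<close>, or with
  \<open>(\<delta>\<^sub>2 \<omega>)\<^sup>n\<close> a constant multiple of \<open>\<beta>\<close>. In order zero the coefficients of the monic minimal polynomial of \<open>y\<close> are
  annihilated by \<open>D\<close>, and they are not all constant because \<open>\<omega>\<close> takes more than finitely many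
  values. If some first integral satisfies an equation outside \<open>{X}\<close>, the equations satisfied by it form
  a nontrivial expansion of finite order.
\<close>

text \<open>The equations for \<open>t\<close> are those satisfied by
  \<open>\<delta>\<^sub>2\<^sup>2 \<omega> / \<delta>\<^sub>2 \<omega>\<close> and by twice the
  Schwarzian derivative for every first integral; the elimination looks for elements of
  \<open>K\<close> with the same property. For inhomogeneous equations the two leading coefficients
  suffice, because the mean of the roots of the minimal relation is again a solution. The equation
  of \<open>y\<^sub>1\<close> is homogeneous and solved by 0, so in order one this argument says
  nothing: two nonzero coefficients must be compared, and a monomial relation
  \<open>B y\<^sub>1\<^sup>n\<close> may remain. As no radical is taken, it is not excluded inside
  the given expansion, only by passing to an expansion of smaller order. Elimination can also end in
  a weaker-looking alternative, which costs nothing: \<open>\<beta>\<close> behaves like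
  \<open>y\<^sub>1\<^sup>n\<close>, so \<open>\<delta>\<^sub>2 \<beta> / (n \<beta>)\<close> behaves
  like \<open>y\<^sub>2 / y\<^sub>1\<close>, and from such a \<open>t\<close> the expression
  \<open>2 \<delta>\<^sub>2 t - t\<^sup>2\<close> behaves like twice the Schwarzian derivative.
  Fractions are kept as pairs of polynomials, so iterated polynomial rings replace the function
  fields in the \<open>y\<^sub>j\<close>.\<close>

section \<open>Elimination of variables\<close>

text \<open>Regarded as a Euclidean ring with gcd, the field \<open>K\<close> provides gcds in \<open>K[y\<^sub>0][y\<^sub>1]\<dots>\<close>.\<close>

instantiation fract :: (idom)
  "{unique_euclidean_ring, normalization_euclidean_semiring, normalization_semidom_multiplicative}"
begin

definition [simp]: "normalize (x :: 'a fract) = (if x = 0 then 0 else 1)"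
definition [simp]: "unit_factor (x :: 'a fract) = x"
definition [simp]: "modulo (x :: 'a fract) y = (if y = 0 then x else 0)"
definition [simp]: "euclidean_size (x :: 'a fract) = (if x = 0 then 0 else 1 :: nat)"
definition [simp]: "division_segment (x :: 'a fract) = 1"

instance
  by standard (simp_all add: dvd_field_iff field_split_simps split: if_splits)

end

instantiation fract :: (idom) euclidean_ring_gcd
begin

definition gcd_fract :: "'a fract \<Rightarrow> 'a fract \<Rightarrow> 'a fract" where
  "gcd_fract = Euclidean_Algorithm.gcd"
definition lcm_fract :: "'a fract \<Rightarrow> 'a fract \<Rightarrow> 'a fract" where
  "lcm_fract = Euclidean_Algorithm.lcm"
definition Gcd_fract :: "'a fract set \<Rightarrow> 'a fract" where
  "Gcd_fract = Euclidean_Algorithm.Gcd"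
definition Lcm_fract :: "'a fract set \<Rightarrow> 'a fract" where
  "Lcm_fract = Euclidean_Algorithm.Lcm"

instance
  by standard (simp_all add: gcd_fract_def lcm_fract_def Gcd_fract_def Lcm_fract_def)

end

instance fract :: (idom) field_gcd ..

text \<open>Characteristic zero enters twice: degrees of relations occur in denominators, and the
  natural numbers supply infinitely many constants of every derivation.\<close>

instance fract :: ("{idom,ring_char_0}") ring_char_0
proof
  show "inj (of_nat :: nat \<Rightarrow> 'a fract)"
    by (auto simp: inj_def of_nat_fract eq_fract)
qed

instance fract :: ("{idom,ring_char_0}") field_char_0 ..

section \<open>Derivations and their extension to a polynomial variable\<close>

definition is_derivation :: "('a :: comm_ring_1 \<Rightarrow> 'a) \<Rightarrow> bool" where
  "is_derivation D \<longleftrightarrow> (\<forall>x y. D (x + y) = D x + D y) \<and> (\<forall>x y. D (x * y) = D x * y + x * D y)"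

context
  fixes D :: "'a :: comm_ring_1 \<Rightarrow> 'a"
  assumes D: "is_derivation D"
begin

lemma derivation_add: "D (x + y) = D x + D y"
  and derivation_mult: "D (x * y) = D x * y + x * D y"
  using D by (auto simp: is_derivation_def)

lemma derivation_0: "D 0 = 0"
  using derivation_add[of 0 0] by simp

lemma derivation_1: "D 1 = 0"
  using derivation_mult[of 1 1] by (simp only: mult_1_left mult_1_right add_cancel_right_right)

lemma derivation_minus: "D (- x) = - D x"
  using derivation_add[of x "-x"] by (simp add: derivation_0 eq_neg_iff_add_eq_0 add.commute)

lemma derivation_diff: "D (x - y) = D x - D y"
  using derivation_add[of x "-y"] by (simp add: derivation_minus)

lemma derivation_sum: "D (sum f A) = (\<Sum>i\<in>A. D (f i))"
  by (induction A rule: infinite_finite_induct) (simp_all add: derivation_0 derivation_add)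

lemma derivation_of_nat: "D (of_nat n) = 0"
  by (induction n) (simp_all add: derivation_0 derivation_add derivation_1)

lemma derivation_numeral: "D (numeral n) = 0"
  using derivation_of_nat[of "numeral n"] by simp

lemmas derivation_simps = derivation_add derivation_mult derivation_0 derivation_1
  derivation_minus derivation_diff derivation_of_nat derivation_numeral

end

text \<open>The derivation that extends \<open>D\<close> to \<open>R[x]\<close> by \<open>D x = a x + b\<close>.\<close>

definition poly_ext :: "('a :: idom \<Rightarrow> 'a) \<Rightarrow> 'a \<Rightarrow> 'a \<Rightarrow> 'a poly \<Rightarrow> 'a poly" where
  "poly_ext D a b P = map_poly D P + pderiv P * [:b, a:]"

lemma coeff_poly_ext:
  assumes "is_derivation D"
  shows "coeff (poly_ext D a b P) n =
    D (coeff P n) + of_nat n * a * coeff P n + of_nat (Suc n) * b * coeff P (Suc n)"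
proof -
  have "coeff (pderiv P * [:b, a:]) n = of_nat (Suc n) * b * coeff P (Suc n) + of_nat n * a * coeff P n"
    by (cases n) (simp_all add: coeff_pderiv coeff_pCons algebra_simps)
  then show ?thesis
    by (simp add: poly_ext_def coeff_map_poly derivation_0[OF assms] algebra_simps)
qed

lemma poly_ext_pCons_0:
  assumes "is_derivation D"
  shows "poly_ext D a b [:x:] = [:D x:]"
  by (simp add: poly_ext_def map_poly_pCons derivation_0[OF assms])

lemma poly_ext_X:
  assumes "is_derivation D"
  shows "poly_ext D a b [:0, 1:] = [:b, a:]"
  by (simp add: poly_ext_def map_poly_pCons derivation_0[OF assms] derivation_1[OF assms] pderiv_pCons)

lemma is_derivation_poly_ext:
  assumes D: "is_derivation D"
  shows "is_derivation (poly_ext D a b)"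
  unfolding is_derivation_def
proof (intro conjI allI)
  fix P Q
  note [simp] = derivation_simps[OF D]
  show "poly_ext D a b (P + Q) = poly_ext D a b P + poly_ext D a b Q"
    by (rule poly_eqI) (simp add: coeff_poly_ext[OF D] algebra_simps)
  have "map_poly D (P * Q) = map_poly D P * Q + P * map_poly D Q"
    by (rule poly_eqI)
      (simp add: coeff_map_poly coeff_mult derivation_sum[OF D] sum.distrib)
  then show "poly_ext D a b (P * Q) = poly_ext D a b P * Q + P * poly_ext D a b Q"
    by (simp only: poly_ext_def pderiv_mult) (simp add: algebra_simps)
qed

text \<open>The image of the variable is affine in the variable, so no higher term can arise. This
  is what forces the cofactors below to be constants.\<close>

lemma degree_poly_ext_le:
  assumes "is_derivation D"
  shows "degree (poly_ext D a b P) \<le> degree P"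
  by (rule degree_le) (simp add: coeff_poly_ext[OF assms] coeff_eq_0 derivation_0[OF assms])

section \<open>Rational solutions and invariant denominators\<close>

text \<open>
  The equation \<open>D t = l t + m\<close> is solved by \<open>t = P / Q\<close> in the fraction field; likewise \<open>semi_invariant\<close> says
  that \<open>D \<beta> = n c \<beta>\<close> has a solution \<open>\<beta> \<noteq> 0\<close> there, for some nonzero integer \<open>n\<close>.
\<close>

definition quotient_solvable :: "('a :: idom \<Rightarrow> 'a) \<Rightarrow> 'a \<Rightarrow> 'a \<Rightarrow> bool" where
  "quotient_solvable D l m \<longleftrightarrow> (\<exists>P Q. Q \<noteq> 0 \<and> Q * D P - P * D Q = l * P * Q + m * Q\<^sup>2)"

lemma quotient_solvableI:
  "Q \<noteq> 0 \<Longrightarrow> Q * D P - P * D Q = l * P * Q + m * Q\<^sup>2 \<Longrightarrow> quotient_solvable D l m"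
  unfolding quotient_solvable_def by blast

definition semi_invariant :: "('a :: idom \<Rightarrow> 'a) \<Rightarrow> 'a \<Rightarrow> bool" where
  "semi_invariant D c \<longleftrightarrow> (\<exists>P Q n. P \<noteq> 0 \<and> Q \<noteq> 0 \<and> n \<noteq> 0 \<and>
     Q * D P - P * D Q = of_int n * c * P * Q)"

text \<open>In \<open>Q * D P - P * D Q\<close> the terms containing the derivative of the common
  factor \<open>h\<close> cancel, so both sides are multiples of \<open>h\<^sup>2\<close> and the
  equation descends to the reduced fraction. There it says that \<open>q\<close> divides
  \<open>p * D q\<close>, and coprimality removes \<open>p\<close>. Geometrically, the poles of a
  solution form an invariant curve.\<close>

lemma coprime_quotient:
  fixes P Q :: "'a :: {idom, ring_gcd}"
  assumes D: "is_derivation D" and Q: "Q \<noteq> 0" and eq: "Q * D P - P * D Q = l * P * Q + m * Q\<^sup>2"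
  obtains p q where "coprime p q" "q \<noteq> 0" "P \<noteq> 0 \<Longrightarrow> p \<noteq> 0"
    "q * D p - p * D q = l * p * q + m * q\<^sup>2" "q dvd D q"
proof -
  have "gcd P Q \<noteq> 0" using Q by simp
  then obtain p q where pq: "P = p * gcd P Q" "Q = q * gcd P Q" "coprime p q"
    using gcd_coprime_exists by blast
  define h where "h = gcd P Q"
  have h: "h \<noteq> 0" and P: "P = p * h" and Qh: "Q = q * h"
    using pq \<open>gcd P Q \<noteq> 0\<close> by (simp_all add: h_def)
  have "h\<^sup>2 * (q * D p - p * D q) = h\<^sup>2 * (l * p * q + m * q\<^sup>2)"
    using eq unfolding P Qh derivation_mult[OF D] by (simp add: algebra_simps power2_eq_square)
  then have eq': "q * D p - p * D q = l * p * q + m * q\<^sup>2"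
    using h by simp
  then have "p * D q = q * (D p - l * p - m * q)"
    by (simp add: algebra_simps power2_eq_square)
  then have "q dvd p * D q" by simp
  then have "q dvd D q" using pq(3) by (simp add: coprime_dvd_mult_right_iff coprime_commute)
  with eq' pq(3) Qh Q P show ?thesis by (intro that[of p q]) auto
qed

text \<open>As the derivation does not raise the degree, the cofactor of \<open>P\<close> has degree
  zero. Divisibility thus becomes one first-order equation per coefficient, all with the same
  \<open>\<theta>\<close>.\<close>

lemma dvd_poly_ext:
  assumes D: "is_derivation D" and dvd: "P dvd poly_ext D a b P"
  obtains \<theta> where "\<And>n. D (coeff P n) + of_nat n * a * coeff P n + of_nat (Suc n) * b * coeff P (Suc n)
     = \<theta> * coeff P n"
proof -
  obtain R where R: "poly_ext D a b P = P * R" using dvd by blast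
  have "\<exists>\<theta>. poly_ext D a b P = smult \<theta> P"
  proof (cases "P = 0 \<or> R = 0")
    case True
    then show ?thesis using R by (intro exI[of _ 0]) auto
  next
    case False
    then have "degree P + degree R \<le> degree P"
      using degree_poly_ext_le[OF D, of a b P] R by (simp add: degree_mult_eq)
    then obtain \<theta> where "R = [:\<theta>:]" using degree_eq_zeroE by auto
    then show ?thesis using R by auto
  qed
  then show ?thesis using coeff_poly_ext[OF D] by (metis coeff_smult that)
qed

text \<open>The variable x satisfies \<open>D x = - c x\<close>, so the coefficient of
  \<open>x ^ j\<close> carries the weight \<open>j\<close>. If the denominator has two nonzero
  coefficients, eliminating their common cofactor leaves a semi-invariant whose exponent is the
  difference of the weights. Otherwise the denominator is \<open>q x ^ d\<close>, and the constant
  term of the Laurent polynomial \<open>P / Q\<close> solves the equation by homogeneity.\<close>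

lemma quotient_solvable_homogeneous_variable:
  fixes D :: "'a :: {factorial_ring_gcd, semiring_gcd_mult_normalize} \<Rightarrow> 'a"
  assumes D: "is_derivation D" and sol: "quotient_solvable (poly_ext D (- c) 0) [:l:] [:m:]"
  shows "quotient_solvable D l m \<or> semi_invariant D c"
proof -
  let ?E = "poly_ext D (- c) 0"
  have E: "is_derivation ?E" by (rule is_derivation_poly_ext[OF D])
  from sol obtain P0 Q0 where "Q0 \<noteq> 0" "Q0 * ?E P0 - P0 * ?E Q0 = [:l:] * P0 * Q0 + [:m:] * Q0\<^sup>2"
    unfolding quotient_solvable_def by blast
  then obtain P Q where Q: "Q \<noteq> 0" "Q dvd ?E Q"
    and eq: "Q * ?E P - P * ?E Q = [:l:] * P * Q + [:m:] * Q\<^sup>2"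
    using coprime_quotient[OF E] by metis
  obtain \<theta> where \<theta>: "D (coeff Q n) + of_nat n * - c * coeff Q n = \<theta> * coeff Q n" for n
    using dvd_poly_ext[OF D Q(2)] by force
  define d where "d = degree Q"
  define q where "q = coeff Q d"
  have q0: "q \<noteq> 0" using Q by (simp add: q_def d_def)
  show ?thesis
  proof (cases "\<exists>j<d. coeff Q j \<noteq> 0")
    case True
    then obtain j where j: "j < d" "coeff Q j \<noteq> 0" by blast
    let ?r = "coeff Q j"
    have "q * D ?r - ?r * D q = of_int (int j - int d) * c * ?r * q"
      using arg_cong[OF \<theta>[of j], of "\<lambda>x. q * x"] arg_cong[OF \<theta>[of d], of "\<lambda>x. ?r * x"]
      by (simp add: q_def algebra_simps)
    with j q0 show ?thesis
      unfolding semi_invariant_def by (intro disjI2 exI[of _ ?r] exI[of _ q] exI[of _ "int j - int d"]) auto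
  next
    case False
    have QX: "Q = monom q d"
    proof (rule poly_eqI)
      fix n show "coeff Q n = coeff (monom q d) n"
        using False by (cases n d rule: linorder_cases) (auto simp: q_def d_def coeff_eq_0)
    qed
    have EQ: "?E Q = monom (D q - of_nat d * c * q) d"
      by (rule poly_eqI) (simp add: QX coeff_poly_ext[OF D] derivation_0[OF D])
    \<comment> \<open>After clearing the denominators \<open>Q = q x ^ d\<close>, the constant term
      of the Laurent expansion sits in degree \<open>d + d\<close>.\<close>
    have m: "coeff (R * monom x d) (d + d) = x * coeff R d" for x R
      by (simp add: coeff_monom_mult mult.commute[of R])
    have mQ: "coeff (R * Q) (d + d) = q * coeff R d" for R
      by (simp add: QX m)
    have "coeff (?E P * Q) (d + d) - coeff (P * ?E Q) (d + d) =
        coeff (smult l P * Q) (d + d) + coeff (smult m Q * Q) (d + d)"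
      using arg_cong[OF eq, of "\<lambda>R. coeff R (d + d)"]
      by (simp add: mult.commute[of Q "?E P"] power2_eq_square)
    then have "q * coeff (?E P) d - (D q - of_nat d * c * q) * coeff P d = l * (q * coeff P d) + m * (q * q)"
      unfolding mQ EQ m by (simp add: q_def mult_ac)
    then have "q * D (coeff P d) - coeff P d * D q = l * coeff P d * q + m * q\<^sup>2"
      by (simp add: coeff_poly_ext[OF D] power2_eq_square algebra_simps)
    with q0 show ?thesis unfolding quotient_solvable_def by blast
  qed
qed

text \<open>If \<open>P\<close> divides its derivative, its roots solve
  \<open>D x = a x + b\<close>, and so does their mean since the equation is affine. In terms of the
  two leading coefficients the mean is \<open>- p / (N * q)\<close> with \<open>N\<close> the
  degree, which avoids splitting fields altogether.\<close>

lemma quotient_solvable_from_dvd: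
  fixes D :: "'a :: {idom, ring_char_0} \<Rightarrow> 'a"
  assumes D: "is_derivation D" and dvd: "P dvd poly_ext D a b P" and deg: "degree P \<noteq> 0"
  shows "quotient_solvable D a b"
proof -
  define n where "n = degree P - 1"
  have n: "degree P = Suc n" using deg by (simp add: n_def)
  define p q where "p = coeff P n" and "q = coeff P (Suc n)"
  have q0: "q \<noteq> 0" using n deg leading_coeff_0_iff[of P] by (auto simp: q_def)
  obtain \<theta> where \<theta>: "D (coeff P n) + of_nat n * a * coeff P n + of_nat (Suc n) * b * coeff P (Suc n)
     = \<theta> * coeff P n" for n using dvd_poly_ext[OF D dvd] by blast
  have 1: "D p + of_nat n * a * p + of_nat (Suc n) * b * q = \<theta> * p"
    using \<theta>[of n] by (simp add: p_def q_def)
  have 2: "D q + of_nat (Suc n) * a * q = \<theta> * q"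
    using \<theta>[of "Suc n"] n by (simp add: q_def coeff_eq_0)
  have 3: "q * D p - p * D q = a * q * p - of_nat (Suc n) * b * q\<^sup>2"
  proof -
    have *: "D p = \<theta> * p - of_nat n * a * p - of_nat (Suc n) * b * q" "D q = \<theta> * q - of_nat (Suc n) * a * q"
      unfolding 1[symmetric] 2[symmetric] by simp_all
    show ?thesis unfolding * by (simp add: algebra_simps power2_eq_square)
  qed
  define N :: 'a where "N = of_nat (Suc n)"
  have N: "N \<noteq> 0" "D N = 0" unfolding N_def using derivation_of_nat[OF D] by (simp_all del: of_nat_Suc)
  have "(N * q) * D (- p) - (- p) * D (N * q) = - N * (q * D p - p * D q)"
    by (simp add: derivation_simps[OF D] N algebra_simps)
  also have "\<dots> = a * (- p) * (N * q) + b * (N * q)\<^sup>2"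
    unfolding 3 N_def[symmetric] by (simp add: algebra_simps power2_eq_square)
  finally show ?thesis by (rule quotient_solvableI[rotated]) (use N q0 in simp)
qed

text \<open>In a reduced fraction whose derivative is a multiple of it, numerator and denominator
  both divide their own derivatives. Without a solution of the affine equation, only polynomials of
  degree zero can do so, and the fraction no longer contains the variable.\<close>

lemma semi_invariant_affine_variable:
  fixes D :: "'a :: {factorial_ring_gcd, semiring_gcd_mult_normalize, ring_char_0} \<Rightarrow> 'a"
  assumes D: "is_derivation D" and semi: "semi_invariant (poly_ext D (- c) (- c')) [:c:]"
  shows "semi_invariant D c \<or> quotient_solvable D (- c) (- c')"
proof (rule disjCI)
  assume no: "\<not> quotient_solvable D (- c) (- c')"
  let ?E = "poly_ext D (- c) (- c')"
  have E: "is_derivation ?E" by (rule is_derivation_poly_ext[OF D])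
  from semi obtain P0 Q0 n where PQ0: "P0 \<noteq> 0" "Q0 \<noteq> 0" "n \<noteq> 0"
    "Q0 * ?E P0 - P0 * ?E Q0 = of_int n * [:c:] * P0 * Q0 + 0 * Q0\<^sup>2"
    unfolding semi_invariant_def by auto
  then obtain P Q where Q: "P \<noteq> 0" "Q \<noteq> 0" "Q dvd ?E Q" "coprime P Q"
    and eq: "Q * ?E P - P * ?E Q = of_int n * [:c:] * P * Q + 0 * Q\<^sup>2"
    using coprime_quotient[OF E PQ0(2) PQ0(4)] by metis
  have "Q * ?E P = P * (?E Q + of_int n * [:c:] * Q)"
    using eq by (simp add: algebra_simps)
  then have "P dvd Q * ?E P" by simp
  then have "P dvd ?E P" using Q(4) by (simp add: coprime_dvd_mult_right_iff)
  then have "degree P = 0" "degree Q = 0"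
    using no Q(3) quotient_solvable_from_dvd[OF D] by blast+
  then obtain p q where pq: "P = [:p:]" "Q = [:q:]"
    by (metis degree_eq_zeroE)
  then have "p \<noteq> 0" "q \<noteq> 0" using Q by auto
  moreover have "q * D p - p * D q = of_int n * c * p * q"
    using eq by (simp add: pq poly_ext_pCons_0[OF D] of_int_poly mult_ac)
  ultimately show "semi_invariant D c"
    unfolding semi_invariant_def using PQ0(3) by blast
qed

text \<open>Unless the affine equation of the variable is solvable below, the denominator is free of
  the variable and the solution is a polynomial in it. A leading coefficient of degree
  \<open>d\<close> has weight \<open>d\<close>, to be compared with the weight 2 of the equation;
  any \<open>d\<close> other than 0 and 2 gives a semi-invariant. The case \<open>d = 2\<close> is
  refuted separately, so the solution is already free of the variable.\<close>

lemma riccati_affine_variable: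
  fixes D :: "'a :: {factorial_ring_gcd, semiring_gcd_mult_normalize, ring_char_0} \<Rightarrow> 'a"
  assumes D: "is_derivation D"
    and sol: "quotient_solvable (poly_ext D (- c) (- c')) [:- 2 * c:] [:- 2 * c'':]"
  shows "quotient_solvable D (- 2 * c) (- 2 * c'') \<or> quotient_solvable D (- c) (- c') \<or> semi_invariant D c"
proof (rule ccontr)
  assume contra: "\<not> ?thesis"
  then have nosemi: "\<not> semi_invariant D c" and no: "\<not> quotient_solvable D (- c) (- c')" by blast+
  let ?E = "poly_ext D (- c) (- c')"
  have E: "is_derivation ?E" by (rule is_derivation_poly_ext[OF D])
  from sol obtain P0 Q0 where PQ0: "Q0 \<noteq> 0"
    "Q0 * ?E P0 - P0 * ?E Q0 = [:- 2 * c:] * P0 * Q0 + [:- 2 * c'':] * Q0\<^sup>2"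
    unfolding quotient_solvable_def by blast
  then obtain P Q where Q: "Q \<noteq> 0" "Q dvd ?E Q"
    and eq: "Q * ?E P - P * ?E Q = [:- 2 * c:] * P * Q + [:- 2 * c'':] * Q\<^sup>2"
    using coprime_quotient[OF E PQ0] by metis
  have "degree Q = 0" using no Q(2) quotient_solvable_from_dvd[OF D] by blast
  then obtain q where q: "Q = [:q:]" by (metis degree_eq_zeroE)
  then have q0: "q \<noteq> 0" using Q by auto
  have cf: "q * (D (coeff P n) - of_nat n * c * coeff P n - of_nat (Suc n) * c' * coeff P (Suc n))
      - coeff P n * D q = - 2 * c * coeff P n * q - 2 * c'' * (if n = 0 then q\<^sup>2 else 0)" for n
  proof -
    have "coeff (Q * ?E P - P * ?E Q) n = coeff ([:- 2 * c:] * P * Q + [:- 2 * c'':] * Q\<^sup>2) n"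
      by (simp only: eq)
    then show ?thesis
      by (simp add: q poly_ext_pCons_0[OF D] coeff_poly_ext[OF D] power2_eq_square coeff_pCons
          algebra_simps split: nat.splits)
  qed
  define d where "d = degree P"
  define p where "p = coeff P d"
  \<comment> \<open>In degree zero the inhomogeneous term \<open>c''\<close> would enter.\<close>
  have top: "q * D p - p * D q = of_int (int d - 2) * c * p * q" if "d \<noteq> 0"
    using cf[of d] that by (simp add: coeff_eq_0 d_def p_def algebra_simps)
  have p0: "p \<noteq> 0" if "d \<noteq> 0" using that leading_coeff_0_iff[of P] by (auto simp: p_def d_def)
  have "d = 0 \<or> d = 2"
  proof (rule ccontr)
    assume "\<not> (d = 0 \<or> d = 2)"
    then have "semi_invariant D c"
      unfolding semi_invariant_def using top p0 q0
      by (intro exI[of _ p] exI[of _ q] exI[of _ "int d - 2"]) auto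
    with nosemi show False by contradiction
  qed
  moreover have "d \<noteq> 2"
  proof
    \<comment> \<open>Here the leading ratio is a constant of \<open>D\<close>. Completing the
      square, the vertex \<open>- p1 / (2 * p)\<close> of the quadratic turns out to solve the
      affine equation that was assumed unsolvable.\<close>
    assume d: "d = 2"
    define p1 where "p1 = coeff P 1"
    have "p = coeff P 2" using d by (simp add: p_def)
    then have 1: "q * (D p1 - c * p1 - 2 * c' * p) - p1 * D q = - 2 * c * p1 * q"
      using cf[of 1] by (simp add: p1_def numeral_2_eq_2)
    have 2: "q * D p = p * D q" using top d by simp
    have "q * (p * D p1 - p1 * D p) = p * (q * D p1) - p1 * (q * D p)"
      by (simp add: algebra_simps)
    also have "\<dots> = p * (q * D p1 - p1 * D q)"
      unfolding 2 by (simp add: algebra_simps)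
    also have "q * D p1 - p1 * D q = q * (2 * c' * p - c * p1)"
      using 1 by (simp add: algebra_simps)
    finally have "q * (p * D p1 - p1 * D p) = q * (p * (2 * c' * p - c * p1))"
      by (simp add: algebra_simps)
    then have 3: "p * D p1 - p1 * D p = p * (2 * c' * p - c * p1)"
      using q0 by simp
    have "(2 * p) * D (- p1) - (- p1) * D (2 * p) = - 2 * (p * D p1 - p1 * D p)"
      by (simp add: derivation_simps[OF D] algebra_simps)
    also have "\<dots> = - c * (- p1) * (2 * p) + (- c') * (2 * p)\<^sup>2"
      unfolding 3 by (simp add: algebra_simps power2_eq_square)
    finally have "quotient_solvable D (- c) (- c')"
      by (rule quotient_solvableI[rotated]) (use p0 d in simp)
    with no show False by contradiction
  qed
  ultimately have "coeff P 1 = 0" by (simp add: coeff_eq_0 d_def)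
  then have "q * D (coeff P 0) - coeff P 0 * D q = - 2 * c * coeff P 0 * q + - 2 * c'' * q\<^sup>2"
    using cf[of 0] by (simp add: algebra_simps)
  then have "quotient_solvable D (- 2 * c) (- 2 * c'')"
    unfolding quotient_solvable_def using q0 by blast
  with contra show False by blast
qed

text \<open>A variable \<open>y\<close> with \<open>D y = 0\<close> is specialised to a natural number at which the denominator does not vanish.\<close>

lemma poly_poly_ext_const:
  assumes D: "is_derivation D" and "D x = 0"
  shows "poly (poly_ext D 0 0 P) x = D (poly P x)"
proof (induction P)
  case (pCons a P)
  have "poly_ext D 0 0 (pCons a P) = pCons (D a) (poly_ext D 0 0 P)"
    by (simp add: poly_ext_def map_poly_pCons derivation_0[OF D])
  with pCons show ?case by (simp add: derivation_simps[OF D] assms(2))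
qed (simp add: poly_ext_def derivation_0[OF D])

lemma generic_constant:
  fixes P :: "'a :: {idom,ring_char_0} poly"
  assumes D: "is_derivation D" and P: "P \<noteq> 0"
  obtains x where "D x = 0" "poly P x \<noteq> 0"
proof -
  have "infinite (range (of_nat :: nat \<Rightarrow> 'a))"
    by (simp add: range_inj_infinite inj_of_nat)
  then have "\<not> range (of_nat :: nat \<Rightarrow> 'a) \<subseteq> {x. poly P x = 0}"
    using poly_roots_finite[OF P] finite_subset by blast
  then obtain n :: nat where "poly P (of_nat n) \<noteq> 0" by auto
  then show ?thesis using derivation_of_nat[OF D] by (intro that[of "of_nat n"]) auto
qed

lemma quotient_solvable_constant_variable:
  fixes D :: "'a :: {idom,ring_char_0} \<Rightarrow> 'a"
  assumes D: "is_derivation D" and sol: "quotient_solvable (poly_ext D 0 0) [:l:] [:m:]"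
  shows "quotient_solvable D l m"
proof -
  let ?E = "poly_ext D 0 0"
  from sol obtain P Q where Q: "Q \<noteq> 0" and eq: "Q * ?E P - P * ?E Q = [:l:] * P * Q + [:m:] * Q\<^sup>2"
    unfolding quotient_solvable_def by blast
  obtain x where x: "D x = 0" "poly Q x \<noteq> 0" using generic_constant[OF D Q] by blast
  have "poly (Q * ?E P - P * ?E Q) x = poly ([:l:] * P * Q + [:m:] * Q\<^sup>2) x" by (simp only: eq)
  then have "poly Q x * D (poly P x) - poly P x * D (poly Q x) = l * poly P x * poly Q x + m * (poly Q x)\<^sup>2"
    by (simp add: poly_poly_ext_const[OF D x(1)])
  with x show ?thesis unfolding quotient_solvable_def by blast
qed

lemma semi_invariant_constant_variable:
  fixes D :: "'a :: {idom,ring_char_0} \<Rightarrow> 'a"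
  assumes D: "is_derivation D" and sol: "semi_invariant (poly_ext D 0 0) [:c:]"
  shows "semi_invariant D c"
proof -
  let ?E = "poly_ext D 0 0"
  from sol obtain P Q n where PQ: "P \<noteq> 0" "Q \<noteq> 0" and n: "n \<noteq> 0"
    and eq: "Q * ?E P - P * ?E Q = of_int n * [:c:] * P * Q"
    unfolding semi_invariant_def by blast
  obtain x where x: "D x = 0" "poly (P * Q) x \<noteq> 0" using generic_constant[OF D, of "P * Q"] PQ by auto
  have "poly (Q * ?E P - P * ?E Q) x = poly (of_int n * [:c:] * P * Q) x" by (simp only: eq)
  then have "poly Q x * D (poly P x) - poly P x * D (poly Q x) = of_int n * c * poly P x * poly Q x"
    by (simp add: poly_poly_ext_const[OF D x(1)] of_int_poly)
  with x n show ?thesis unfolding semi_invariant_def by (metis mult_eq_0_iff poly_mult)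
qed

text \<open>Multiplying the derivative of \<open>A\<close> by the leading coefficient and
  subtracting a multiple of \<open>A\<close> cancels the top term, as in pseudo-division. The
  difference stays in \<open>I\<close> and has smaller degree, hence vanishes; the conclusion lists
  its coefficients.\<close>

lemma minimal_relation:
  assumes D: "is_derivation D"
    and comb: "\<And>P Q x y. P \<in> I \<Longrightarrow> Q \<in> I \<Longrightarrow> smult x P - smult y Q \<in> I"
    and ext: "\<And>P. P \<in> I \<Longrightarrow> poly_ext D a b P \<in> I"
    and A: "A \<in> I" and min: "\<And>B. B \<in> I \<Longrightarrow> B \<noteq> 0 \<Longrightarrow> degree A \<le> degree B"
  defines "n \<equiv> degree A"
  shows "coeff A n * (D (coeff A i) + of_nat i * a * coeff A i + of_nat (Suc i) * b * coeff A (Suc i)) =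
    (D (coeff A n) + of_nat n * a * coeff A n) * coeff A i"
proof -
  \<comment> \<open>The coefficient of degree \<open>n\<close> in the derivative of
    \<open>A\<close>; nothing comes down from degree \<open>n + 1\<close>.\<close>
  define x where "x = D (coeff A n) + of_nat n * a * coeff A n"
  define B where "B = smult (coeff A n) (poly_ext D a b A) - smult x A"
  have "B \<in> I" unfolding B_def by (intro comb ext A)
  have B: "coeff B i = coeff A n * (D (coeff A i) + of_nat i * a * coeff A i
       + of_nat (Suc i) * b * coeff A (Suc i)) - x * coeff A i" for i
    by (simp add: B_def coeff_poly_ext[OF D])
  have "coeff B i = 0" if "i \<ge> n" for i
    using that by (cases "i = n") (auto simp: B n_def x_def coeff_eq_0 derivation_0[OF D])
  then have "degree B < n \<or> B = 0"
    by (metis leading_coeff_0_iff not_le)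
  then have "B = 0" using min[OF \<open>B \<in> I\<close>] by (force simp: n_def)
  then show ?thesis using B[of i] by (simp add: x_def)
qed

text \<open>The mean of the roots once more: the minimal relation divides its derivative up to its
  leading coefficient, and \<open>- p / (N * q)\<close> is the solution. The assumption on constants
  guarantees that a minimal relation really contains the variable.\<close>

lemma quotient_solvable_minimal_relation:
  fixes D :: "'a :: {idom,ring_char_0} \<Rightarrow> 'a"
  assumes D: "is_derivation D"
    and comb: "\<And>P Q x y. P \<in> I \<Longrightarrow> Q \<in> I \<Longrightarrow> smult x P - smult y Q \<in> I"
    and ext: "\<And>P. P \<in> I \<Longrightarrow> poly_ext D a b P \<in> I"
    and A: "A \<in> I" "A \<noteq> 0" and const: "\<And>x. [:x:] \<in> I \<Longrightarrow> x = 0"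
  shows "quotient_solvable D a b"
proof -
  define d where "d = (LEAST d. \<exists>P\<in>I. P \<noteq> 0 \<and> degree P = d)"
  have "\<exists>P\<in>I. P \<noteq> 0 \<and> degree P = d" unfolding d_def using A by (intro LeastI) blast
  then obtain P where P: "P \<in> I" "P \<noteq> 0" "degree P = d" by blast
  have min: "degree P \<le> degree B" if "B \<in> I" "B \<noteq> 0" for B
    unfolding P(3) d_def using that by (intro Least_le) blast
  note rel = minimal_relation[OF D comb ext P(1) min, of "degree P - 1"]
  have "degree P \<noteq> 0" using P const by (metis degree_eq_zeroE pCons_0_0)
  then obtain n where n: "degree P = Suc n" using not0_implies_Suc by blast
  define p q where "p = coeff P n" and "q = coeff P (Suc n)"
  have q0: "q \<noteq> 0" using n P leading_coeff_0_iff[of P] by (auto simp: q_def)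
  define N :: 'a where "N = of_nat (Suc n)"
  have N: "N \<noteq> 0" "D N = 0" unfolding N_def using derivation_of_nat[OF D] by (simp_all del: of_nat_Suc)
  have "q * (D p + (N - 1) * a * p + N * b * q) = (D q + N * a * q) * p"
    using rel by (simp add: n p_def q_def N_def)
  then have 3: "q * D p - p * D q = a * q * p - N * b * q\<^sup>2"
    by (simp add: algebra_simps power2_eq_square)
  have "(N * q) * D (- p) - (- p) * D (N * q) = - N * (q * D p - p * D q)"
    by (simp add: derivation_simps[OF D] N algebra_simps)
  also have "\<dots> = a * (- p) * (N * q) + b * (N * q)\<^sup>2"
    unfolding 3 by (simp add: algebra_simps power2_eq_square)
  finally show ?thesis by (rule quotient_solvableI[rotated]) (use N q0 in simp)
qed

section \<open>Changes of the unknown and of the variables\<close>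

lemma quotient_solvable_hom:
  assumes hom: "\<And>x y. \<sigma> (x + y) = \<sigma> x + \<sigma> y" "\<And>x y. \<sigma> (x * y) = \<sigma> x * \<sigma> y"
    and inj: "\<And>x. \<sigma> x = 0 \<Longrightarrow> x = 0" and D: "\<And>x. \<sigma> (D x) = D' (\<sigma> x)"
    and sol: "quotient_solvable D l m"
  shows "quotient_solvable D' (\<sigma> l) (\<sigma> m)"
proof -
  obtain P Q where Q: "Q \<noteq> 0" and eq: "Q * D P - P * D Q = l * P * Q + m * Q\<^sup>2"
    using sol unfolding quotient_solvable_def by blast
  \<comment> \<open>Only sums and products are known to be preserved by \<open>\<sigma>\<close>, so
    the difference is moved to the other side first.\<close>
  have "Q * D P = l * P * Q + m * (Q * Q) + P * D Q"
    using eq by (simp add: algebra_simps power2_eq_square)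
  from arg_cong[OF this, of \<sigma>]
  have "\<sigma> Q * D' (\<sigma> P) - \<sigma> P * D' (\<sigma> Q) = \<sigma> l * \<sigma> P * \<sigma> Q + \<sigma> m * (\<sigma> Q)\<^sup>2"
    by (simp add: hom D power2_eq_square)
  with Q inj show ?thesis by (intro quotient_solvableI) auto
qed

text \<open>If \<open>T\<close> solves \<open>D T = l T + m u\<close>, then \<open>T / u\<close>
  solves \<open>D t = (l - a) t + m\<close>. With \<open>u = y\<^sub>1\<close> this passes from
  \<open>y\<^sub>2\<close> and \<open>y\<^sub>3\<close> to their quotients by
  \<open>y\<^sub>1\<close>.\<close>

lemma quotient_solvable_divide:
  assumes D: "is_derivation D" and u: "u \<noteq> 0" "D u = a * u" and sol: "quotient_solvable D l (m * u)"
  shows "quotient_solvable D (l - a) m"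
proof -
  obtain P Q where Q: "Q \<noteq> 0" and eq: "Q * D P - P * D Q = l * P * Q + m * u * Q\<^sup>2"
    using sol unfolding quotient_solvable_def by blast
  have "(u * Q) * D P - P * D (u * Q) = u * (Q * D P - P * D Q) - a * P * (u * Q)"
    by (simp add: derivation_mult[OF D] u algebra_simps)
  also have "\<dots> = (l - a) * P * (u * Q) + m * (u * Q)\<^sup>2"
    unfolding eq by (simp add: algebra_simps power2_eq_square)
  finally show ?thesis by (rule quotient_solvableI[rotated]) (use u Q in simp)
qed

text \<open>The new unknown is \<open>k T + s\<close> with a constant \<open>k\<close>; it serves to
  remove unwanted variables from the inhomogeneous term.\<close>

lemma quotient_solvable_shift:
  assumes D: "is_derivation D" and sol: "quotient_solvable D l m" and s: "k * m + D s - l * s = m'"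
    and k: "D k = 0"
  shows "quotient_solvable D l m'"
proof -
  obtain P Q where Q: "Q \<noteq> 0" and eq: "Q * D P - P * D Q = l * P * Q + m * Q\<^sup>2"
    using sol unfolding quotient_solvable_def by blast
  have "Q * D (k * P + s * Q) - (k * P + s * Q) * D Q = k * (Q * D P - P * D Q) + Q\<^sup>2 * D s"
    by (simp add: derivation_add[OF D] derivation_mult[OF D] k algebra_simps power2_eq_square)
  also have "\<dots> = l * (k * P + s * Q) * Q + m' * Q\<^sup>2"
    unfolding eq s[symmetric] by (simp add: algebra_simps power2_eq_square)
  finally show ?thesis by (rule quotient_solvableI[rotated]) (rule Q)
qed

text \<open>
  The substitution \<open>v = s u\<close> with the roles of \<open>u\<close> and the new variable \<open>s\<close> exchanged:
  \<open>R[u][v] \<rightarrow> R[s][u]\<close>.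
\<close>

definition poly_swap :: "'a :: idom poly poly \<Rightarrow> 'a poly poly" where
  "poly_swap P = poly (map_poly (map_poly (\<lambda>r. [:r:])) P) [:0, [:0, 1:]:]"

lemma map_poly_hom:
  fixes h :: "'a :: comm_ring_1 \<Rightarrow> 'b :: comm_ring_1"
  assumes h: "\<And>x y. h (x + y) = h x + h y" "\<And>x y. h (x * y) = h x * h y"
  shows "map_poly h (P + Q) = map_poly h P + map_poly h Q"
    and "map_poly h (P * Q) = map_poly h P * map_poly h Q"
proof -
  have h0: "h 0 = 0" using h(1)[of 0 0] by (simp only: add_0_left add_cancel_right_right)
  have sum: "h (sum f A) = (\<Sum>i\<in>A. h (f i))" for f :: "nat \<Rightarrow> 'a" and A
    by (induction A rule: infinite_finite_induct) (simp_all add: h h0)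
  show "map_poly h (P + Q) = map_poly h P + map_poly h Q"
    by (rule poly_eqI) (simp add: coeff_map_poly h h0)
  show "map_poly h (P * Q) = map_poly h P * map_poly h Q"
    by (rule poly_eqI) (simp add: coeff_map_poly coeff_mult sum h h0)
qed

lemma poly_swap_add: "poly_swap (P + Q) = poly_swap P + poly_swap Q"
  and poly_swap_mult: "poly_swap (P * Q) = poly_swap P * poly_swap Q"
  unfolding poly_swap_def
  by (simp_all add: map_poly_hom[of "map_poly (\<lambda>r. [:r:])"] map_poly_hom[of "\<lambda>r. [:r:]"])

lemma poly_swap_pCons:
  "poly_swap (pCons p P) = map_poly (\<lambda>r. [:r:]) p + [:0, [:0, 1:]:] * poly_swap P"
  unfolding poly_swap_def by (subst map_poly_pCons) simp_all

lemma poly_swap_0 [simp]: "poly_swap 0 = 0"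
  by (simp add: poly_swap_def)

text \<open>The monomial \<open>u ^ n * v ^ k\<close> becomes \<open>s ^ k * u ^ (n + k)\<close>, so
  distinct monomials stay distinct. Injectivity of the substitution is read off from this.\<close>

lemma poly_swap_coeff:
  "coeff (coeff (poly_swap P) (n + k)) k = coeff (coeff P k) n"
proof (induction P arbitrary: k n)
  case (pCons p P)
  have "coeff ([:0, [:0, 1:]:] * poly_swap P) m = (case m of 0 \<Rightarrow> 0 | Suc i \<Rightarrow> [:0, 1:] * coeff (poly_swap P) i)" for m
    by (simp add: coeff_pCons split: nat.splits)
  then show ?case
  proof (cases k)
    case 0
    then show ?thesis
      by (simp add: poly_swap_pCons coeff_pCons coeff_map_poly split: nat.splits)
  next
    case (Suc j)
    then show ?thesis using pCons.IH[of n j]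
      by (simp add: poly_swap_pCons coeff_pCons coeff_map_poly)
  qed
qed simp

lemma poly_swap_eq_0: "poly_swap P = 0 \<Longrightarrow> P = 0"
  using poly_swap_coeff[of P] by (metis coeff_0 poly_eqI)

text \<open>With \<open>D u = - c u\<close> and \<open>D v = - 2 c v - c' u\<close>, the quotient
  \<open>s = v / u\<close> satisfies \<open>D s = - c s - c'\<close>, which no longer involves
  \<open>u\<close>. Hence \<open>s\<close> can be the inner variable, and the homogeneous variable
  \<open>u\<close> becomes the outer one, which is eliminated first.\<close>

lemma poly_swap_poly_ext:
  fixes D :: "'a :: idom \<Rightarrow> 'a"
  assumes D: "is_derivation D"
  shows "poly_swap (poly_ext (poly_ext D (- c) 0) [:- 2 * c:] [:0, - c':] P) =
    poly_ext (poly_ext D (- c) (- c')) [:- c:] 0 (poly_swap P)"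
proof -
  let ?E1 = "poly_ext D (- c) 0"
  let ?E2 = "poly_ext ?E1 [:- 2 * c:] [:0, - c':]"
  let ?F1 = "poly_ext D (- c) (- c')"
  let ?F2 = "poly_ext ?F1 [:- c:] 0"
  let ?h = "map_poly (\<lambda>r. [:r:]) :: 'a poly \<Rightarrow> _"
  note E1 = is_derivation_poly_ext[OF D, of "- c" 0]
  note E2 = is_derivation_poly_ext[OF E1, of "[:- 2 * c:]" "[:0, - c':]"]
  note F1 = is_derivation_poly_ext[OF D, of "- c" "- c'"]
  note F2 = is_derivation_poly_ext[OF F1, of "[:- c:]" 0]
  have h: "?h (?E1 p) = ?F2 (?h p)" for p
    by (rule poly_eqI)
      (simp add: coeff_map_poly coeff_poly_ext[OF D] coeff_poly_ext[OF F1] poly_ext_pCons_0[OF D]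
        derivation_0[OF D] of_nat_poly)
  show ?thesis
  proof (induction P)
    case (pCons p P)
    have X: "pCons p P = [:p:] + [:0, 1:] * P" by simp
    have sX: "poly_swap [:0, 1:] = [:0, [:0, 1:]:]"
      by (simp add: poly_swap_pCons one_pCons map_poly_pCons)
    have sc: "poly_swap [:p:] = ?h p" for p by (simp add: poly_swap_pCons)
    have c2: "[:[:0, - c':], [:- 2 * c:]:] = [:[:0, - c':]:] + [:[:-2 * c:]:] * [:0, 1:]"
      by simp
    \<comment> \<open>Coefficients are dealt with by \<open>h\<close>; the remaining generator
      \<open>v\<close> is compared with \<open>s * u\<close>.\<close>
    have "?F2 [:0, [:0, 1:]:] = poly_swap (?E2 [:0, 1:])"
      unfolding poly_ext_X[OF E1] c2 poly_swap_add poly_swap_mult sX sc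
      by (intro poly_eqI) (simp add: coeff_poly_ext[OF F1] coeff_pCons poly_ext_X[OF D]
          derivation_0[OF F1] map_poly_pCons split: nat.splits)
    then show ?case unfolding X
      by (simp only: derivation_add[OF E2] derivation_mult[OF E2] poly_swap_add poly_swap_mult
          derivation_add[OF F2] derivation_mult[OF F2] pCons.IH sX sc poly_ext_pCons_0[OF E1] h)
  qed (simp add: poly_ext_def)
qed

lemma quotient_solvable_field:
  fixes D :: "'a :: field \<Rightarrow> 'a"
  assumes D: "is_derivation D" and sol: "quotient_solvable D l m"
  obtains t where "D t = l * t + m"
proof -
  obtain P Q where Q: "Q \<noteq> 0" and eq: "Q * D P - P * D Q = l * P * Q + m * Q\<^sup>2"
    using sol unfolding quotient_solvable_def by blast
  define t where "t = P / Q"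
  have P: "P = t * Q" using Q by (simp add: t_def)
  have "Q\<^sup>2 * D t = Q\<^sup>2 * (l * t + m)"
    using eq unfolding P derivation_mult[OF D] by (simp add: algebra_simps power2_eq_square)
  then show ?thesis using Q that by simp
qed

text \<open>Exchanging numerator and denominator reverses the sign of the exponent. The sign chosen
  here is that of \<open>D (y\<^sub>1\<^sup>n)\<close>, so that \<open>\<beta>\<close> can stand for
  a power of \<open>\<delta>\<^sub>2 \<omega>\<close>.\<close>

lemma semi_invariant_field:
  fixes D :: "'a :: field \<Rightarrow> 'a"
  assumes D: "is_derivation D" and sol: "semi_invariant D c"
  obtains \<beta> n where "\<beta> \<noteq> 0" "n > (0 :: nat)" "D \<beta> = - of_nat n * c * \<beta>"
proof -
  obtain P Q n where PQ: "P \<noteq> 0" "Q \<noteq> 0" "n \<noteq> 0" and eq: "Q * D P - P * D Q = of_int n * c * P * Q"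
    using sol unfolding semi_invariant_def by blast
  have key: "\<exists>\<beta> k. \<beta> \<noteq> 0 \<and> k > (0 :: nat) \<and> D \<beta> = - of_nat k * c * \<beta>"
    if PQ: "P \<noteq> 0" "Q \<noteq> 0" "n < 0" and eq: "Q * D P - P * D Q = of_int n * c * P * Q" for P Q n
  proof -
    define t where "t = P / Q"
    have P: "P = t * Q" using PQ by (simp add: t_def)
    have "Q\<^sup>2 * D t = Q\<^sup>2 * (of_int n * c * t)"
      using eq unfolding P derivation_mult[OF D] by (simp add: algebra_simps power2_eq_square)
    then have "D t = of_int n * c * t" using PQ by simp
    moreover have "of_int n = - (of_nat (nat (- n)) :: 'a)" using PQ(3) by simp
    ultimately have "D t = - of_nat (nat (- n)) * c * t" by simp
    moreover have "t \<noteq> 0" "nat (- n) > 0" using PQ by (simp_all add: t_def)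
    ultimately show ?thesis by blast
  qed
  show thesis
  proof (cases "n < 0")
    case True
    then show ?thesis using key[OF PQ(1,2) _ eq] that by blast
  next
    case False
    have "P * D Q - Q * D P = of_int (- n) * c * Q * P"
      using eq by (simp add: algebra_simps)
    then show ?thesis using key[OF PQ(2,1), of "- n"] PQ(3) False that by force
  qed
qed

section \<open>Solutions derived from one another by the second derivation\<close>

context
  fixes D \<delta> :: "'a :: field_char_0 \<Rightarrow> 'a" and c :: 'a
  assumes D: "is_derivation D" and \<delta>: "is_derivation \<delta>"
    and comm: "\<And>x. D (\<delta> x) = \<delta> (D x) - c * \<delta> x"
begin

text \<open>The candidate is the logarithmic derivative of the n-th root of \<open>\<beta>\<close>,
  which corresponds to \<open>y\<^sub>2 / y\<^sub>1\<close> when \<open>\<beta>\<close> corresponds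
  to \<open>y\<^sub>1\<^sup>n\<close>.\<close>

lemma log_derivative_solution:
  assumes \<beta>: "\<beta> \<noteq> 0" and n: "n > 0" and D\<beta>: "D \<beta> = - of_nat n * c * \<beta>"
  shows "D (\<delta> \<beta> / (of_nat n * \<beta>)) = - c * (\<delta> \<beta> / (of_nat n * \<beta>)) - \<delta> c"
proof -
  define t where "t = \<delta> \<beta> / (of_nat n * \<beta>)"
  have t: "\<delta> \<beta> = of_nat n * t * \<beta>" using \<beta> n by (simp add: t_def)
  have "of_nat n * (D t * \<beta> + t * D \<beta>) = D (of_nat n * t * \<beta>)"
    by (simp add: derivation_simps[OF D] algebra_simps)
  also have "\<dots> = \<delta> (- of_nat n * c * \<beta>) - c * \<delta> \<beta>"
    unfolding t[symmetric] by (simp only: comm D\<beta>)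
  also have "\<dots> = - of_nat n * (\<delta> c * \<beta> + c * \<delta> \<beta>) - c * \<delta> \<beta>"
    by (simp add: derivation_simps[OF \<delta>] algebra_simps)
  finally have "of_nat n * \<beta> * D t = of_nat n * \<beta> * (- c * t - \<delta> c)"
    unfolding D\<beta> unfolding t by (simp add: algebra_simps eq_neg_iff_add_eq_0)
  then show ?thesis using \<beta> n by (simp add: t_def)
qed

text \<open>For \<open>t = y\<^sub>2 / y\<^sub>1\<close> one has
  \<open>y\<^sub>3 / y\<^sub>1 = \<delta> t + t\<^sup>2\<close>, so
  \<open>2 y\<^sub>3 / y\<^sub>1 - 3 t\<^sup>2\<close> equals
  \<open>2 \<delta> t - t\<^sup>2\<close>: the expression is twice the Schwarzian derivative written
  in \<open>t\<close>.\<close>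

lemma riccati_solution:
  assumes "D t = - c * t - \<delta> c"
  shows "D (2 * \<delta> t - t\<^sup>2) = - 2 * c * (2 * \<delta> t - t\<^sup>2) - 2 * \<delta> (\<delta> c)"
proof -
  have "D (2 * \<delta> t - t\<^sup>2) = 2 * (\<delta> (D t) - c * \<delta> t) - 2 * t * D t"
    by (simp add: derivation_simps[OF D] comm power2_eq_square algebra_simps)
  then show ?thesis
    unfolding assms by (simp add: derivation_simps[OF \<delta>] power2_eq_square algebra_simps)
qed

end

section \<open>Analytic functions of two variables\<close>

text \<open>By Osgood's lemma \<open>hol2\<close> amounts to \<open>analytic2_on\<close>, but it is much easier to verify.\<close>

definition hol2 :: "(complex \<times> complex \<Rightarrow> complex) \<Rightarrow> (complex \<times> complex) set \<Rightarrow> bool" where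
  "hol2 u S \<longleftrightarrow> open S \<and> continuous_on S u \<and>
     (\<forall>z\<in>S. (\<lambda>w. u (w, snd z)) field_differentiable at (fst z) \<and>
             (\<lambda>w. u (fst z, w)) field_differentiable at (snd z))"

lemma hol2_open: "hol2 u S \<Longrightarrow> open S"
  and hol2_continuous: "hol2 u S \<Longrightarrow> continuous_on S u"
  by (simp_all add: hol2_def)

lemma hol2_has_derivative1:
  assumes "hol2 u S" "(a, b) \<in> S"
  shows "((\<lambda>w. u (w, b)) has_field_derivative pd1 u (a, b)) (at a)"
proof -
  have "(\<lambda>w. u (w, b)) field_differentiable at a" using assms by (force simp: hol2_def)
  then show ?thesis by (simp add: pd1_def field_differentiable_derivI)
qed

lemma hol2_has_derivative2:
  assumes "hol2 u S" "(a, b) \<in> S"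
  shows "((\<lambda>w. u (a, w)) has_field_derivative pd2 u (a, b)) (at b)"
proof -
  have "(\<lambda>w. u (a, w)) field_differentiable at b" using assms by (force simp: hol2_def)
  then show ?thesis by (simp add: pd2_def field_differentiable_derivI)
qed

lemma pd1_eqI: "((\<lambda>w. u (w, b)) has_field_derivative d) (at a) \<Longrightarrow> pd1 u (a, b) = d"
  by (simp add: pd1_def DERIV_imp_deriv)

lemma pd2_eqI: "((\<lambda>w. u (a, w)) has_field_derivative d) (at b) \<Longrightarrow> pd2 u (a, b) = d"
  by (simp add: pd2_def DERIV_imp_deriv)

lemma hol2I:
  assumes "open S" "continuous_on S u"
    and "\<And>a b. (a, b) \<in> S \<Longrightarrow> \<exists>d. ((\<lambda>w. u (w, b)) has_field_derivative d) (at a)"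
    and "\<And>a b. (a, b) \<in> S \<Longrightarrow> \<exists>d. ((\<lambda>w. u (a, w)) has_field_derivative d) (at b)"
  shows "hol2 u S"
  using assms by (auto simp: hol2_def field_differentiable_def)

lemma hol2_subset: "hol2 u S \<Longrightarrow> T \<subseteq> S \<Longrightarrow> open T \<Longrightarrow> hol2 u T"
  unfolding hol2_def using continuous_on_subset by blast

lemma slice_nbhd:
  fixes S :: "('a :: topological_space \<times> 'b :: topological_space) set"
  assumes "open S" "(a, b) \<in> S"
  shows "eventually (\<lambda>w. (w, b) \<in> S) (nhds a)" "eventually (\<lambda>w. (a, w) \<in> S) (nhds b)"
proof -
  obtain A B where AB: "open A" "open B" "a \<in> A" "b \<in> B" "A \<times> B \<subseteq> S"
    using assms open_prod_elim by (metis mem_Sigma_iff)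
  show "eventually (\<lambda>w. (w, b) \<in> S) (nhds a)" "eventually (\<lambda>w. (a, w) \<in> S) (nhds b)"
    unfolding eventually_nhds using AB by blast+
qed

lemma pd_cong:
  assumes "open S" "\<And>z. z \<in> S \<Longrightarrow> u z = v z" "z \<in> S"
  shows "pd1 u z = pd1 v z" "pd2 u z = pd2 v z"
proof -
  obtain a b where z: "z = (a, b)" by (cases z)
  show "pd1 u z = pd1 v z" unfolding pd1_def z using assms slice_nbhd(1)[OF assms(1), of a b]
    by (intro deriv_cong_ev) (auto simp: z elim: eventually_mono)
  show "pd2 u z = pd2 v z" unfolding pd2_def z using assms slice_nbhd(2)[OF assms(1), of a b]
    by (intro deriv_cong_ev) (auto simp: z elim: eventually_mono)
qed

lemma has_derivative_slice_cong:
  assumes "open S" "\<And>z. z \<in> S \<Longrightarrow> u z = v z" "(a, b) \<in> S"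
  shows "((\<lambda>w. u (w, b)) has_field_derivative d) (at a) \<longleftrightarrow> ((\<lambda>w. v (w, b)) has_field_derivative d) (at a)"
    and "((\<lambda>w. u (a, w)) has_field_derivative d) (at b) \<longleftrightarrow> ((\<lambda>w. v (a, w)) has_field_derivative d) (at b)"
  by (rule DERIV_cong_ev[OF refl _ refl], rule eventually_mono[OF slice_nbhd(1)[OF assms(1,3)]], erule assms(2))
    (rule DERIV_cong_ev[OF refl _ refl], rule eventually_mono[OF slice_nbhd(2)[OF assms(1,3)]], erule assms(2))

lemma hol2_cong:
  assumes "\<And>z. z \<in> S \<Longrightarrow> u z = v z"
  shows "hol2 u S \<longleftrightarrow> hol2 v S"
proof -
  have "hol2 v S" if u: "hol2 u S" and eq: "\<And>z. z \<in> S \<Longrightarrow> u z = v z" for u v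
  proof (rule hol2I)
    show S: "open S" using u by (rule hol2_open)
    show "continuous_on S v" using hol2_continuous[OF u] eq by (simp cong: continuous_on_cong)
    show "\<exists>d. ((\<lambda>w. v (w, b)) has_field_derivative d) (at a)" if "(a, b) \<in> S" for a b
      using hol2_has_derivative1[OF u that] has_derivative_slice_cong(1)[of S u v, OF S _ that] eq by blast
    show "\<exists>d. ((\<lambda>w. v (a, w)) has_field_derivative d) (at b)" if "(a, b) \<in> S" for a b
      using hol2_has_derivative2[OF u that] has_derivative_slice_cong(2)[of S u v, OF S _ that] eq by blast
  qed
  then show ?thesis using assms by metis
qed

lemma hol2_const: "open S \<Longrightarrow> hol2 (\<lambda>z. c) S"
  and hol2_fst: "open S \<Longrightarrow> hol2 fst S"
  and hol2_snd: "open S \<Longrightarrow> hol2 snd S"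
  by (auto simp: hol2_def intro!: continuous_intros)

lemma hol2_add: "hol2 u S \<Longrightarrow> hol2 v S \<Longrightarrow> hol2 (\<lambda>z. u z + v z) S"
  and hol2_mult: "hol2 u S \<Longrightarrow> hol2 v S \<Longrightarrow> hol2 (\<lambda>z. u z * v z) S"
  and hol2_minus: "hol2 u S \<Longrightarrow> hol2 (\<lambda>z. - u z) S"
  and hol2_diff: "hol2 u S \<Longrightarrow> hol2 v S \<Longrightarrow> hol2 (\<lambda>z. u z - v z) S"
  by (auto simp: hol2_def intro!: continuous_intros field_differentiable_add field_differentiable_mult
      field_differentiable_minus field_differentiable_diff)

lemma hol2_divide:
  "hol2 u S \<Longrightarrow> hol2 v S \<Longrightarrow> (\<And>z. z \<in> S \<Longrightarrow> v z \<noteq> 0) \<Longrightarrow> hol2 (\<lambda>z. u z / v z) S"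
  by (auto simp: hol2_def intro!: continuous_intros field_differentiable_divide)

lemma hol2_power: "hol2 u S \<Longrightarrow> hol2 (\<lambda>z. u z ^ n) S"
  by (induction n) (auto intro: hol2_const hol2_mult hol2_open)

lemma hol2_sum:
  "open S \<Longrightarrow> (\<And>i. i \<in> I \<Longrightarrow> hol2 (f i) S) \<Longrightarrow> hol2 (\<lambda>z. \<Sum>i\<in>I. f i z) S"
  by (induction I rule: infinite_finite_induct) (auto intro: hol2_const hol2_add)

lemma hol2_prod:
  "open S \<Longrightarrow> (\<And>i. i \<in> I \<Longrightarrow> hol2 (f i) S) \<Longrightarrow> hol2 (\<lambda>z. \<Prod>i\<in>I. f i z) S"
  by (induction I rule: infinite_finite_induct) (auto intro: hol2_const hol2_mult)

lemma hol2_local: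
  assumes "\<And>p. p \<in> S \<Longrightarrow> \<exists>T. p \<in> T \<and> T \<subseteq> S \<and> hol2 u T"
  shows "hol2 u S"
proof -
  obtain T where T: "\<And>p. p \<in> S \<Longrightarrow> p \<in> T p \<and> T p \<subseteq> S \<and> hol2 u (T p)" using assms by metis
  then have "S = (\<Union>p\<in>S. T p)" by blast
  moreover have "open (\<Union>p\<in>S. T p)" "continuous_on (\<Union>p\<in>S. T p) u"
    using T by (auto simp: hol2_def intro!: continuous_on_open_UN)
  ultimately show ?thesis using T by (auto simp: hol2_def)
qed

lemma hol2_swap:
  assumes "hol2 u S"
  shows "hol2 (\<lambda>z. u (snd z, fst z)) {z. (snd z, fst z) \<in> S}"
proof (rule hol2I)
  have "{z. (snd z, fst z) \<in> S} = (\<lambda>z. (snd z, fst z)) -` S" by auto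
  moreover have "open ((\<lambda>z. (snd z, fst z)) -` S)" using hol2_open[OF assms]
    by (intro open_vimage) (auto intro!: continuous_intros)
  ultimately show "open {z. (snd z, fst z) \<in> S}" by simp
  show "continuous_on {z. (snd z, fst z) \<in> S} (\<lambda>z. u (snd z, fst z))"
    by (rule continuous_on_compose2[OF hol2_continuous[OF assms]]) (auto intro!: continuous_intros)
qed (simp, blast intro: hol2_has_derivative1[OF assms] hol2_has_derivative2[OF assms])+

lemma pd_swap: "pd1 (\<lambda>z. u (snd z, fst z)) z = pd2 u (snd z, fst z)"
  "pd2 (\<lambda>z. u (snd z, fst z)) z = pd1 u (snd z, fst z)"
  by (simp_all add: pd1_def pd2_def)

section \<open>Polydiscs, locally uniform limits and partial derivatives\<close>

definition cbidisc :: "complex \<times> complex \<Rightarrow> real \<Rightarrow> (complex \<times> complex) set" where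
  "cbidisc p r = cball (fst p) r \<times> cball (snd p) r"

definition bidisc :: "complex \<times> complex \<Rightarrow> real \<Rightarrow> (complex \<times> complex) set" where
  "bidisc p r = ball (fst p) r \<times> ball (snd p) r"

lemma open_bidisc: "open (bidisc p r)"
  by (simp add: bidisc_def open_Times)

lemma connected_bidisc: "connected (bidisc p r)"
  by (simp add: bidisc_def connected_Times)

lemma centre_in_bidisc: "r > 0 \<Longrightarrow> p \<in> bidisc p r"
  by (simp add: bidisc_def mem_Times_iff)

lemma bidisc_subset_cbidisc: "bidisc p r \<subseteq> cbidisc p r"
  by (auto simp: bidisc_def cbidisc_def)

lemma bidisc_mono: "r \<le> s \<Longrightarrow> bidisc p r \<subseteq> bidisc p s"
  by (auto simp: bidisc_def)

lemma cbidisc_in_open: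
  assumes "open S" "p \<in> S"
  obtains r where "r > 0" "cbidisc p r \<subseteq> S"
proof -
  obtain A B where AB: "open A" "open B" "p \<in> A \<times> B" "A \<times> B \<subseteq> S"
    using assms open_prod_elim by metis
  then obtain r s where "r > 0" "cball (fst p) r \<subseteq> A" "s > 0" "cball (snd p) s \<subseteq> B"
    by (metis open_contains_cball mem_Times_iff)
  moreover have "cbidisc p (min r s) \<subseteq> cball (fst p) r \<times> cball (snd p) s" by (auto simp: cbidisc_def)
  ultimately show ?thesis using AB(4) by (intro that[of "min r s"]) (simp, blast)
qed

lemma bidisc_in_open:
  assumes "open S" "p \<in> S"
  obtains r where "r > 0" "bidisc p r \<subseteq> S"
  using cbidisc_in_open[OF assms] bidisc_subset_cbidisc by (metis subset_trans)

lemma hol2_bounded: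
  assumes "hol2 u S" "cbidisc p r \<subseteq> S"
  obtains M where "M > 0" "\<And>z. z \<in> cbidisc p r \<Longrightarrow> norm (u z) \<le> M"
proof -
  have "compact (cbidisc p r)" by (simp add: cbidisc_def compact_Times)
  then have "compact (u ` cbidisc p r)"
    using assms by (intro compact_continuous_image continuous_on_subset[OF hol2_continuous])
  then obtain M where "\<forall>x\<in>u ` cbidisc p r. norm x \<le> M"
    using compact_imp_bounded bounded_iff by blast
  then show ?thesis by (intro that[of "max M 1"]) force+
qed

text \<open>The one-variable theorem of Weierstrass is applied on each slice, and joint continuity
  comes from uniform convergence on polydiscs. Convergence of the partial derivatives is recorded as
  well, for the proof that they commute.\<close>

lemma hol2_uniform_limit:
  assumes f: "\<And>n. hol2 (f n) S" and F: "F \<noteq> bot"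
    and ul: "\<And>p. p \<in> S \<Longrightarrow> \<exists>r>0. cbidisc p r \<subseteq> S \<and> uniform_limit (cbidisc p r) f u F"
  shows "hol2 u S" and "z \<in> S \<Longrightarrow> ((\<lambda>n. pd1 (f n) z) \<longlongrightarrow> pd1 u z) F"
    and "z \<in> S \<Longrightarrow> ((\<lambda>n. pd2 (f n) z) \<longlongrightarrow> pd2 u z) F"
proof -
  have S: "open S" using f hol2_open by blast
  have d1: "\<exists>d. ((\<lambda>w. u (w, b)) has_field_derivative d) (at a) \<and> ((\<lambda>n. pd1 (f n) (a, b)) \<longlongrightarrow> d) F"
    if ab: "(a, b) \<in> S" for a b
  proof -
    obtain r where r: "r > 0" "cbidisc (a, b) r \<subseteq> S" "uniform_limit (cbidisc (a, b) r) f u F"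
      using ul[OF ab] by blast
    have in_S: "(w, b) \<in> S" if "w \<in> cball a r" for w using r that by (auto simp: cbidisc_def)
    obtain g' where "\<And>w. w \<in> ball a r \<Longrightarrow> ((\<lambda>w. u (w, b)) has_field_derivative (g' w)) (at w) \<and> ((\<lambda>n. pd1 (f n) (w, b)) \<longlongrightarrow> g' w) F"
    proof (rule has_complex_derivative_uniform_limit[where f = "\<lambda>n w. f n (w, b)"
          and f' = "\<lambda>n w. pd1 (f n) (w, b)" and z = a and r = r and F = F and g = "\<lambda>w. u (w, b)"])
      show "\<forall>\<^sub>F n in F. continuous_on (cball a r) (\<lambda>w. f n (w, b)) \<and>
        (\<forall>w\<in>ball a r. ((\<lambda>w. f n (w, b)) has_field_derivative pd1 (f n) (w, b)) (at w))"
        using in_S hol2_has_derivative1[OF f]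
        by (intro always_eventually allI conjI ballI
            continuous_on_compose2[OF hol2_continuous[OF f]] continuous_intros) auto
      show "uniform_limit (cball a r) (\<lambda>n w. f n (w, b)) (\<lambda>w. u (w, b)) F"
        using r(3) unfolding uniform_limit_iff
        by (elim all_forward imp_forward eventually_mono) (use r(1) in \<open>auto simp: cbidisc_def\<close>)
    qed (use F r in auto)
    then show ?thesis using r(1) by (metis centre_in_ball)
  qed
  have d2: "\<exists>d. ((\<lambda>w. u (a, w)) has_field_derivative d) (at b) \<and> ((\<lambda>n. pd2 (f n) (a, b)) \<longlongrightarrow> d) F"
    if ab: "(a, b) \<in> S" for a b
  proof -
    obtain r where r: "r > 0" "cbidisc (a, b) r \<subseteq> S" "uniform_limit (cbidisc (a, b) r) f u F"
      using ul[OF ab] by blast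
    have in_S: "(a, w) \<in> S" if "w \<in> cball b r" for w using r that by (auto simp: cbidisc_def)
    obtain g' where "\<And>w. w \<in> ball b r \<Longrightarrow> ((\<lambda>w. u (a, w)) has_field_derivative (g' w)) (at w) \<and> ((\<lambda>n. pd2 (f n) (a, w)) \<longlongrightarrow> g' w) F"
    proof (rule has_complex_derivative_uniform_limit[where f = "\<lambda>n w. f n (a, w)"
          and f' = "\<lambda>n w. pd2 (f n) (a, w)" and z = b and r = r and F = F and g = "\<lambda>w. u (a, w)"])
      show "\<forall>\<^sub>F n in F. continuous_on (cball b r) (\<lambda>w. f n (a, w)) \<and>
        (\<forall>w\<in>ball b r. ((\<lambda>w. f n (a, w)) has_field_derivative pd2 (f n) (a, w)) (at w))"
        using in_S hol2_has_derivative2[OF f]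
        by (intro always_eventually allI conjI ballI
            continuous_on_compose2[OF hol2_continuous[OF f]] continuous_intros) auto
      show "uniform_limit (cball b r) (\<lambda>n w. f n (a, w)) (\<lambda>w. u (a, w)) F"
        using r(3) unfolding uniform_limit_iff
        by (elim all_forward imp_forward eventually_mono) (use r(1) in \<open>auto simp: cbidisc_def\<close>)
    qed (use F r in auto)
    then show ?thesis using r(1) by (metis centre_in_ball)
  qed
  show "hol2 u S"
  proof (rule hol2I[OF S])
    show "continuous_on S u"
    proof (rule continuous_at_imp_continuous_on, rule ballI)
      fix p assume "p \<in> S"
      then obtain r where r: "r > 0" "cbidisc p r \<subseteq> S" "uniform_limit (cbidisc p r) f u F"
        using ul by blast
      have "continuous_on (cbidisc p r) u"
        by (rule uniform_limit_theorem[OF _ r(3)])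
          (use r(2) f F in \<open>auto intro!: always_eventually continuous_on_subset[OF hol2_continuous]\<close>)
      then have "continuous_on (bidisc p r) u" using bidisc_subset_cbidisc continuous_on_subset by blast
      then show "isCont u p"
        using continuous_on_eq_continuous_at open_bidisc centre_in_bidisc[OF r(1)] by blast
    qed
  qed (use d1 d2 in blast)+
  show "((\<lambda>n. pd1 (f n) z) \<longlongrightarrow> pd1 u z) F" if "z \<in> S"
    using d1[of "fst z" "snd z"] that by (auto dest: pd1_eqI)
  show "((\<lambda>n. pd2 (f n) z) \<longlongrightarrow> pd2 u z) F" if "z \<in> S"
    using d2[of "fst z" "snd z"] that by (auto dest: pd2_eqI)
qed

text \<open>Discs of radius \<open>r\<close> about points of the disc of radius \<open>2 * r\<close>
  stay inside the one of radius \<open>3 * r\<close>. Cauchy's inequality there bounds the second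
  derivative by \<open>2 * M / r\<^sup>2\<close>, uniformly in both points.\<close>

lemma taylor_first_order:
  assumes f: "f holomorphic_on ball a (3 * r)" "continuous_on (cball a (3 * r)) f" and r: "r > 0"
    and M: "\<And>z. z \<in> cball a (3 * r) \<Longrightarrow> norm (f z) \<le> M"
    and z: "z \<in> cball a (2 * r)" and w: "w \<in> cball a (2 * r)"
  shows "norm (f z - f w - deriv f w * (z - w)) \<le> 2 * M / r\<^sup>2 * norm (z - w) ^ 2"
proof -
  have f': "deriv f holomorphic_on ball a (3 * r)" using f(1) by (simp add: holomorphic_deriv)
  have sub: "cball a (2 * r) \<subseteq> ball a (3 * r)" using r by auto
  define F where "F i = (deriv ^^ i) f" for i
  have "norm (F 0 z - (\<Sum>i\<le>1. F i w * (z - w) ^ i / fact i)) \<le> 2 * M / r\<^sup>2 * norm (z - w) ^ Suc 1 / fact 1"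
  proof (rule complex_Taylor[of "cball a (2 * r)"])
    fix i :: nat and x assume x: "x \<in> cball a (2 * r)"
    have "F i holomorphic_on ball a (3 * r)" unfolding F_def using f(1) by (simp add: holomorphic_higher_deriv)
    then have "(F i has_field_derivative F (Suc i) x) (at x)"
      using x sub by (simp add: F_def holomorphic_derivI[OF _ open_ball] subset_iff)
    then show "(F i has_field_derivative F (Suc i) x) (at x within cball a (2 * r))"
      by (rule has_field_derivative_at_within)
  next
    fix x assume x: "x \<in> cball a (2 * r)"
    have sub2: "cball x r \<subseteq> cball a (3 * r)"
    proof
      fix y assume "y \<in> cball x r"
      then show "y \<in> cball a (3 * r)" using x dist_triangle[of a y x] by simp
    qed
    have "ball x r \<subseteq> ball a (3 * r)"
    proof
      fix y assume "y \<in> ball x r"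
      then show "y \<in> ball a (3 * r)" using x dist_triangle[of a y x] by simp
    qed
    then have "norm ((deriv ^^ 2) f x) \<le> fact 2 * M / r ^ 2"
    proof (intro Cauchy_inequality)
      show "norm (f y) \<le> M" if "norm (x - y) = r" for y
        using sub2 that by (intro M) (auto simp: dist_norm)
    qed (use f sub2 r holomorphic_on_subset continuous_on_subset in blast)+
    then show "norm (F (Suc 1) x) \<le> 2 * M / r\<^sup>2" by (simp add: F_def numeral_2_eq_2)
  qed (use z w in auto)
  then show ?thesis by (simp add: F_def numeral_2_eq_2 algebra_simps)
qed

text \<open>Slices show at once that \<open>pd1 u\<close> is holomorphic in the first variable, but
  neither its continuity nor its behaviour in the second variable. Both are inherited from
  difference quotients in the first variable, which are themselves \<open>hol2\<close> and converge
  uniformly by the Taylor bound. Their explicit form is kept because the commutation of the partial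
  derivatives uses it.\<close>

lemma hol2_pd1_local:
  assumes u: "hol2 u S" and p: "p \<in> S"
  obtains r f where "r > 0" "bidisc p r \<subseteq> S" "\<And>n. hol2 (f n) (bidisc p r)"
    "\<And>q. q \<in> bidisc p r \<Longrightarrow> \<exists>s>0. cbidisc q s \<subseteq> bidisc p r \<and> uniform_limit (cbidisc q s) f (pd1 u) sequentially"
    "\<And>n. \<exists>h. h \<noteq> 0 \<and> norm h < r / Suc n \<and> (\<forall>z\<in>bidisc p r. (fst z + h, snd z) \<in> S \<and>
        f n z = (u (fst z + h, snd z) - u z) / h)"
proof -
  obtain R where R: "R > 0" "cbidisc p R \<subseteq> S" using cbidisc_in_open[OF hol2_open[OF u] p] .
  define r where "r = R / 3"
  have r: "r > 0" "R = 3 * r" using R by (simp_all add: r_def)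
  obtain M where M: "M > 0" "\<And>z. z \<in> cbidisc p R \<Longrightarrow> norm (u z) \<le> M" using hol2_bounded[OF u R(2)] by blast
  \<comment> \<open>The denominator \<open>n + 2\<close> makes the step strictly smaller than
    \<open>r / Suc n\<close>, also for \<open>n = 0\<close>.\<close>
  define h where "h n = complex_of_real (r / real (n + 2))" for n
  have nh: "norm (h n) = r / real (n + 2)" for n
    unfolding h_def norm_of_real using r(1) by (intro abs_of_nonneg divide_nonneg_nonneg) auto
  have h0: "h n \<noteq> 0" for n
    using nh[of n] r(1) by (metis divide_eq_0_iff norm_zero of_nat_eq_0_iff add_2_eq_Suc' nat.distinct(1) less_irrefl)
  have hr: "norm (h n) < r / Suc n" for n
    unfolding nh by (rule divide_strict_left_mono) (use r(1) in auto)
  have hr': "norm (h n) < r" for n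
    unfolding nh using divide_strict_left_mono[of 1 "real (n + 2)" r] r(1) by simp
  define f where "f n z = (u (fst z + h n, snd z) - u z) / h n" for n z
  have shift: "(fst z + h n, snd z) \<in> cbidisc p R" if "z \<in> bidisc p r" for z n
    using that hr'[of n] r norm_triangle_ineq[of "fst z - fst p" "h n"]
    by (auto simp: bidisc_def cbidisc_def dist_norm norm_minus_commute algebra_simps mem_Times_iff)
  have sub: "bidisc p r \<subseteq> S"
    using R(2) r bidisc_subset_cbidisc[of p r] by (force simp: cbidisc_def)
  have hol: "hol2 (f n) (bidisc p r)" for n
  proof -
    have "hol2 (\<lambda>z. u (fst z + h n, snd z)) (bidisc p r)"
    proof (rule hol2I[OF open_bidisc])
      show "continuous_on (bidisc p r) (\<lambda>z. u (fst z + h n, snd z))"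
        using shift R(2) by (intro continuous_on_compose2[OF hol2_continuous[OF u]] continuous_intros) auto
    next
      fix a b assume "(a, b) \<in> bidisc p r"
      then have ab: "(a + h n, b) \<in> S" using shift R(2) by force
      show "\<exists>d. ((\<lambda>w. u (fst (w, b) + h n, snd (w, b))) has_field_derivative d) (at a)"
        using DERIV_shift[of "\<lambda>w. u (w, b)" _ a "h n"] hol2_has_derivative1[OF u ab] by auto
      show "\<exists>d. ((\<lambda>w. u (fst (a, w) + h n, snd (a, w))) has_field_derivative d) (at b)"
        using hol2_has_derivative2[OF u ab] by auto
    qed
    then show ?thesis unfolding f_def
      by (intro hol2_divide hol2_diff hol2_subset[OF u sub] hol2_const open_bidisc) (use h0 in auto)
  qed
  have bound: "norm (f n z - pd1 u z) \<le> 2 * M / r\<^sup>2 * norm (h n)" if z: "z \<in> bidisc p r" for n z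
  proof -
    let ?f = "\<lambda>w. u (w, snd z)"
    have inS: "(w, snd z) \<in> S" if "w \<in> cball (fst p) (3 * r)" for w
      using that z R(2) r by (auto simp: cbidisc_def bidisc_def mem_Times_iff subset_iff)
    have "norm (?f (fst z + h n) - ?f (fst z) - deriv ?f (fst z) * (fst z + h n - fst z))
        \<le> 2 * M / r\<^sup>2 * norm (fst z + h n - fst z) ^ 2"
    proof (rule taylor_first_order[OF _ _ r(1)])
      show "?f holomorphic_on ball (fst p) (3 * r)"
        unfolding holomorphic_on_open[OF open_ball]
        using hol2_has_derivative1[OF u inS] by (meson ball_subset_cball subsetD)
      show "continuous_on (cball (fst p) (3 * r)) ?f"
        using inS by (intro continuous_on_compose2[OF hol2_continuous[OF u]] continuous_intros) auto
      show "norm (?f w) \<le> M" if "w \<in> cball (fst p) (3 * r)" for w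
        using that z r by (intro M) (auto simp: cbidisc_def bidisc_def mem_Times_iff)
      show "fst z + h n \<in> cball (fst p) (2 * r)" "fst z \<in> cball (fst p) (2 * r)"
        using z r(1) hr'[of n] norm_triangle_ineq[of "fst z - fst p" "h n"]
        by (auto simp: bidisc_def dist_norm norm_minus_commute algebra_simps mem_Times_iff)
    qed
    moreover have "?f (fst z + h n) - ?f (fst z) - deriv ?f (fst z) * (fst z + h n - fst z) = h n * (f n z - pd1 u z)"
      using h0[of n] by (simp add: f_def pd1_def field_simps)
    ultimately have "norm (h n) * norm (f n z - pd1 u z) \<le> norm (h n) * (2 * M / r\<^sup>2 * norm (h n))"
      by (simp add: norm_mult power2_eq_square mult_ac)
    then show ?thesis by (rule mult_left_le_imp_le) (use h0[of n] in simp)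
  qed
  have "(\<lambda>n. norm (h n)) \<longlonglongrightarrow> 0" unfolding nh by real_asymp
  then have lim: "(\<lambda>n. 2 * M / r\<^sup>2 * norm (h n)) \<longlonglongrightarrow> 0" by (rule tendsto_mult_right_zero)
  have ul: "uniform_limit (bidisc p r) f (pd1 u) sequentially"
  proof (rule uniform_limitI)
    fix e :: real assume "e > 0"
    from \<open>e > 0\<close> have "\<forall>\<^sub>F n in sequentially. 2 * M / r\<^sup>2 * norm (h n) < e" by (rule order_tendstoD(2)[OF lim])
    then show "\<forall>\<^sub>F n in sequentially. \<forall>x\<in>bidisc p r. dist (f n x) (pd1 u x) < e"
      by eventually_elim (auto simp: dist_norm intro: le_less_trans[OF bound])
  qed
  show ?thesis
  proof (rule that[OF r(1) sub hol])
    show "\<exists>s>0. cbidisc q s \<subseteq> bidisc p r \<and> uniform_limit (cbidisc q s) f (pd1 u) sequentially"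
      if "q \<in> bidisc p r" for q
      using cbidisc_in_open[OF open_bidisc that] uniform_limit_on_subset[OF ul] by metis
    show "\<exists>h. h \<noteq> 0 \<and> norm h < r / Suc n \<and> (\<forall>z\<in>bidisc p r. (fst z + h, snd z) \<in> S \<and>
        f n z = (u (fst z + h, snd z) - u z) / h)" for n
      using h0[of n] hr[of n] shift[of _ n] R(2) by (intro exI[of _ "h n"]) (auto simp: f_def)
  qed
qed

lemma hol2_pd1:
  assumes u: "hol2 u S"
  shows "hol2 (pd1 u) S"
proof (rule hol2_local)
  fix p assume "p \<in> S"
  then obtain r f where "r > 0" "bidisc p r \<subseteq> S" "\<And>n. hol2 (f n) (bidisc p r)"
    "\<And>q. q \<in> bidisc p r \<Longrightarrow> \<exists>s>0. cbidisc q s \<subseteq> bidisc p r \<and> uniform_limit (cbidisc q s) f (pd1 u) sequentially"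
    using hol2_pd1_local[OF u] by metis
  then show "\<exists>T. p \<in> T \<and> T \<subseteq> S \<and> hol2 (pd1 u) T"
    using hol2_uniform_limit(1)[of f "bidisc p r" sequentially "pd1 u"] centre_in_bidisc
    by (intro exI[of _ "bidisc p r"]) auto
qed

lemma hol2_pd2:
  assumes u: "hol2 u S"
  shows "hol2 (pd2 u) S"
  using hol2_swap[OF hol2_pd1[OF hol2_swap[OF u]]] by (simp add: pd_swap)

text \<open>The second partial derivative of a difference quotient of \<open>u\<close> is the
  difference quotient of \<open>pd2 u\<close>. One reading converges to \<open>pd2 (pd1 u)\<close>
  by uniform convergence, the other to \<open>pd1 (pd2 u)\<close> by definition.\<close>

lemma pd_commute:
  assumes u: "hol2 u S" and p: "p \<in> S"
  shows "pd2 (pd1 u) p = pd1 (pd2 u) p"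
proof -
  obtain r f where r: "r > 0" "bidisc p r \<subseteq> S" "\<And>n. hol2 (f n) (bidisc p r)"
    and ul: "\<And>q. q \<in> bidisc p r \<Longrightarrow> \<exists>s>0. cbidisc q s \<subseteq> bidisc p r \<and> uniform_limit (cbidisc q s) f (pd1 u) sequentially"
    and h: "\<And>n. \<exists>h. h \<noteq> 0 \<and> norm h < r / Suc n \<and> (\<forall>z\<in>bidisc p r. (fst z + h, snd z) \<in> S \<and>
        f n z = (u (fst z + h, snd z) - u z) / h)"
    using hol2_pd1_local[OF u p] by blast
  obtain h where h0: "\<And>n. h n \<noteq> 0" and hr: "\<And>n. norm (h n) < r / Suc n"
    and hS: "\<And>n z. z \<in> bidisc p r \<Longrightarrow> (fst z + h n, snd z) \<in> S"
    and f: "\<And>n z. z \<in> bidisc p r \<Longrightarrow> f n z = (u (fst z + h n, snd z) - u z) / h n"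
    using h by metis
  have p': "p \<in> bidisc p r" by (rule centre_in_bidisc[OF r(1)])
  obtain a b where ab: "p = (a, b)" by (cases p)
  have h_lim: "h \<longlonglongrightarrow> 0"
  proof (rule Lim_null_comparison)
    show "(\<lambda>n. r / real (Suc n)) \<longlonglongrightarrow> 0" by real_asymp
  qed (use hr in \<open>auto intro: always_eventually less_imp_le\<close>)
  have "pd2 (f n) p = (pd2 u (a + h n, b) - pd2 u (a, b)) / h n" for n
  proof -
    have "pd2 (f n) p = pd2 (\<lambda>z. (u (fst z + h n, snd z) - u z) / h n) p"
      by (rule pd_cong(2)[OF open_bidisc _ p']) (rule f)
    also have "\<dots> = (pd2 u (a + h n, b) - pd2 u (a, b)) / h n"
      unfolding ab using hS[OF p'] p h0
      by (intro pd2_eqI) (auto simp: ab intro!: DERIV_cdivide DERIV_diff hol2_has_derivative2[OF u])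
    finally show ?thesis .
  qed
  moreover have "(\<lambda>n. pd2 (f n) p) \<longlonglongrightarrow> pd2 (pd1 u) p"
    by (rule hol2_uniform_limit(3)[OF r(3) _ ul p']) auto
  moreover have "(\<lambda>n. (pd2 u (a + h n, b) - pd2 u (a, b)) / h n) \<longlonglongrightarrow> pd1 (pd2 u) p"
  proof -
    have "((\<lambda>w. pd2 u (w, b)) has_field_derivative pd1 (pd2 u) (a, b)) (at a)"
      using hol2_has_derivative1[OF hol2_pd2[OF u]] p ab by blast
    then have "((\<lambda>k. (pd2 u (a + k, b) - pd2 u (a, b)) / k) \<longlongrightarrow> pd1 (pd2 u) (a, b)) (at 0)"
      by (simp add: DERIV_def)
    moreover have "filterlim h (at 0) sequentially"
      using h_lim h0 by (simp add: filterlim_at)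
    ultimately show ?thesis unfolding ab by (rule filterlim_compose)
  qed
  ultimately show ?thesis using LIMSEQ_unique by simp
qed

lemma hol2_funpow: "hol2 u S \<Longrightarrow> hol2 ((pd1 ^^ i) ((pd2 ^^ j) u)) S"
proof (induction i)
  case 0
  then show ?case by (induction j) (auto intro: hol2_pd2)
qed (auto intro: hol2_pd1)

lemma pd2_funpow_pd1:
  assumes u: "hol2 u S" and p: "p \<in> S"
  shows "pd2 ((pd1 ^^ i) u) p = (pd1 ^^ i) (pd2 u) p"
  using p
proof (induction i arbitrary: p)
  case (Suc i)
  have "hol2 ((pd1 ^^ i) u) S" using hol2_funpow[OF u, of i 0] by simp
  then have "pd2 ((pd1 ^^ Suc i) u) p = pd1 (pd2 ((pd1 ^^ i) u)) p"
    using pd_commute Suc.prems by simp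
  also have "\<dots> = pd1 ((pd1 ^^ i) (pd2 u)) p"
    by (rule pd_cong(1)[OF hol2_open[OF u] Suc.IH Suc.prems])
  finally show ?case by simp
qed simp

text \<open>The double series is enumerated as a single one and converges uniformly by the M-test;
  its partial sums are polynomials.\<close>

lemma analytic2_imp_hol2:
  assumes "analytic2_on u S" "open S"
  shows "hol2 u S"
proof (rule hol2_local)
  fix p assume p: "p \<in> S"
  obtain a R where R: "R > 0" and sum: "\<And>z. norm (fst z - fst p) < R \<Longrightarrow> norm (snd z - snd p) < R \<Longrightarrow>
           ((\<lambda>(i, j). a i j * (fst z - fst p) ^ i * (snd z - snd p) ^ j) has_sum u z) UNIV"
    using assms(1) p unfolding analytic2_on_def by blast
  obtain R' where R': "R' > 0" "bidisc p R' \<subseteq> S" using bidisc_in_open[OF assms(2) p] .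
  define r where "r = min (R / 2) R'"
  have r: "r > 0" "r < R" "r \<le> R'" using R R' by (auto simp: r_def)
  define f where "f k z = (case prod_decode k of (i, j) \<Rightarrow> a i j * (fst z - fst p) ^ i * (snd z - snd p) ^ j)" for k z
  \<comment> \<open>The corner at distance \<open>r\<close> in both coordinates still lies in the
    domain of convergence, and the terms there dominate those on the whole polydisc.\<close>
  define M where "M k = norm (f k (fst p + r, snd p + r))" for k
  have "((\<lambda>k. f k z) has_sum u z) UNIV" if "norm (fst z - fst p) < R" "norm (snd z - snd p) < R" for z
    using sum[OF that] has_sum_reindex_bij_betw[OF bij_prod_decode,
        of "\<lambda>(i, j). a i j * (fst z - fst p) ^ i * (snd z - snd p) ^ j" "u z"]
    by (simp add: f_def[abs_def])
  note fsum = this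
  have "summable M"
  proof -
    have "(\<lambda>k. f k (fst p + r, snd p + r)) summable_on UNIV"
      using fsum[of "(fst p + r, snd p + r)"] r by (auto simp: summable_on_def)
    then have "(\<lambda>k. norm (f k (fst p + r, snd p + r))) summable_on UNIV"
      by (simp add: summable_on_iff_abs_summable_on_complex)
    then show ?thesis unfolding M_def by (rule summable_on_imp_summable)
  qed
  moreover have "norm (f k z) \<le> M k" if "z \<in> bidisc p r" for k z
  proof -
    obtain i j where ij: "prod_decode k = (i, j)" by (cases "prod_decode k")
    have "norm (fst z - fst p) \<le> r" "norm (snd z - snd p) \<le> r"
      using that by (auto simp: bidisc_def dist_norm norm_minus_commute)
    then have "norm (a i j) * norm (fst z - fst p) ^ i * norm (snd z - snd p) ^ j \<le> norm (a i j) * r ^ i * r ^ j"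
      using r by (intro mult_mono power_mono) auto
    then show ?thesis using r(1) by (simp add: f_def M_def ij norm_mult norm_power)
  qed
  ultimately have "uniform_limit (bidisc p r) (\<lambda>n z. \<Sum>k<n. f k z) (\<lambda>z. suminf (\<lambda>k. f k z)) sequentially"
    by (intro Weierstrass_m_test)
  moreover have "suminf (\<lambda>k. f k z) = u z" if "z \<in> bidisc p r" for z
    using has_sum_imp_sums[OF fsum[of z]] that r
    by (auto simp: bidisc_def dist_norm norm_minus_commute sums_iff)
  ultimately have ul: "uniform_limit (bidisc p r) (\<lambda>n z. \<Sum>k<n. f k z) u sequentially"
    by (simp cong: uniform_limit_cong')
  have "hol2 u (bidisc p r)"
  proof (rule hol2_uniform_limit(1))
    have hc: "hol2 (\<lambda>z. fst z - fst p) (bidisc p r)" "hol2 (\<lambda>z. snd z - snd p) (bidisc p r)"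
      by (intro hol2_diff hol2_const hol2_fst hol2_snd open_bidisc)+
    show "hol2 (\<lambda>z. \<Sum>k<n. f k z) (bidisc p r)" for n
      unfolding f_def case_prod_beta by (intro hol2_sum hol2_mult hol2_power hol2_const hc open_bidisc)
    show "\<exists>s>0. cbidisc q s \<subseteq> bidisc p r \<and> uniform_limit (cbidisc q s) (\<lambda>n z. \<Sum>k<n. f k z) u sequentially"
      if "q \<in> bidisc p r" for q
      using cbidisc_in_open[OF open_bidisc that] uniform_limit_on_subset[OF ul] by metis
  qed auto
  moreover have "bidisc p r \<subseteq> S" using R' r bidisc_mono by blast
  ultimately show "\<exists>T. p \<in> T \<and> T \<subseteq> S \<and> hol2 u T"
    using centre_in_bidisc[OF r(1)] by blast
qed

section \<open>Taylor expansion in two variables\<close>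

lemma pd1_funpow_deriv: "(pd1 ^^ i) u (a, b) = (deriv ^^ i) (\<lambda>w. u (w, b)) a"
proof -
  have "(\<lambda>w. (pd1 ^^ i) u (w, b)) = (deriv ^^ i) (\<lambda>w. u (w, b))"
    by (induction i) (auto simp: pd1_def)
  then show ?thesis by metis
qed

lemma pd2_funpow_deriv: "(pd2 ^^ i) u (a, b) = (deriv ^^ i) (\<lambda>w. u (a, w)) b"
proof -
  have "(\<lambda>w. (pd2 ^^ i) u (a, w)) = (deriv ^^ i) (\<lambda>w. u (a, w))"
    by (induction i) (auto simp: pd2_def)
  then show ?thesis by metis
qed

lemma hol2_slice1:
  assumes "hol2 u S" "\<And>w. w \<in> A \<Longrightarrow> (w, b) \<in> S" "open A"
  shows "(\<lambda>w. u (w, b)) holomorphic_on A"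
  unfolding holomorphic_on_open[OF assms(3)] using hol2_has_derivative1[OF assms(1,2)] by blast

lemma hol2_slice2:
  assumes "hol2 u S" "\<And>w. w \<in> A \<Longrightarrow> (a, w) \<in> S" "open A"
  shows "(\<lambda>w. u (a, w)) holomorphic_on A"
  unfolding holomorphic_on_open[OF assms(3)] using hol2_has_derivative2[OF assms(1,2)] by blast

lemma hol2_power_series_bound:
  assumes u: "hol2 u S" and sub: "cbidisc p r \<subseteq> S" and r: "r > 0"
    and M: "\<And>z. z \<in> cbidisc p r \<Longrightarrow> norm (u z) \<le> M" and w: "w \<in> cball (snd p) r"
  shows "norm ((pd1 ^^ i) u (fst p, w)) \<le> fact i * M / r ^ i"
    and "z \<in> ball (fst p) r \<Longrightarrow> (\<lambda>i. (pd1 ^^ i) u (fst p, w) / fact i * (z - fst p) ^ i) sums u (z, w)"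
proof -
  have inS: "(x, w) \<in> S" if "x \<in> cball (fst p) r" for x
    using that w sub by (auto simp: cbidisc_def)
  have hol: "(\<lambda>x. u (x, w)) holomorphic_on ball (fst p) r"
    by (rule hol2_slice1[OF u]) (use inS in auto)
  show "norm ((pd1 ^^ i) u (fst p, w)) \<le> fact i * M / r ^ i"
    unfolding pd1_funpow_deriv
  proof (rule Cauchy_inequality[OF hol _ r])
    show "continuous_on (cball (fst p) r) (\<lambda>x. u (x, w))"
      using inS by (intro continuous_on_compose2[OF hol2_continuous[OF u]] continuous_intros) auto
    show "norm (u (x, w)) \<le> M" if "norm (fst p - x) = r" for x
      using that w by (intro M) (auto simp: cbidisc_def dist_norm)
  qed
  show "(\<lambda>i. (pd1 ^^ i) u (fst p, w) / fact i * (z - fst p) ^ i) sums u (z, w)" if "z \<in> ball (fst p) r"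
    unfolding pd1_funpow_deriv by (rule holomorphic_power_series[OF hol that])
qed

text \<open>One-variable Taylor expansion is used twice: first in the first variable, then for each
  resulting coefficient, a holomorphic function of the second. The two Cauchy estimates give a
  product of geometric series as majorant, which permits rearranging the iterated sum into an
  unordered double sum.\<close>

theorem hol2_imp_analytic2:
  assumes u: "hol2 u S"
  shows "analytic2_on u S"
  unfolding analytic2_on_def
proof (rule ballI)
  fix p assume p: "p \<in> S"
  obtain r where r: "r > 0" "cbidisc p r \<subseteq> S" using cbidisc_in_open[OF hol2_open[OF u] p] .
  obtain M where M: "M > 0" "\<And>z. z \<in> cbidisc p r \<Longrightarrow> norm (u z) \<le> M" using hol2_bounded[OF u r(2)] by blast
  define a where "a i j = (pd2 ^^ j) ((pd1 ^^ i) u) p / (fact i * fact j)" for i j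
  have A_hol: "hol2 ((pd1 ^^ i) u) S" for i using hol2_funpow[OF u, of i 0] by simp
  have inS: "(fst p, w) \<in> S" if "w \<in> cball (snd p) r" for w
    using that r by (auto simp: cbidisc_def)
  have hol: "(\<lambda>w. (pd1 ^^ i) u (fst p, w)) holomorphic_on ball (snd p) r" for i
    by (rule hol2_slice2[OF A_hol]) (use inS in auto)
  have A_series: "(\<lambda>j. a i j * (w - snd p) ^ j) sums ((pd1 ^^ i) u (fst p, w) / fact i)"
    if w: "w \<in> ball (snd p) r" for i w
  proof -
    have "(\<lambda>j. (pd2 ^^ j) ((pd1 ^^ i) u) (fst p, snd p) / fact j * (w - snd p) ^ j) sums (pd1 ^^ i) u (fst p, w)"
      unfolding pd2_funpow_deriv by (rule holomorphic_power_series[OF hol w])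
    from sums_divide[OF this, of "fact i"] show ?thesis by (simp add: a_def field_simps)
  qed
  have a_bound: "norm (a i j) \<le> M / r ^ i / r ^ j" for i j
  proof -
    have "norm ((pd2 ^^ j) ((pd1 ^^ i) u) (fst p, snd p)) \<le> fact j * (fact i * M / r ^ i) / r ^ j"
      unfolding pd2_funpow_deriv
    proof (rule Cauchy_inequality[OF hol _ r(1)])
      show "continuous_on (cball (snd p) r) (\<lambda>w. (pd1 ^^ i) u (fst p, w))"
        using inS by (intro continuous_on_compose2[OF hol2_continuous[OF A_hol]] continuous_intros) auto
      show "norm ((pd1 ^^ i) u (fst p, w)) \<le> fact i * M / r ^ i" if "norm (snd p - w) = r" for w
        using that by (intro hol2_power_series_bound(1)[OF u r(2,1) M(2)]) (auto simp: dist_norm)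
    qed
    then show ?thesis by (simp add: a_def norm_divide norm_mult field_simps)
  qed
  show "\<exists>a r. r > 0 \<and> (\<forall>z. norm (fst z - fst p) < r \<and> norm (snd z - snd p) < r \<longrightarrow>
           ((\<lambda>(i, j). a i j * (fst z - fst p) ^ i * (snd z - snd p) ^ j) has_sum u z) UNIV)"
  proof (intro exI[of _ a] exI[of _ r] conjI allI impI r(1))
    fix z assume "norm (fst z - fst p) < r \<and> norm (snd z - snd p) < r"
    then have z: "fst z \<in> ball (fst p) r" "snd z \<in> ball (snd p) r"
      by (auto simp: dist_norm norm_minus_commute)
    define x where "x = norm (fst z - fst p) / r"
    define y where "y = norm (snd z - snd p) / r"
    have xy: "0 \<le> x" "x < 1" "0 \<le> y" "y < 1"
      using z r by (auto simp: x_def y_def dist_norm norm_minus_commute)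
    let ?t = "\<lambda>(i, j). a i j * (fst z - fst p) ^ i * (snd z - snd p) ^ j"
    have t_bound: "norm (a i j * (fst z - fst p) ^ i * (snd z - snd p) ^ j) \<le> M * x ^ i * y ^ j" for i j
    proof -
      have "norm (a i j * (fst z - fst p) ^ i * (snd z - snd p) ^ j) \<le>
          (M / r ^ i / r ^ j) * norm (fst z - fst p) ^ i * norm (snd z - snd p) ^ j"
        unfolding norm_mult norm_power by (intro mult_right_mono a_bound) auto
      then show ?thesis by (simp add: x_def y_def power_divide)
    qed
    have geo: "((\<lambda>j. M * x ^ i * y ^ j) has_sum (M * x ^ i * (1 / (1 - y)))) UNIV" for i
      using xy M(1) by (intro sums_nonneg_imp_has_sum sums_mult geometric_sums) auto
    have "(\<lambda>i. M * x ^ i * (1 / (1 - y))) sums (M * (1 / (1 - x)) * (1 / (1 - y)))"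
      using xy by (intro sums_mult sums_mult2 geometric_sums) auto
    then have "((\<lambda>i. M * x ^ i * (1 / (1 - y))) has_sum (M * (1 / (1 - x)) * (1 / (1 - y)))) UNIV"
      using xy M(1) by (intro sums_nonneg_imp_has_sum) auto
    then have "(\<lambda>(i, j). M * x ^ i * y ^ j) summable_on (UNIV \<times> UNIV)"
      using geo xy M(1) by (intro summable_on_SigmaI[where g = "\<lambda>i. M * x ^ i * (1 / (1 - y))"])
        (auto simp: summable_on_def)
    then have abs: "(\<lambda>z. norm (?t z)) summable_on (UNIV \<times> UNIV)"
      by (rule Infinite_Sum.abs_summable_on_comparison_test') (use t_bound in auto)
    have inner: "((\<lambda>j. ?t (i, j)) has_sum ((pd1 ^^ i) u (fst p, snd z) / fact i * (fst z - fst p) ^ i)) UNIV" for i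
    proof (rule norm_summable_imp_has_sum)
      show "summable (\<lambda>j. norm (?t (i, j)))"
      proof (rule summable_comparison_test')
        show "summable (\<lambda>j. M * x ^ i * y ^ j)" using xy by (intro summable_mult summable_geometric) auto
        show "norm (norm (?t (i, n))) \<le> M * x ^ i * y ^ n" for n using t_bound by simp
      qed
      have "(\<lambda>j. a i j * (snd z - snd p) ^ j * (fst z - fst p) ^ i) sums
          ((pd1 ^^ i) u (fst p, snd z) / fact i * (fst z - fst p) ^ i)"
        by (rule sums_mult2[OF A_series[OF z(2)]])
      then show "(\<lambda>j. ?t (i, j)) sums ((pd1 ^^ i) u (fst p, snd z) / fact i * (fst z - fst p) ^ i)"
        by (simp add: mult_ac)
    qed
    have outer: "((\<lambda>i. (pd1 ^^ i) u (fst p, snd z) / fact i * (fst z - fst p) ^ i) has_sum u z) UNIV"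
    proof (rule norm_summable_imp_has_sum)
      show "summable (\<lambda>i. norm ((pd1 ^^ i) u (fst p, snd z) / fact i * (fst z - fst p) ^ i))"
      proof (rule summable_comparison_test')
        show "summable (\<lambda>i. M * x ^ i)" using xy by (intro summable_mult summable_geometric) auto
        show "norm (norm ((pd1 ^^ n) u (fst p, snd z) / fact n * (fst z - fst p) ^ n)) \<le> M * x ^ n" for n
        proof -
          have "norm ((pd1 ^^ n) u (fst p, snd z)) \<le> fact n * M / r ^ n"
            using z(2) by (intro hol2_power_series_bound(1)[OF u r(2,1) M(2)]) auto
          then have "norm ((pd1 ^^ n) u (fst p, snd z)) * norm (fst z - fst p) ^ n \<le> fact n * M / r ^ n * norm (fst z - fst p) ^ n"
            by (rule mult_right_mono) simp
          then show ?thesis by (simp add: x_def norm_mult norm_divide norm_power power_divide field_simps)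
        qed
      qed
      show "(\<lambda>i. (pd1 ^^ i) u (fst p, snd z) / fact i * (fst z - fst p) ^ i) sums u z"
        using hol2_power_series_bound(2)[OF u r(2,1) M(2), of "snd z" "fst z"] z by simp
    qed
    have "(?t has_sum u z) (UNIV \<times> UNIV)"
      by (rule has_sum_SigmaI[OF inner outer abs_summable_summable[OF abs]])
    then show "(?t has_sum u z) UNIV" by simp
  qed
qed

text \<open>On a polydisc every point is joined to the centre by a path along the two coordinate
  directions; connectedness makes local constancy global.\<close>

lemma hol2_constant:
  assumes u: "hol2 u S" and S: "connected S" and 1: "\<And>z. z \<in> S \<Longrightarrow> pd1 u z = 0"
    and 2: "\<And>z. z \<in> S \<Longrightarrow> pd2 u z = 0"
  shows "u constant_on S"
proof -
  have "\<forall>p\<in>S. eventually (\<lambda>q. u p = u q) (at p within S)"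
  proof
    fix p assume p: "p \<in> S"
    obtain r where r: "r > 0" "bidisc p r \<subseteq> S" using bidisc_in_open[OF hol2_open[OF u] p] .
    have "u p = u q" if q: "q \<in> bidisc p r" for q
    proof -
      have "((\<lambda>w. u (w, snd q)) has_field_derivative 0) (at x within ball (fst p) r)" if "x \<in> ball (fst p) r" for x
      proof -
        have "(x, snd q) \<in> S" using that q r by (auto simp: bidisc_def)
        from hol2_has_derivative1[OF u this] 1[OF this] show ?thesis
          by (simp add: has_field_derivative_at_within)
      qed
      then obtain c where "\<And>x. x \<in> ball (fst p) r \<Longrightarrow> u (x, snd q) = c"
        using has_field_derivative_zero_constant[of "ball (fst p) r" "\<lambda>w. u (w, snd q)"] by auto
      then have 3: "u (fst q, snd q) = u (fst p, snd q)" using q r(1) by (auto simp: bidisc_def)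
      have "((\<lambda>w. u (fst p, w)) has_field_derivative 0) (at x within ball (snd p) r)" if "x \<in> ball (snd p) r" for x
      proof -
        have "(fst p, x) \<in> S" using that r by (auto simp: bidisc_def)
        from hol2_has_derivative2[OF u this] 2[OF this] show ?thesis
          by (simp add: has_field_derivative_at_within)
      qed
      then obtain c where c: "\<And>x. x \<in> ball (snd p) r \<Longrightarrow> u (fst p, x) = c"
        using has_field_derivative_zero_constant[of "ball (snd p) r" "\<lambda>w. u (fst p, w)"] by auto
      have "u (fst p, snd q) = u (fst p, snd p)"
        using c[of "snd q"] c[of "snd p"] q r(1) by (auto simp: bidisc_def)
      with 3 show ?thesis by simp
    qed
    then have "eventually (\<lambda>q. u p = u q) (nhds p)"
      unfolding eventually_nhds using open_bidisc centre_in_bidisc[OF r(1)] by blast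
    then show "eventually (\<lambda>q. u p = u q) (at p within S)" by (simp add: eventually_at_filter eventually_mono)
  qed
  then show ?thesis unfolding constant_on_def using connected_local_const[OF S, of _ _ u] by metis
qed

section \<open>Evaluation of differential polynomials\<close>

lemma pd_const: "pd1 (\<lambda>z. c) z = 0" "pd2 (\<lambda>z. c) z = 0"
  by (simp_all add: pd1_def pd2_def)

lemma pd_add:
  assumes "hol2 u S" "hol2 v S" "z \<in> S"
  shows "pd1 (\<lambda>z. u z + v z) z = pd1 u z + pd1 v z" "pd2 (\<lambda>z. u z + v z) z = pd2 u z + pd2 v z"
proof -
  obtain a b where z: "z = (a, b)" by (cases z)
  show "pd1 (\<lambda>z. u z + v z) z = pd1 u z + pd1 v z" "pd2 (\<lambda>z. u z + v z) z = pd2 u z + pd2 v z"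
    unfolding z using assms z
    by (auto intro!: pd1_eqI pd2_eqI derivative_eq_intros hol2_has_derivative1 hol2_has_derivative2)
qed

lemma pd_mult:
  assumes "hol2 u S" "hol2 v S" "z \<in> S"
  shows "pd1 (\<lambda>z. u z * v z) z = pd1 u z * v z + u z * pd1 v z"
    "pd2 (\<lambda>z. u z * v z) z = pd2 u z * v z + u z * pd2 v z"
proof -
  obtain a b where z: "z = (a, b)" by (cases z)
  show "pd1 (\<lambda>z. u z * v z) z = pd1 u z * v z + u z * pd1 v z"
    unfolding z using DERIV_mult[OF hol2_has_derivative1[OF assms(1)] hol2_has_derivative1[OF assms(2)], of a b]
      assms(3) z by (intro pd1_eqI) (simp add: algebra_simps)
  show "pd2 (\<lambda>z. u z * v z) z = pd2 u z * v z + u z * pd2 v z"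
    unfolding z using DERIV_mult[OF hol2_has_derivative2[OF assms(1)] hol2_has_derivative2[OF assms(2)], of a b]
      assms(3) z by (intro pd2_eqI) (simp add: algebra_simps)
qed

subsection \<open>Bivariate polynomials as functions\<close>

lemma eval2_simps [simp]:
  "eval2 0 z = 0" "eval2 1 z = 1" "eval2 (p + q) z = eval2 p z + eval2 q z"
  "eval2 (p * q) z = eval2 p z * eval2 q z" "eval2 (p - q) z = eval2 p z - eval2 q z"
  "eval2 (- p) z = - eval2 p z"
  by (simp_all add: eval2_def)

lemma eval2_pCons: "eval2 (pCons c p) z = poly c (fst z) + snd z * eval2 p z"
  by (simp add: eval2_def)

lemma eval2_has_derivative1:
  "((\<lambda>w. eval2 p (w, b)) has_field_derivative eval2 (bipoly_d1 p) (a, b)) (at a)"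
proof -
  have "pderiv (poly p [:b:]) = poly (bipoly_d1 p) [:b:]"
    by (induction p) (simp_all add: bipoly_d1_def map_poly_pCons pderiv_add pderiv_smult)
  then show ?thesis using poly_DERIV[of "poly p [:b:]" a] by (simp add: eval2_def)
qed

lemma eval2_has_derivative2:
  "((\<lambda>w. eval2 p (a, w)) has_field_derivative eval2 (bipoly_d2 p) (a, b)) (at b)"
proof (induction p)
  case (pCons c p)
  have "((\<lambda>w. poly c a + w * eval2 p (a, w)) has_field_derivative
      0 + (1 * eval2 p (a, b) + eval2 (bipoly_d2 p) (a, b) * b)) (at b)"
    by (intro DERIV_add DERIV_const DERIV_mult DERIV_ident pCons.IH)
  then show ?case by (simp add: eval2_pCons bipoly_d2_def pderiv_pCons mult.commute)
qed (simp add: bipoly_d2_def)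

lemma continuous_on_eval2: "continuous_on S (eval2 p)"
proof (induction p)
  case (pCons c p)
  have "continuous_on S (\<lambda>z. poly c (fst z) + snd z * eval2 p z)"
    by (intro continuous_intros pCons.IH)
  then show ?case by (simp add: eval2_pCons[abs_def])
next
  case 0
  have "eval2 0 = (\<lambda>z. 0)" by auto
  then show ?case by simp
qed

lemma hol2_eval2: "open S \<Longrightarrow> hol2 (eval2 p) S"
  using eval2_has_derivative1 eval2_has_derivative2 by (intro hol2I continuous_on_eval2) blast+

lemma pd_eval2: "pd1 (eval2 p) z = eval2 (bipoly_d1 p) z" "pd2 (eval2 p) z = eval2 (bipoly_d2 p) z"
  using pd1_eqI[OF eval2_has_derivative1] pd2_eqI[OF eval2_has_derivative2] by (metis surj_pair)+

lemma open_eval2_nonzero: "open S \<Longrightarrow> open {z \<in> S. eval2 p z \<noteq> 0}"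
  using continuous_open_preimage[OF continuous_on_eval2[of S p], of "- {0}"]
  by (auto simp: vimage_def Int_def open_Compl)

text \<open>The coordinates are chosen one after the other. Each time a nonzero polynomial in one
  variable has finitely many roots and the disc infinitely many points.\<close>

lemma eval2_nonzero_dense:
  assumes p: "p \<noteq> 0" and S: "open S" "S \<noteq> {}"
  obtains z where "z \<in> S" "eval2 p z \<noteq> 0"
proof -
  from S obtain q where "q \<in> S" by blast
  then obtain r where r: "r > 0" "bidisc q r \<subseteq> S" using bidisc_in_open[OF S(1)] by blast
  have inf: "infinite (ball a r)" for a :: complex
    using r(1) by (simp add: uncountable_infinite uncountable_ball)
  have "infinite ((\<lambda>c. [:c:]) ` ball (snd q) r)"
    using inf by (subst finite_image_iff) (auto intro: inj_onI)
  then have "\<not> (\<lambda>c. [:c:]) ` ball (snd q) r \<subseteq> {x. poly p x = 0}"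
    using poly_roots_finite[OF p] finite_subset by blast
  then obtain b where b: "b \<in> ball (snd q) r" "poly p [:b:] \<noteq> 0" by blast
  then have "\<not> ball (fst q) r \<subseteq> {x. poly (poly p [:b:]) x = 0}"
    using poly_roots_finite[OF b(2)] inf finite_subset by blast
  then obtain a where "a \<in> ball (fst q) r" "poly (poly p [:b:]) a \<noteq> 0" by blast
  then have "a \<in> ball (fst q) r" "eval2 p (a, b) \<noteq> 0" by (simp_all add: eval2_def)
  then show ?thesis using b r by (intro that[of "(a, b)"]) (auto simp: bidisc_def)
qed

text \<open>
  Generic points of \<open>S\<close>: sets that avoid the zeros of some nonzero polynomial. As \<open>rat_val\<close> is
  meaningless at singular points, identities between values of differential operators only hold generically.
\<close>

definition generic :: "(complex \<times> complex) set \<Rightarrow> (complex \<times> complex) filter" where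
  "generic S = (INF b\<in>{b. b \<noteq> 0}. principal {z \<in> S. eval2 b z \<noteq> 0})"

lemma eventually_generic:
  "eventually P (generic S) \<longleftrightarrow> (\<exists>b. b \<noteq> 0 \<and> (\<forall>z\<in>S. eval2 b z \<noteq> 0 \<longrightarrow> P z))"
  unfolding generic_def
proof (subst eventually_INF_base)
  show "{b :: bipoly. b \<noteq> 0} \<noteq> {}" by (auto intro: exI[of _ 1])
  fix a b :: bipoly assume "a \<in> {b. b \<noteq> 0}" "b \<in> {b. b \<noteq> 0}"
  then show "\<exists>x\<in>{b. b \<noteq> 0}. principal {z \<in> S. eval2 x z \<noteq> 0} \<le>
      inf (principal {z \<in> S. eval2 a z \<noteq> 0}) (principal {z \<in> S. eval2 b z \<noteq> 0})"
    by (intro bexI[of _ "a * b"]) auto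
qed (auto simp: eventually_principal)

lemma generic_exists:
  assumes "eventually P (generic S)" "open T" "T \<noteq> {}" "T \<subseteq> S"
  obtains z where "z \<in> T" "P z"
  using assms eval2_nonzero_dense unfolding eventually_generic by (metis subsetD)

lemma generic_neq_bot: "open S \<Longrightarrow> S \<noteq> {} \<Longrightarrow> generic S \<noteq> bot"
  using generic_exists[of "\<lambda>_. False" S S] by (auto simp: trivial_limit_def)

lemma eventually_generic_in: "eventually (\<lambda>z. z \<in> S) (generic S)"
  unfolding eventually_generic by (auto intro: exI[of _ 1])

text \<open>The non-vanishing set of a polynomial is open, so a generic identity holds on a
  neighbourhood of each generic point and may be differentiated there.\<close>

lemma eventually_generic_open:
  assumes "eventually P (generic S)" "open S"
  shows "eventually (\<lambda>z. \<exists>T. open T \<and> z \<in> T \<and> T \<subseteq> S \<and> (\<forall>x\<in>T. P x)) (generic S)"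
proof -
  obtain b where b: "b \<noteq> 0" "\<And>z. z \<in> S \<Longrightarrow> eval2 b z \<noteq> 0 \<Longrightarrow> P z"
    using assms(1) unfolding eventually_generic by blast
  show ?thesis unfolding eventually_generic
    using b open_eval2_nonzero[OF assms(2), of b]
    by (intro exI[of _ b] conjI ballI impI exI[of _ "{z \<in> S. eval2 b z \<noteq> 0}"]) auto
qed

lemma generic_zero_imp_zero:
  assumes "eventually (\<lambda>z. u z = 0) (generic S)" "open T" "T \<subseteq> S" "continuous_on T u" "z \<in> T"
  shows "u z = (0 :: complex)"
proof (rule ccontr)
  assume nz: "u z \<noteq> 0"
  have "open (T \<inter> u -` (- {0}))" by (rule continuous_open_preimage) (use assms in auto)
  then obtain x where "x \<in> T \<inter> u -` (- {0})" "u x = 0"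
    using generic_exists[OF assms(1), of "T \<inter> u -` (- {0})"] nz assms by blast
  then show False by simp
qed

subsection \<open>Rational functions as functions\<close>

lemma eval2_nonzero_imp: "eval2 q z \<noteq> 0 \<Longrightarrow> q \<noteq> 0"
  by auto

lemma rat_regularE:
  assumes "rat_regular c z"
  obtains p q where "c = Fract p q" "q \<noteq> 0" "eval2 q z \<noteq> 0" "rat_val c z = eval2 p z / eval2 q z"
  using assms unfolding rat_regular_def using rat_val_Fract eval2_nonzero_imp by metis

lemma rat_regular_Fract: "eval2 q z \<noteq> 0 \<Longrightarrow> rat_regular (Fract p q) z"
  unfolding rat_regular_def by blast

lemma rat_val_0 [simp]: "rat_val 0 z = 0" and rat_val_1 [simp]: "rat_val 1 z = 1"
  and rat_regular_0: "rat_regular 0 z" and rat_regular_1: "rat_regular 1 z"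
  using rat_val_Fract[of 1 z 0] rat_val_Fract[of 1 z 1] rat_regular_Fract[of 1 z]
  by (simp_all add: Zero_fract_def One_fract_def)

lemma rat_val_of_bipoly: "rat_val (Fract p 1) z = eval2 p z" "rat_regular (Fract p 1) z"
  using rat_val_Fract[of 1 z p] rat_regular_Fract[of 1 z p] by simp_all

lemma rat_val_add:
  assumes "rat_regular c z" "rat_regular d z"
  shows "rat_val (c + d) z = rat_val c z + rat_val d z" "rat_regular (c + d) z"
proof -
  obtain p q where c: "c = Fract p q" "q \<noteq> 0" "eval2 q z \<noteq> 0" "rat_val c z = eval2 p z / eval2 q z"
    using rat_regularE[OF assms(1)] .
  obtain p' q' where d: "d = Fract p' q'" "q' \<noteq> 0" "eval2 q' z \<noteq> 0" "rat_val d z = eval2 p' z / eval2 q' z"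
    using rat_regularE[OF assms(2)] .
  have e: "c + d = Fract (p * q' + p' * q) (q * q')" using c d by (simp add: add_fract)
  show "rat_val (c + d) z = rat_val c z + rat_val d z"
    unfolding c(4) d(4) e by (subst rat_val_Fract) (use c(3) d(3) in \<open>auto simp: add_frac_eq\<close>)
  show "rat_regular (c + d) z" unfolding e by (rule rat_regular_Fract) (use c(3) d(3) in simp)
qed

lemma rat_val_mult:
  assumes "rat_regular c z" "rat_regular d z"
  shows "rat_val (c * d) z = rat_val c z * rat_val d z" "rat_regular (c * d) z"
proof -
  obtain p q where c: "c = Fract p q" "q \<noteq> 0" "eval2 q z \<noteq> 0" "rat_val c z = eval2 p z / eval2 q z"
    using rat_regularE[OF assms(1)] .
  obtain p' q' where d: "d = Fract p' q'" "q' \<noteq> 0" "eval2 q' z \<noteq> 0" "rat_val d z = eval2 p' z / eval2 q' z"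
    using rat_regularE[OF assms(2)] .
  have e: "c * d = Fract (p * p') (q * q')" using c d by (simp add: mult_fract)
  show "rat_val (c * d) z = rat_val c z * rat_val d z"
    unfolding c(4) d(4) e by (subst rat_val_Fract) (use c(3) d(3) in auto)
  show "rat_regular (c * d) z" unfolding e by (rule rat_regular_Fract) (use c(3) d(3) in simp)
qed

lemma rat_local:
  assumes "rat_regular c z" "open S" "z \<in> S"
  obtains p q T where "c = Fract p q" "q \<noteq> 0" "eval2 q z \<noteq> 0" "open T" "z \<in> T" "T \<subseteq> S"
    "\<forall>x\<in>T. rat_regular c x \<and> rat_val c x = eval2 p x / eval2 q x" "hol2 (\<lambda>x. eval2 p x / eval2 q x) T"
proof -
  obtain p q where c: "c = Fract p q" "q \<noteq> 0" "eval2 q z \<noteq> 0" "rat_val c z = eval2 p z / eval2 q z"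
    using rat_regularE[OF assms(1)] .
  have T: "open {x \<in> S. eval2 q x \<noteq> 0}" by (rule open_eval2_nonzero[OF assms(2)])
  show ?thesis
  proof (rule that[OF c(1-3) T])
    show "hol2 (\<lambda>x. eval2 p x / eval2 q x) {x \<in> S. eval2 q x \<noteq> 0}"
      by (intro hol2_divide hol2_eval2 T) auto
    show "\<forall>x\<in>{x \<in> S. eval2 q x \<noteq> 0}. rat_regular c x \<and> rat_val c x = eval2 p x / eval2 q x"
      by (simp add: c(1) rat_val_Fract rat_regular_Fract)
    show "z \<in> {x \<in> S. eval2 q x \<noteq> 0}" using assms(3) c(3) by simp
  qed blast
qed

lemma open_rat_regular:
  assumes S: "open S"
  shows "open {z \<in> S. rat_regular c z}"
proof (subst open_subopen, rule ballI)
  fix z assume "z \<in> {z \<in> S. rat_regular c z}"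
  then have z: "rat_regular c z" "z \<in> S" by auto
  obtain T where "open T" "z \<in> T" "T \<subseteq> S" "\<forall>x\<in>T. rat_regular c x"
    by (rule rat_local[OF z(1) S z(2)]) blast
  then show "\<exists>T. open T \<and> z \<in> T \<and> T \<subseteq> {z \<in> S. rat_regular c z}"
    by (intro exI[of _ T]) auto
qed

lemma hol2_rat_val:
  assumes "open S" "\<And>z. z \<in> S \<Longrightarrow> rat_regular c z"
  shows "hol2 (rat_val c) S"
proof (rule hol2_local)
  fix z assume z: "z \<in> S"
  obtain p q T where T: "z \<in> T" "T \<subseteq> S" "\<forall>x\<in>T. rat_val c x = eval2 p x / eval2 q x"
    "hol2 (\<lambda>x. eval2 p x / eval2 q x) T"
    by (rule rat_local[OF assms(2)[OF z] assms(1) z], rule that) auto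
  have "hol2 (rat_val c) T"
    using T(4) hol2_cong[of T "rat_val c" "\<lambda>x. eval2 p x / eval2 q x"] T(3) by blast
  then show "\<exists>T. z \<in> T \<and> T \<subseteq> S \<and> hol2 (rat_val c) T"
    using T by blast
qed

lemma pd_divide:
  assumes "hol2 u S" "hol2 v S" "z \<in> S" "v z \<noteq> 0"
  shows "pd1 (\<lambda>z. u z / v z) z = (pd1 u z * v z - u z * pd1 v z) / (v z * v z)"
    "pd2 (\<lambda>z. u z / v z) z = (pd2 u z * v z - u z * pd2 v z) / (v z * v z)"
proof -
  obtain a b where z: "z = (a, b)" by (cases z)
  have ab: "(a, b) \<in> S" "v (a, b) \<noteq> 0" using assms(3,4) z by auto
  show "pd1 (\<lambda>z. u z / v z) z = (pd1 u z * v z - u z * pd1 v z) / (v z * v z)"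
    unfolding z by (rule pd1_eqI)
      (rule DERIV_divide[OF hol2_has_derivative1[OF assms(1) ab(1)] hol2_has_derivative1[OF assms(2) ab(1)] ab(2)])
  show "pd2 (\<lambda>z. u z / v z) z = (pd2 u z * v z - u z * pd2 v z) / (v z * v z)"
    unfolding z by (rule pd2_eqI)
      (rule DERIV_divide[OF hol2_has_derivative2[OF assms(1) ab(1)] hol2_has_derivative2[OF assms(2) ab(1)] ab(2)])
qed

lemma pd_rat_val:
  assumes "rat_regular c z"
  shows "pd1 (rat_val c) z = rat_val (rat_d1 c) z" "pd2 (rat_val c) z = rat_val (rat_d2 c) z"
    "rat_regular (rat_d1 c) z" "rat_regular (rat_d2 c) z"
proof -
  obtain p q T where pq: "c = Fract p q" "q \<noteq> 0" "eval2 q z \<noteq> 0" "open T" "z \<in> T" "T \<subseteq> UNIV"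
    and T: "\<forall>x\<in>T. rat_regular c x \<and> rat_val c x = eval2 p x / eval2 q x"
      "hol2 (\<lambda>x. eval2 p x / eval2 q x) T"
    using rat_local[OF assms open_UNIV UNIV_I] .
  have q: "eval2 q z \<noteq> 0" "eval2 (q * q) z \<noteq> 0" using pq(3) by auto
  note h = hol2_eval2[OF open_UNIV]
  have "pd1 (rat_val c) z = pd1 (\<lambda>x. eval2 p x / eval2 q x) z"
    by (rule pd_cong(1)[OF pq(4) _ pq(5)]) (use T in blast)
  also have "\<dots> = rat_val (rat_d1 c) z"
    unfolding pq(1) rat_d1_Fract[OF pq(2)] rat_val_Fract[OF q(2)]
    by (simp add: pd_divide(1)[OF h h UNIV_I q(1)] pd_eval2)
  finally show "pd1 (rat_val c) z = rat_val (rat_d1 c) z" .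
  have "pd2 (rat_val c) z = pd2 (\<lambda>x. eval2 p x / eval2 q x) z"
    by (rule pd_cong(2)[OF pq(4) _ pq(5)]) (use T in blast)
  also have "\<dots> = rat_val (rat_d2 c) z"
    unfolding pq(1) rat_d2_Fract[OF pq(2)] rat_val_Fract[OF q(2)]
    by (simp add: pd_divide(2)[OF h h UNIV_I q(1)] pd_eval2)
  finally show "pd2 (rat_val c) z = rat_val (rat_d2 c) z" .
  show "rat_regular (rat_d1 c) z" "rat_regular (rat_d2 c) z"
    unfolding pq(1) rat_d1_Fract[OF pq(2)] rat_d2_Fract[OF pq(2)] using q(2)
    by (auto intro: rat_regular_Fract)
qed

lemma eventually_rat_regular: "eventually (rat_regular c) (generic S)"
proof -
  obtain p q where "c = Fract p q" "q \<noteq> 0" by (cases c) auto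
  then show ?thesis unfolding eventually_generic using rat_regular_Fract by blast
qed

lemma eventually_rat_nonzero:
  assumes "c \<noteq> 0"
  shows "eventually (\<lambda>z. rat_val c z \<noteq> 0) (generic S)"
proof -
  obtain p q where c: "c = Fract p q" "q \<noteq> 0" by (cases c) auto
  then have "p \<noteq> 0" using assms by (auto simp: Zero_fract_def eq_fract)
  then show ?thesis unfolding eventually_generic using c
    by (intro exI[of _ "p * q"]) (auto simp: rat_val_Fract)
qed

subsection \<open>Differential polynomials as operators\<close>

lemma dpoly_single_induct [case_names single add]:
  fixes A :: dpoly
  assumes single: "\<And>m c. P (Poly_Mapping.single m c)" and add: "\<And>A B. P A \<Longrightarrow> P B \<Longrightarrow> P (A + B)"
  shows "P A"
proof -
  have decomp: "A = (\<Sum>m\<in>Poly_Mapping.keys A. Poly_Mapping.single m (Poly_Mapping.lookup A m))"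
    by (intro poly_mapping_eqI)
      (auto simp: lookup_sum lookup_single when_def in_keys_iff sum.delta)
  have "P (\<Sum>m\<in>I. Poly_Mapping.single m (Poly_Mapping.lookup A m))" if "finite I" for I
    using that
  proof induction
    case empty
    show ?case using single[of 0 0] by simp
  qed (simp add: add single)
  then show ?thesis by (subst decomp) simp
qed

lemma dvar_power: "dvar \<theta> ^ k = Poly_Mapping.single (Poly_Mapping.single \<theta> k) 1"
proof (induction k)
  case (Suc k)
  have "dvar \<theta> ^ Suc k = Poly_Mapping.single (Poly_Mapping.single \<theta> 1 + Poly_Mapping.single \<theta> k) 1"
    unfolding power_Suc Suc by (simp add: dvar_def mult_single del: One_nat_def)
  then show ?case by (simp flip: single_add)
qed simp

lemma single_conv_dvar:
  "Poly_Mapping.single m c = dconst c * (\<Prod>\<theta>\<in>Poly_Mapping.keys m. dvar \<theta> ^ Poly_Mapping.lookup m \<theta>)"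
proof -
  have "(\<Prod>\<theta>\<in>I. dvar \<theta> ^ Poly_Mapping.lookup m \<theta>) =
      Poly_Mapping.single (\<Sum>\<theta>\<in>I. Poly_Mapping.single \<theta> (Poly_Mapping.lookup m \<theta>)) 1" if "finite I" for I
    using that by induction (simp_all add: dvar_power mult_single)
  moreover have "(\<Sum>\<theta>\<in>Poly_Mapping.keys m. Poly_Mapping.single \<theta> (Poly_Mapping.lookup m \<theta>)) = m"
    by (intro poly_mapping_eqI)
      (auto simp: lookup_sum lookup_single when_def in_keys_iff sum.delta)
  ultimately show ?thesis by (simp add: dconst_def mult_single)
qed

lemma dpoly_induct [consumes 1, case_names const var add mult]:
  assumes A: "occurring A \<subseteq> T"
    and const: "\<And>c. P (dconst c)" and var: "\<And>\<theta>. \<theta> \<in> T \<Longrightarrow> P (dvar \<theta>)"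
    and add: "\<And>A B. P A \<Longrightarrow> P B \<Longrightarrow> P (A + B)" and mult: "\<And>A B. P A \<Longrightarrow> P B \<Longrightarrow> P (A * B)"
  shows "P A"
proof -
  have one: "P 1" using const[of 1] by (simp add: dconst_def)
  have pow: "P (dvar \<theta> ^ k)" if "\<theta> \<in> T" for \<theta> k
    by (induction k) (simp_all add: one mult var that)
  have prod: "P (\<Prod>\<theta>\<in>I. dvar \<theta> ^ f \<theta>)" if "finite I" "I \<subseteq> T" for I and f :: "nat \<times> nat \<Rightarrow> nat"
    using that by induction (simp_all add: one mult pow)
  have single: "P (Poly_Mapping.single m c)" if "Poly_Mapping.keys m \<subseteq> T" for m c
    unfolding single_conv_dvar using that by (intro mult const prod) auto
  have decomp: "A = (\<Sum>m\<in>Poly_Mapping.keys A. Poly_Mapping.single m (Poly_Mapping.lookup A m))"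
    by (intro poly_mapping_eqI)
      (auto simp: lookup_sum lookup_single when_def in_keys_iff sum.delta)
  have "P (\<Sum>m\<in>I. Poly_Mapping.single m (Poly_Mapping.lookup A m))"
    if "finite I" "I \<subseteq> Poly_Mapping.keys A" for I
    using that
  proof induction
    case empty
    show ?case using const[of 0] by (simp add: dconst_def)
  next
    case (insert m I)
    then have "Poly_Mapping.keys m \<subseteq> T" using A by (auto simp: occurring_def)
    with insert show ?case by (simp add: add single)
  qed
  then show ?thesis by (subst decomp) simp
qed

definition monom_val :: "(complex \<times> complex \<Rightarrow> complex) \<Rightarrow> complex \<times> complex \<Rightarrow> dmonom \<Rightarrow> complex" where
  "monom_val u z m = (\<Prod>\<theta>\<in>Poly_Mapping.keys m.
     ((pd1 ^^ fst \<theta>) ((pd2 ^^ snd \<theta>) u) z) ^ Poly_Mapping.lookup m \<theta>)"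

lemma monom_val_superset:
  assumes "finite T" "Poly_Mapping.keys m \<subseteq> T"
  shows "monom_val u z m = (\<Prod>\<theta>\<in>T. ((pd1 ^^ fst \<theta>) ((pd2 ^^ snd \<theta>) u) z) ^ Poly_Mapping.lookup m \<theta>)"
  unfolding monom_val_def by (rule prod.mono_neutral_left) (use assms in \<open>auto simp: in_keys_iff\<close>)

lemma monom_val_add: "monom_val u z (m + n) = monom_val u z m * monom_val u z n"
proof -
  let ?T = "Poly_Mapping.keys m \<union> Poly_Mapping.keys n"
  have T: "finite ?T" by simp
  show ?thesis
    unfolding monom_val_superset[OF T Poly_Mapping.keys_add]
      monom_val_superset[OF T Un_upper1] monom_val_superset[OF T Un_upper2]
    by (simp add: lookup_add power_add prod.distrib)
qed

lemma diff_op_superset: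
  assumes "finite M" "Poly_Mapping.keys A \<subseteq> M"
  shows "diff_op A u z = (\<Sum>m\<in>M. rat_val (Poly_Mapping.lookup A m) z * monom_val u z m)"
  unfolding diff_op_def monom_val_def[symmetric]
  by (rule sum.mono_neutral_left) (use assms in \<open>auto simp: in_keys_iff\<close>)

lemma diff_op_single: "diff_op (Poly_Mapping.single m c) u z = rat_val c z * monom_val u z m"
  by (subst diff_op_superset[of "{m}"]) auto

lemma diff_op_dconst: "diff_op (dconst c) u z = rat_val c z"
  by (simp add: dconst_def diff_op_single monom_val_def)

lemma diff_op_dvar: "diff_op (dvar (i, j)) u z = (pd1 ^^ i) ((pd2 ^^ j) u) z"
  by (simp add: dvar_def diff_op_single monom_val_def)

lemma diff_op_0 [simp]: "diff_op 0 u z = 0"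
  by (simp add: diff_op_def)

lemma eventually_diff_op_add:
  "eventually (\<lambda>z. diff_op (A + B) u z = diff_op A u z + diff_op B u z) (generic S)"
proof -
  let ?M = "Poly_Mapping.keys A \<union> Poly_Mapping.keys B"
  have M: "finite ?M" by simp
  have "eventually (\<lambda>z. \<forall>m\<in>?M. rat_regular (Poly_Mapping.lookup A m) z \<and> rat_regular (Poly_Mapping.lookup B m) z) (generic S)"
    by (intro eventually_ball_finite M ballI eventually_conj eventually_rat_regular)
  then show ?thesis
  proof eventually_elim
    case (elim z)
    show ?case
      unfolding diff_op_superset[OF M Poly_Mapping.keys_add]
        diff_op_superset[OF M Un_upper1] diff_op_superset[OF M Un_upper2] sum.distrib[symmetric]
      using elim by (intro sum.cong refl) (auto simp: lookup_add rat_val_add(1) algebra_simps)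
  qed
qed

lemma eventually_diff_op_mult:
  "eventually (\<lambda>z. diff_op (A * B) u z = diff_op A u z * diff_op B u z) (generic S)"
proof (induction A rule: dpoly_single_induct)
  case (single m c)
  show ?case
  proof (induction B rule: dpoly_single_induct)
    case (single n d)
    have "eventually (\<lambda>z. rat_regular c z \<and> rat_regular d z) (generic S)"
      by (intro eventually_conj eventually_rat_regular)
    then show ?case
      by eventually_elim (simp add: mult_single diff_op_single monom_val_add rat_val_mult(1) mult_ac)
  next
    case (add B1 B2)
    then show ?case
      using eventually_diff_op_add[of B1 B2 u S]
        eventually_diff_op_add[of "Poly_Mapping.single m c * B1" "Poly_Mapping.single m c * B2" u S]
      by eventually_elim (simp add: distrib_left)
  qed
next
  case (add A1 A2)
  then show ?case
    using eventually_diff_op_add[of A1 A2 u S] eventually_diff_op_add[of "A1 * B" "A2 * B" u S]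
    by eventually_elim (simp add: distrib_right)
qed

text \<open>Since \<open>rat_val\<close> has arbitrary values at poles, \<open>diff_op A u\<close>
  need not be holomorphic on the whole domain; the notion is therefore local.\<close>

definition hol2_at :: "(complex \<times> complex \<Rightarrow> complex) \<Rightarrow> complex \<times> complex \<Rightarrow> bool" where
  "hol2_at u z \<longleftrightarrow> (\<exists>T. z \<in> T \<and> hol2 u T)"

lemma hol2_at_cong:
  assumes "open T" "z \<in> T" "\<And>x. x \<in> T \<Longrightarrow> u x = v x" "hol2_at v z"
  shows "hol2_at u z"
proof -
  obtain T' where T': "z \<in> T'" "hol2 v T'" using assms(4) by (auto simp: hol2_at_def)
  then have "hol2 v (T \<inter> T')" using hol2_subset hol2_open assms(1) by (metis Int_lower2 open_Int)
  then have "hol2 u (T \<inter> T')" using hol2_cong[of "T \<inter> T'" u v] assms(3) by auto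
  then show ?thesis using T' assms(2) by (auto simp: hol2_at_def)
qed

lemma hol2_at_common:
  assumes "hol2_at u z" "hol2_at v z"
  obtains T where "z \<in> T" "hol2 u T" "hol2 v T"
proof -
  obtain T T' where T: "z \<in> T" "hol2 u T" "z \<in> T'" "hol2 v T'" using assms by (auto simp: hol2_at_def)
  then have o: "open (T \<inter> T')" by (auto intro: hol2_open)
  show ?thesis using T hol2_subset[OF T(2) _ o] hol2_subset[OF T(4) _ o] by (intro that[of "T \<inter> T'"]) auto
qed

text \<open>Induction over the generators. Sums and products are evaluated correctly only
  generically, but then on neighbourhoods, so that the sum and product rules for functions carry
  over.\<close>

lemma eventually_diff_op_deriv:
  assumes u: "hol2 u S"
  shows "eventually (\<lambda>z. hol2_at (diff_op A u) z \<and> pd1 (diff_op A u) z = diff_op (dpoly_d1 A) u z \<and>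
     pd2 (diff_op A u) z = diff_op (dpoly_d2 A) u z) (generic S)"
proof -
  have S: "open S" by (rule hol2_open[OF u])
  show ?thesis
  proof (induction A rule: dpoly_induct[OF subset_UNIV])
    case (1 c)
    have "eventually (\<lambda>z. \<exists>T. open T \<and> z \<in> T \<and> T \<subseteq> S \<and> (\<forall>x\<in>T. rat_regular c x)) (generic S)"
      by (rule eventually_generic_open[OF eventually_rat_regular S])
    then show ?case
    proof eventually_elim
      case (elim z)
      have eq: "diff_op (dconst c) u = rat_val c" for c by (auto simp: diff_op_dconst)
      obtain T where T: "open T" "z \<in> T" "\<And>x. x \<in> T \<Longrightarrow> rat_regular c x" using elim by blast
      then have "hol2_at (rat_val c) z" using hol2_rat_val[OF T(1,3)] by (auto simp: hol2_at_def)
      then show ?case using pd_rat_val[OF T(3)[OF T(2)]]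
        by (simp add: eq dpoly_d1_derivation dpoly_d2_derivation)
    qed
  next
    case (2 \<theta>)
    obtain i j where \<theta>: "\<theta> = (i, j)" by (cases \<theta>)
    have eq: "diff_op (dvar (i, j)) u = (pd1 ^^ i) ((pd2 ^^ j) u)" for i j by (auto simp: diff_op_dvar)
    show ?case using eventually_generic_in[of S]
    proof eventually_elim
      case (elim z)
      have "hol2 ((pd2 ^^ j) u) S" using hol2_funpow[OF u, of 0 j] by simp
      from pd2_funpow_pd1[OF this elim, of i] show ?case
        unfolding \<theta> dpoly_d1_derivation dpoly_d2_derivation eq hol2_at_def
        using hol2_funpow[OF u, of i j] elim by auto
    qed
  next
    case (3 A B)
    show ?case
      using 3 eventually_generic_open[OF eventually_diff_op_add[of A B u S] S]
        eventually_diff_op_add[of "dpoly_d1 A" "dpoly_d1 B" u S] eventually_diff_op_add[of "dpoly_d2 A" "dpoly_d2 B" u S]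
    proof eventually_elim
      case (elim z)
      then obtain T where T: "z \<in> T" "hol2 (diff_op A u) T" "hol2 (diff_op B u) T"
        using hol2_at_common by blast
      obtain T' where T': "open T'" "z \<in> T'"
        "\<And>x. x \<in> T' \<Longrightarrow> diff_op (A + B) u x = diff_op A u x + diff_op B u x" using elim by blast
      have "hol2_at (\<lambda>x. diff_op A u x + diff_op B u x) z"
        using T hol2_add by (auto simp: hol2_at_def)
      from hol2_at_cong[OF T' this] show ?case
        using elim pd_cong[OF T'(1,3,2)] pd_add[OF T(2,3,1)]
        by (simp add: dpoly_d1_derivation dpoly_d2_derivation)
    qed
  next
    case (4 A B)
    show ?case
      using 4 eventually_generic_open[OF eventually_diff_op_mult[of A B u S] S]
        eventually_diff_op_add[of "dpoly_d1 A * B" "A * dpoly_d1 B" u S]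
        eventually_diff_op_add[of "dpoly_d2 A * B" "A * dpoly_d2 B" u S]
        eventually_diff_op_mult[of "dpoly_d1 A" B u S] eventually_diff_op_mult[of "dpoly_d2 A" B u S]
        eventually_diff_op_mult[of A "dpoly_d1 B" u S] eventually_diff_op_mult[of A "dpoly_d2 B" u S]
    proof eventually_elim
      case (elim z)
      then obtain T where T: "z \<in> T" "hol2 (diff_op A u) T" "hol2 (diff_op B u) T"
        using hol2_at_common by blast
      obtain T' where T': "open T'" "z \<in> T'"
        "\<And>x. x \<in> T' \<Longrightarrow> diff_op (A * B) u x = diff_op A u x * diff_op B u x" using elim by blast
      have "hol2_at (\<lambda>x. diff_op A u x * diff_op B u x) z"
        using T hol2_mult by (auto simp: hol2_at_def)
      from hol2_at_cong[OF T' this] show ?case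
        using elim pd_cong[OF T'(1,3,2)] pd_mult[OF T(2,3,1)]
        by (simp add: dpoly_d1_derivation dpoly_d2_derivation)
    qed
  qed
qed

text \<open>Vanishing is required only generically, which makes closure under sums and products
  immediate although evaluation is not a homomorphism at poles.\<close>

definition annihilator :: "(complex \<times> complex \<Rightarrow> complex) \<Rightarrow> (complex \<times> complex) set \<Rightarrow> dpoly set" where
  "annihilator u S = {A. eventually (\<lambda>z. diff_op A u z = 0) (generic S)}"

lemma differential_ideal_annihilator:
  assumes u: "hol2 u S"
  shows "differential_ideal (annihilator u S)"
proof -
  have "A + B \<in> annihilator u S" if "A \<in> annihilator u S" "B \<in> annihilator u S" for A B
    using that[unfolded annihilator_def mem_Collect_eq] eventually_diff_op_add[of A B u S]
    unfolding annihilator_def mem_Collect_eq by eventually_elim simp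
  moreover have "C * A \<in> annihilator u S" if "A \<in> annihilator u S" for A C
    using that[unfolded annihilator_def mem_Collect_eq] eventually_diff_op_mult[of C A u S]
    unfolding annihilator_def mem_Collect_eq by eventually_elim simp
  moreover have "dpoly_d1 A \<in> annihilator u S" "dpoly_d2 A \<in> annihilator u S" if "A \<in> annihilator u S" for A
  proof -
    have "eventually (\<lambda>z. pd1 (diff_op A u) z = 0 \<and> pd2 (diff_op A u) z = 0) (generic S)"
      using eventually_generic_open[OF that[unfolded annihilator_def mem_Collect_eq] hol2_open[OF u]]
    proof eventually_elim
      case (elim z)
      then obtain T where T: "open T" "z \<in> T" "\<And>x. x \<in> T \<Longrightarrow> diff_op A u x = 0" by blast
      show ?case using pd_cong[OF T(1,3,2)] by (simp add: pd_const)
    qed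
    with eventually_diff_op_deriv[OF u, of A]
    have "eventually (\<lambda>z. diff_op (dpoly_d1 A) u z = 0 \<and> diff_op (dpoly_d2 A) u z = 0) (generic S)"
      by eventually_elim auto
    then show "dpoly_d1 A \<in> annihilator u S" "dpoly_d2 A \<in> annihilator u S"
      by (auto simp: annihilator_def eventually_conj_iff)
  qed
  ultimately show ?thesis
    unfolding differential_ideal_def by (auto simp: annihilator_def)
qed

text \<open>Away from the poles of the coefficients the value of the operator is continuous, so it
  vanishes there as soon as it vanishes on a dense set. Conversely, poles are avoided
  generically.\<close>

lemma annihilator_iff_satisfies:
  assumes u: "hol2 u S"
  shows "A \<in> annihilator u S \<longleftrightarrow> satisfies_on u A S"
proof
  assume A: "A \<in> annihilator u S"
  define T where "T = S - sing_pts A"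
  have T_eq: "T = (\<Inter>m\<in>Poly_Mapping.keys A. {z \<in> S. rat_regular (Poly_Mapping.lookup A m) z}) \<inter> S"
    by (auto simp: T_def sing_pts_def)
  have T: "open T" unfolding T_eq
    by (intro open_Int open_INT ballI open_rat_regular hol2_open[OF u]) auto
  have "hol2 (diff_op A u) T"
    unfolding diff_op_def
  proof (intro hol2_sum T hol2_mult hol2_prod hol2_power)
    show "hol2 (rat_val (Poly_Mapping.lookup A m)) T" if "m \<in> Poly_Mapping.keys A" for m
      by (rule hol2_rat_val[OF T]) (use that in \<open>auto simp: T_def sing_pts_def\<close>)
    show "hol2 ((pd1 ^^ fst \<theta>) ((pd2 ^^ snd \<theta>) u)) T" for \<theta> :: "nat \<times> nat"
      by (rule hol2_subset[OF hol2_funpow[OF u] _ T]) (auto simp: T_def)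
  qed
  then have "continuous_on T (diff_op A u)" by (rule hol2_continuous)
  then show "satisfies_on u A S"
    using generic_zero_imp_zero[OF A[unfolded annihilator_def mem_Collect_eq] T]
    unfolding satisfies_on_def T_def by blast
next
  assume sat: "satisfies_on u A S"
  have "eventually (\<lambda>z. \<forall>m\<in>Poly_Mapping.keys A. rat_regular (Poly_Mapping.lookup A m) z) (generic S)"
    by (intro eventually_ball_finite ballI eventually_rat_regular) auto
  with eventually_generic_in[of S] have "eventually (\<lambda>z. diff_op A u z = 0) (generic S)"
    by eventually_elim (use sat in \<open>auto simp: satisfies_on_def sing_pts_def\<close>)
  then show "A \<in> annihilator u S" by (simp add: annihilator_def)
qed

lemma vf_in_annihilator_iff:
  assumes u: "hol2 u S"
  shows "vf_dpoly X1 X2 \<in> annihilator u S \<longleftrightarrow> (\<forall>z\<in>S. eval2 X1 z * pd1 u z + eval2 X2 z * pd2 u z = 0)"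
proof -
  have "eventually (\<lambda>z. diff_op (vf_dpoly X1 X2) u z = eval2 X1 z * pd1 u z + eval2 X2 z * pd2 u z) (generic S)"
    unfolding vf_dpoly_def
    using eventually_diff_op_add[of "dconst (Fract X1 1) * dvar (1, 0)" "dconst (Fract X2 1) * dvar (0, 1)" u S]
      eventually_diff_op_mult[of "dconst (Fract X1 1)" "dvar (1, 0)" u S]
      eventually_diff_op_mult[of "dconst (Fract X2 1)" "dvar (0, 1)" u S]
    by eventually_elim (simp add: diff_op_dconst diff_op_dvar rat_val_of_bipoly)
  then have "vf_dpoly X1 X2 \<in> annihilator u S \<longleftrightarrow>
      eventually (\<lambda>z. eval2 X1 z * pd1 u z + eval2 X2 z * pd2 u z = 0) (generic S)"
    unfolding annihilator_def mem_Collect_eq by (rule eventually_cong) auto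
  also have "\<dots> \<longleftrightarrow> (\<forall>z\<in>S. eval2 X1 z * pd1 u z + eval2 X2 z * pd2 u z = 0)"
  proof
    assume *: "eventually (\<lambda>z. eval2 X1 z * pd1 u z + eval2 X2 z * pd2 u z = 0) (generic S)"
    have "hol2 (\<lambda>z. eval2 X1 z * pd1 u z + eval2 X2 z * pd2 u z) S"
      by (intro hol2_add hol2_mult hol2_eval2 hol2_pd1 hol2_pd2 u hol2_open[OF u])
    from generic_zero_imp_zero[OF * hol2_open[OF u] subset_refl hol2_continuous[OF this]]
    show "\<forall>z\<in>S. eval2 X1 z * pd1 u z + eval2 X2 z * pd2 u z = 0" by blast
  next
    assume "\<forall>z\<in>S. eval2 X1 z * pd1 u z + eval2 X2 z * pd2 u z = 0"
    then show "eventually (\<lambda>z. eval2 X1 z * pd1 u z + eval2 X2 z * pd2 u z = 0) (generic S)"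
      using eventually_generic_in[of S] by (auto elim: eventually_mono)
  qed
  finally show ?thesis .
qed

lemma one_not_in_annihilator:
  assumes "open S" "S \<noteq> {}" "c \<noteq> 0"
  shows "dconst c \<notin> annihilator u S"
proof
  assume "dconst c \<in> annihilator u S"
  then have "eventually (\<lambda>z. rat_val c z = 0) (generic S)" by (simp add: annihilator_def diff_op_dconst)
  with eventually_rat_nonzero[OF assms(3), of S] have "eventually (\<lambda>z. False) (generic S)"
    by eventually_elim auto
  then show False using generic_neq_bot[OF assms(1,2)] by (simp add: trivial_limit_def)
qed

section \<open>Linear Pfaffian systems\<close>

text \<open>The Taylor coefficients of the solution of \<open>v' = A v + B w\<close>,
  \<open>w' = C v + D w\<close> with initial values \<open>x\<close>, \<open>y\<close>, when
  \<open>A\<close>, \<open>B\<close>, \<open>C\<close>, \<open>D\<close> are given by their own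
  Taylor coefficients.\<close>

fun lin_rec :: "(nat \<Rightarrow> complex) \<Rightarrow> (nat \<Rightarrow> complex) \<Rightarrow> (nat \<Rightarrow> complex) \<Rightarrow> (nat \<Rightarrow> complex) \<Rightarrow>
    complex \<Rightarrow> complex \<Rightarrow> nat \<Rightarrow> complex \<times> complex" where
  "lin_rec A B C D x y 0 = (x, y)"
| "lin_rec A B C D x y (Suc k) =
    ((\<Sum>i\<le>k. A i * fst (lin_rec A B C D x y (k - i)) + B i * snd (lin_rec A B C D x y (k - i))) / of_nat (Suc k),
     (\<Sum>i\<le>k. C i * fst (lin_rec A B C D x y (k - i)) + D i * snd (lin_rec A B C D x y (k - i))) / of_nat (Suc k))"

text \<open>Each of the \<open>n + 1\<close> summands is at most \<open>2 * K * M * L ^ n\<close>,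
  and their number is cancelled by the denominator \<open>n + 1\<close> of the recursion. The
  condition \<open>2 * K \<le> L\<close> then absorbs the remaining factor.\<close>

lemma lin_rec_bound:
  assumes A: "\<And>i. norm (A i) \<le> K * \<rho> ^ i" "\<And>i. norm (B i) \<le> K * \<rho> ^ i"
    "\<And>i. norm (C i) \<le> K * \<rho> ^ i" "\<And>i. norm (D i) \<le> K * \<rho> ^ i"
    and xy: "norm x \<le> M" "norm y \<le> M" and L: "0 \<le> \<rho>" "\<rho> \<le> L" "2 * K \<le> L" and K: "0 \<le> K"
  shows "norm (fst (lin_rec A B C D x y k)) \<le> M * L ^ k \<and> norm (snd (lin_rec A B C D x y k)) \<le> M * L ^ k"
proof (induction k rule: less_induct)
  case (less k)
  have M: "0 \<le> M" using xy(1) norm_ge_zero order_trans by blast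
  show ?case
  proof (cases k)
    case 0
    then show ?thesis using xy by simp
  next
    case (Suc n)
    let ?f = "\<lambda>i. lin_rec A B C D x y (n - i)"
    have step: "norm ((\<Sum>i\<le>n. P i * fst (?f i) + Q i * snd (?f i)) / of_nat (Suc n)) \<le> M * L ^ k"
      if P: "\<And>i. norm (P i) \<le> K * \<rho> ^ i" and Q: "\<And>i. norm (Q i) \<le> K * \<rho> ^ i" for P Q :: "nat \<Rightarrow> complex"
    proof -
      have "norm (\<Sum>i\<le>n. P i * fst (?f i) + Q i * snd (?f i)) \<le> (\<Sum>i\<le>n. 2 * K * (M * L ^ n))"
      proof (rule order_trans[OF norm_sum], rule sum_mono)
        fix i assume "i \<in> {..n}"
        then have i: "i \<le> n" by simp
        then have IH: "norm (fst (?f i)) \<le> M * L ^ (n - i)" "norm (snd (?f i)) \<le> M * L ^ (n - i)"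
          using less[of "n - i"] Suc by auto
        have pow: "\<rho> ^ i * L ^ (n - i) \<le> L ^ n"
          using mult_right_mono[OF power_mono[OF L(2,1), of i], of "L ^ (n - i)"] L i
          by (simp flip: power_add)
        have one: "norm (p * q) \<le> K * (M * L ^ n)" if "norm p \<le> K * \<rho> ^ i" "norm q \<le> M * L ^ (n - i)" for p q :: complex
        proof -
          have "norm (p * q) \<le> (K * \<rho> ^ i) * (M * L ^ (n - i))"
            unfolding norm_mult using that K L by (intro mult_mono) auto
          also have "\<dots> = K * M * (\<rho> ^ i * L ^ (n - i))" by simp
          also have "\<dots> \<le> K * M * L ^ n" using pow K M by (intro mult_left_mono) auto
          finally show ?thesis by simp
        qed
        show "norm (P i * fst (?f i) + Q i * snd (?f i)) \<le> 2 * K * (M * L ^ n)"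
          using norm_triangle_ineq[of "P i * fst (?f i)" "Q i * snd (?f i)"]
            one[OF P IH(1)] one[OF Q IH(2)] by simp
      qed
      also have "\<dots> = real (Suc n) * (2 * K * (M * L ^ n))" by simp
      finally have "norm ((\<Sum>i\<le>n. P i * fst (?f i) + Q i * snd (?f i)) / of_nat (Suc n)) \<le> 2 * K * (M * L ^ n)"
        by (simp only: norm_divide norm_of_nat) (simp add: divide_le_eq mult.commute del: of_nat_Suc)
      also have "\<dots> \<le> L * (M * L ^ n)"
        using L M by (intro mult_right_mono) auto
      finally show ?thesis by (simp add: Suc mult_ac)
    qed
    have "norm (fst (lin_rec A B C D x y (Suc n))) \<le> M * L ^ k" "norm (snd (lin_rec A B C D x y (Suc n))) \<le> M * L ^ k"
      unfolding lin_rec.simps fst_conv snd_conv using step[OF A(1,2)] step[OF A(3,4)] by blast+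
    then show ?thesis unfolding Suc by blast
  qed
qed

lemma lin_rec_series:
  fixes A B C D :: "nat \<Rightarrow> complex"
  assumes A: "\<And>i. norm (A i) \<le> K * \<rho> ^ i" "\<And>i. norm (B i) \<le> K * \<rho> ^ i"
    "\<And>i. norm (C i) \<le> K * \<rho> ^ i" "\<And>i. norm (D i) \<le> K * \<rho> ^ i"
    and xy: "norm x \<le> M" "norm y \<le> M" and L: "0 \<le> \<rho>" "\<rho> \<le> L" "2 * K \<le> L" "0 < L" and K: "0 \<le> K"
    and t: "norm t * L < 1"
  defines "v \<equiv> \<lambda>k. fst (lin_rec A B C D x y k)" and "w \<equiv> \<lambda>k. snd (lin_rec A B C D x y k)"
  shows "((\<lambda>t. suminf (\<lambda>k. v k * t ^ k)) has_field_derivative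
      (suminf (\<lambda>k. A k * t ^ k)) * (suminf (\<lambda>k. v k * t ^ k)) + (suminf (\<lambda>k. B k * t ^ k)) * (suminf (\<lambda>k. w k * t ^ k))) (at t)"
    "((\<lambda>t. suminf (\<lambda>k. w k * t ^ k)) has_field_derivative
      (suminf (\<lambda>k. C k * t ^ k)) * (suminf (\<lambda>k. v k * t ^ k)) + (suminf (\<lambda>k. D k * t ^ k)) * (suminf (\<lambda>k. w k * t ^ k))) (at t)"
proof -
  note bound = lin_rec_bound[OF A xy L(1-3) K]
  \<comment> \<open>A radius strictly between \<open>norm t\<close> and \<open>1 / L\<close> leaves
    room for termwise differentiation.\<close>
  obtain s where s: "norm t < s" "s * L < 1"
    using dense[of "norm t" "1 / L"] t L(4) by (auto simp: field_simps)
  have sum_bd: "summable (\<lambda>k. norm (c k * u ^ k))"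
    if "\<And>k. norm (c k) \<le> N * L ^ k" "norm u \<le> s" for c :: "nat \<Rightarrow> complex" and N u
  proof (rule summable_comparison_test')
    have "0 \<le> s" using s(1) norm_ge_zero[of t] by linarith
    then show "summable (\<lambda>k. N * (s * L) ^ k)"
      using s L(4) by (intro summable_mult summable_geometric) auto
    fix k
    have N: "0 \<le> N" using order_trans[OF norm_ge_zero that(1)[of 0]] by simp
    have "norm (c k) * norm u ^ k \<le> (N * L ^ k) * s ^ k"
      using that N L(4) by (intro mult_mono power_mono) auto
    then show "norm (norm (c k * u ^ k)) \<le> N * (s * L) ^ k"
      by (simp add: norm_mult norm_power power_mult_distrib mult_ac)
  qed
  have AL: "norm (c k) \<le> K * L ^ k" if "\<And>i. norm (c i) \<le> K * \<rho> ^ i" for c :: "nat \<Rightarrow> complex" and k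
    using that[of k] mult_left_mono[OF power_mono[OF L(2,1), of k] K] by linarith
  have vb: "norm (v k) \<le> M * L ^ k" "norm (w k) \<le> M * L ^ k" for k
    using bound[of k] by (auto simp: v_def w_def)
  have s0: "0 \<le> s" "norm t \<le> s" using s(1) norm_ge_zero[of t] by linarith+
  have deriv: "((\<lambda>t. suminf (\<lambda>k. f k * t ^ k)) has_field_derivative
      (suminf (\<lambda>k. P k * t ^ k)) * (suminf (\<lambda>k. v k * t ^ k)) + (suminf (\<lambda>k. Q k * t ^ k)) * (suminf (\<lambda>k. w k * t ^ k))) (at t)"
    if P: "\<And>i. norm (P i) \<le> K * \<rho> ^ i" and Q: "\<And>i. norm (Q i) \<le> K * \<rho> ^ i"
      and f: "\<And>k. norm (f k) \<le> M * L ^ k"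
      and rec: "\<And>k. f (Suc k) = (\<Sum>i\<le>k. P i * v (k - i) + Q i * w (k - i)) / of_nat (Suc k)" for P Q f
  proof -
    have "summable (\<lambda>k. f k * of_real s ^ k)"
      by (rule summable_norm_cancel[OF sum_bd[OF f]]) (use s0 in simp)
    then have "((\<lambda>t. suminf (\<lambda>k. f k * t ^ k)) has_field_derivative (suminf (\<lambda>k. diffs f k * t ^ k))) (at t)"
      by (rule termdiffs_strong) (use s s0 in simp)
    also have "(\<lambda>k. diffs f k * t ^ k) =
      (\<lambda>k. (\<Sum>i\<le>k. (P i * t ^ i) * (v (k - i) * t ^ (k - i))) + (\<Sum>i\<le>k. (Q i * t ^ i) * (w (k - i) * t ^ (k - i))))"
    proof
      fix k
      have "diffs f k * t ^ k = (\<Sum>i\<le>k. P i * v (k - i) + Q i * w (k - i)) * t ^ k"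
        unfolding diffs_def rec by (simp del: of_nat_Suc)
      also have "\<dots> = (\<Sum>i\<le>k. (P i * t ^ i) * (v (k - i) * t ^ (k - i)) + (Q i * t ^ i) * (w (k - i) * t ^ (k - i)))"
        unfolding sum_distrib_right
      proof (intro sum.cong refl)
        fix i assume "i \<in> {..k}"
        then have "t ^ k = t ^ i * t ^ (k - i)" by (simp flip: power_add)
        then show "(P i * v (k - i) + Q i * w (k - i)) * t ^ k =
            P i * t ^ i * (v (k - i) * t ^ (k - i)) + Q i * t ^ i * (w (k - i) * t ^ (k - i))"
          by (simp add: algebra_simps)
      qed
      finally show "diffs f k * t ^ k = (\<Sum>i\<le>k. (P i * t ^ i) * (v (k - i) * t ^ (k - i))) +
          (\<Sum>i\<le>k. (Q i * t ^ i) * (w (k - i) * t ^ (k - i)))"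
        by (simp add: sum.distrib)
    qed
    also have "suminf \<dots> = (suminf (\<lambda>k. P k * t ^ k)) * (suminf (\<lambda>k. v k * t ^ k)) + (suminf (\<lambda>k. Q k * t ^ k)) * (suminf (\<lambda>k. w k * t ^ k))"
      by (rule sums_unique[symmetric], intro sums_add Cauchy_product_sums sum_bd[OF AL[OF P] s0(2)]
        sum_bd[OF AL[OF Q] s0(2)] sum_bd[OF vb(1) s0(2)] sum_bd[OF vb(2) s0(2)])
    finally show ?thesis .
  qed
  show "((\<lambda>t. suminf (\<lambda>k. v k * t ^ k)) has_field_derivative
      (suminf (\<lambda>k. A k * t ^ k)) * (suminf (\<lambda>k. v k * t ^ k)) + (suminf (\<lambda>k. B k * t ^ k)) * (suminf (\<lambda>k. w k * t ^ k))) (at t)"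
    by (rule deriv[OF A(1,2) vb(1)]) (simp add: v_def w_def)
  show "((\<lambda>t. suminf (\<lambda>k. w k * t ^ k)) has_field_derivative
      (suminf (\<lambda>k. C k * t ^ k)) * (suminf (\<lambda>k. v k * t ^ k)) + (suminf (\<lambda>k. D k * t ^ k)) * (suminf (\<lambda>k. w k * t ^ k))) (at t)"
    by (rule deriv[OF A(3,4) vb(2)]) (simp add: v_def w_def)
qed

section \<open>Linear differential equations with a parameter\<close>

lemma hol2_of_snd:
  assumes "f holomorphic_on A" "open A" "open S" "\<And>z. z \<in> S \<Longrightarrow> snd z \<in> A"
  shows "hol2 (\<lambda>z. f (snd z)) S"
proof (rule hol2I[OF assms(3)])
  show "continuous_on S (\<lambda>z. f (snd z))"
    by (intro continuous_on_compose2[OF holomorphic_on_imp_continuous_on[OF assms(1)]] continuous_intros)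
      (use assms(4) in auto)
  show "\<exists>d. ((\<lambda>w. f (snd (a, w))) has_field_derivative d) (at b)" if "(a, b) \<in> S" for a b
    using holomorphic_derivI[OF assms(1,2), of b] assms(4)[OF that] by auto
qed (auto intro: exI[of _ 0])

text \<open>The second coordinate is the parameter. Cauchy estimates bound the Taylor coefficients
  of the given functions uniformly in it, and the recursion keeps the coefficients of the solution
  holomorphic in it. The series therefore converges uniformly on a smaller polydisc and is
  \<open>hol2\<close> there.\<close>

lemma linear_ode_with_parameter:
  assumes a: "hol2 a11 S" "hol2 a12 S" "hol2 a21 S" "hol2 a22 S"
    and R: "cbidisc p R \<subseteq> S" "R > 0"
    and f: "f holomorphic_on ball (snd p) R" "\<And>y. y \<in> ball (snd p) R \<Longrightarrow> norm (f y) \<le> M"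
    and g: "g holomorphic_on ball (snd p) R" "\<And>y. y \<in> ball (snd p) R \<Longrightarrow> norm (g y) \<le> M"
  obtains r v w where "r > 0" "r \<le> R" "hol2 v (bidisc p r)" "hol2 w (bidisc p r)"
    "\<forall>z\<in>bidisc p r. pd1 v z = a11 z * v z + a12 z * w z"
    "\<forall>z\<in>bidisc p r. pd1 w z = a21 z * v z + a22 z * w z"
    "\<forall>y\<in>ball (snd p) r. v (fst p, y) = f y" "\<forall>y\<in>ball (snd p) r. w (fst p, y) = g y"
proof -
  obtain K1 where K1: "\<And>z. z \<in> cbidisc p R \<Longrightarrow> norm (a11 z) \<le> K1" using hol2_bounded[OF a(1) R(1)] by blast
  obtain K2 where K2: "\<And>z. z \<in> cbidisc p R \<Longrightarrow> norm (a12 z) \<le> K2" using hol2_bounded[OF a(2) R(1)] by blast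
  obtain K3 where K3: "\<And>z. z \<in> cbidisc p R \<Longrightarrow> norm (a21 z) \<le> K3" using hol2_bounded[OF a(3) R(1)] by blast
  obtain K4 where K4: "\<And>z. z \<in> cbidisc p R \<Longrightarrow> norm (a22 z) \<le> K4" using hol2_bounded[OF a(4) R(1)] by blast
  define K where "K = max 0 (max (max K1 K2) (max K3 K4))"
  have K0: "0 \<le> K" by (simp add: K_def)
  have K: "norm (a11 z) \<le> K" "norm (a12 z) \<le> K" "norm (a21 z) \<le> K" "norm (a22 z) \<le> K"
    if "z \<in> cbidisc p R" for z
    using K1[OF that] K2[OF that] K3[OF that] K4[OF that] by (auto simp: K_def)
  \<comment> \<open>\<open>1 / R\<close> is the ratio in the Cauchy estimates, and
    \<open>2 * K\<close> is demanded by the recursion.\<close>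
  define L where "L = max (1 / R) (max (2 * K) 1)"
  have L: "0 \<le> 1 / R" "1 / R \<le> L" "2 * K \<le> L" "0 < L" using R(2) by (auto simp: L_def)
  define cf where "cf a y i = (pd1 ^^ i) a (fst p, y) / fact i" for a y i
  have cf_bound: "norm (cf a y i) \<le> K * (1 / R) ^ i"
    if "hol2 a S" "\<And>z. z \<in> cbidisc p R \<Longrightarrow> norm (a z) \<le> K" "y \<in> ball (snd p) R" for a y i
  proof -
    have "norm ((pd1 ^^ i) a (fst p, y)) \<le> fact i * K / R ^ i"
      by (rule hol2_power_series_bound(1)[OF that(1) R that(2)]) (use that in auto)
    then show ?thesis by (simp add: cf_def norm_divide field_simps)
  qed
  have cf_sums: "(suminf (\<lambda>i. cf a y i * (x - fst p) ^ i)) = a (x, y)"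
    if "hol2 a S" "\<And>z. z \<in> cbidisc p R \<Longrightarrow> norm (a z) \<le> K" "y \<in> ball (snd p) R" "x \<in> ball (fst p) R" for a x y
    using hol2_power_series_bound(2)[OF that(1) R that(2), of y x] that(3,4)
    by (simp add: cf_def sums_iff)
  have cf_hol: "(\<lambda>y. cf a y i) holomorphic_on ball (snd p) R" if "hol2 a S" for a i
  proof -
    have "hol2 ((pd1 ^^ i) a) S" using hol2_funpow[OF that, of i 0] by simp
    then show ?thesis unfolding cf_def using R(2)
      by (intro holomorphic_intros hol2_slice2[of _ S]) (auto simp: cbidisc_def intro!: subsetD[OF R(1)])
  qed
  define rec where "rec y = lin_rec (cf a11 y) (cf a12 y) (cf a21 y) (cf a22 y) (f y) (g y)" for y
  have rec_hol: "(\<lambda>y. fst (rec y k)) holomorphic_on ball (snd p) R \<and> (\<lambda>y. snd (rec y k)) holomorphic_on ball (snd p) R" for k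
  proof (induction k rule: less_induct)
    case (less k)
    show ?case
    proof (cases k)
      case 0
      then show ?thesis using f g by (simp add: rec_def)
    next
      case (Suc n)
      have IH: "(\<lambda>y. fst (rec y (n - i))) holomorphic_on ball (snd p) R"
        "(\<lambda>y. snd (rec y (n - i))) holomorphic_on ball (snd p) R" for i
        using less[of "n - i"] Suc by auto
      have "rec y k = ((\<Sum>i\<le>n. cf a11 y i * fst (rec y (n - i)) + cf a12 y i * snd (rec y (n - i))) / of_nat (Suc n),
         (\<Sum>i\<le>n. cf a21 y i * fst (rec y (n - i)) + cf a22 y i * snd (rec y (n - i))) / of_nat (Suc n))" for y
        unfolding rec_def Suc by simp
      then show ?thesis
        using IH a by (simp del: of_nat_Suc) (intro conjI holomorphic_intros cf_hol; simp del: of_nat_Suc)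
    qed
  qed
  \<comment> \<open>This makes the series of the solution dominated by a geometric one of ratio one
    half.\<close>
  define r where "r = min R (1 / (2 * L))"
  have r: "r > 0" "r \<le> R" "r * L \<le> 1 / 2" using R L(4) by (auto simp: r_def min_def field_simps)
  define v where "v z = (suminf (\<lambda>k. fst (rec (snd z) k) * (fst z - fst p) ^ k))" for z
  define w where "w z = (suminf (\<lambda>k. snd (rec (snd z) k) * (fst z - fst p) ^ k))" for z
  have rec_bound: "norm (fst (rec y k)) \<le> M * L ^ k" "norm (snd (rec y k)) \<le> M * L ^ k"
    if y: "y \<in> ball (snd p) R" for y k
    using lin_rec_bound[OF cf_bound[OF a(1) K(1) y] cf_bound[OF a(2) K(2) y] cf_bound[OF a(3) K(3) y]
        cf_bound[OF a(4) K(4) y] f(2)[OF y] g(2)[OF y] L(1-3) K0, of k]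
    unfolding rec_def by simp_all
  have M0: "0 \<le> M" using f(2)[of "snd p"] R(2) norm_ge_zero[of "f (snd p)"] by (metis centre_in_ball order_trans)
  have hol: "hol2 (\<lambda>z. suminf (\<lambda>k. c (snd z) k * (fst z - fst p) ^ k)) (bidisc p r)"
    if c: "\<And>k. (\<lambda>y. c y k) holomorphic_on ball (snd p) R"
      "\<And>y k. y \<in> ball (snd p) R \<Longrightarrow> norm (c y k) \<le> M * L ^ k" for c
  proof (rule hol2_uniform_limit(1)[of "\<lambda>n z. \<Sum>k<n. c (snd z) k * (fst z - fst p) ^ k" _ sequentially])
    show "hol2 (\<lambda>z. \<Sum>k<n. c (snd z) k * (fst z - fst p) ^ k) (bidisc p r)" for n
    proof (intro hol2_sum hol2_mult hol2_power hol2_diff hol2_fst hol2_const open_bidisc)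
      show "hol2 (\<lambda>z. c (snd z) k) (bidisc p r)" for k
        by (rule hol2_of_snd[OF c(1) _ open_bidisc]) (use r in \<open>auto simp: bidisc_def\<close>)
    qed
    have ul: "uniform_limit (bidisc p r) (\<lambda>n z. \<Sum>k<n. c (snd z) k * (fst z - fst p) ^ k)
       (\<lambda>z. suminf (\<lambda>k. c (snd z) k * (fst z - fst p) ^ k)) sequentially"
    proof (rule Weierstrass_m_test)
      show "summable (\<lambda>k. M * (1 / 2) ^ k :: real)" by (intro summable_mult summable_geometric) simp
      fix k z assume z: "z \<in> bidisc p r"
      then have zb: "snd z \<in> ball (snd p) R" "norm (fst z - fst p) \<le> r"
        using r by (auto simp: bidisc_def dist_norm norm_minus_commute)
      have "norm (c (snd z) k * (fst z - fst p) ^ k) \<le> (M * L ^ k) * r ^ k"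
        unfolding norm_mult norm_power using c(2)[OF zb(1)] zb(2) M0 L(4)
        by (intro mult_mono power_mono) auto
      also have "\<dots> = M * (r * L) ^ k" by (simp add: power_mult_distrib mult_ac)
      also have "\<dots> \<le> M * (1 / 2) ^ k"
        using r L(4) M0 by (intro mult_left_mono power_mono) auto
      finally show "norm (c (snd z) k * (fst z - fst p) ^ k) \<le> M * (1 / 2) ^ k" .
    qed
    show "\<exists>s>0. cbidisc q s \<subseteq> bidisc p r \<and> uniform_limit (cbidisc q s)
        (\<lambda>n z. \<Sum>k<n. c (snd z) k * (fst z - fst p) ^ k)
        (\<lambda>z. suminf (\<lambda>k. c (snd z) k * (fst z - fst p) ^ k)) sequentially" if q: "q \<in> bidisc p r" for q
    proof -
      obtain s where "s > 0" "cbidisc q s \<subseteq> bidisc p r" using cbidisc_in_open[OF open_bidisc q] .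
      then show ?thesis using uniform_limit_on_subset[OF ul] by (intro exI[of _ s] conjI)
    qed
  qed simp
  have eqs: "pd1 v (x, y) = a11 (x, y) * v (x, y) + a12 (x, y) * w (x, y) \<and>
      pd1 w (x, y) = a21 (x, y) * v (x, y) + a22 (x, y) * w (x, y)" if "(x, y) \<in> bidisc p r" for x y
  proof -
    have y: "y \<in> ball (snd p) R" and x: "x \<in> ball (fst p) R" and xr: "norm (x - fst p) < r"
      using that r by (auto simp: bidisc_def dist_norm norm_minus_commute)
    have t: "norm (x - fst p) * L < 1"
      using mult_strict_right_mono[OF xr L(4)] r(3) by linarith
    note series = lin_rec_series[OF cf_bound[OF a(1) K(1) y] cf_bound[OF a(2) K(2) y] cf_bound[OF a(3) K(3) y]
        cf_bound[OF a(4) K(4) y] f(2)[OF y] g(2)[OF y] L K0 t, folded rec_def]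
    note sums = cf_sums[OF a(1) K(1) y x] cf_sums[OF a(2) K(2) y x] cf_sums[OF a(3) K(3) y x] cf_sums[OF a(4) K(4) y x]
    have shift: "((\<lambda>x. F (x - fst p)) has_field_derivative d) (at x)"
      if "(F has_field_derivative d) (at (x - fst p))" for F d
      using that DERIV_shift[of F d x "- fst p"] by simp
    show ?thesis
      using shift[OF series(1)] shift[OF series(2)]
      by (intro conjI pd1_eqI) (simp_all add: v_def w_def sums)
  qed
  show ?thesis
  proof (rule that[OF r(1,2)])
    show "hol2 v (bidisc p r)" unfolding v_def[abs_def] by (rule hol) (use rec_hol rec_bound in auto)
    show "hol2 w (bidisc p r)" unfolding w_def[abs_def] by (rule hol) (use rec_hol rec_bound in auto)
    have "(suminf (\<lambda>k. c k * 0 ^ k)) = c 0" for c :: "nat \<Rightarrow> complex" using powser_zero[of c] by simp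
    then show "\<forall>y\<in>ball (snd p) r. v (fst p, y) = f y" "\<forall>y\<in>ball (snd p) r. w (fst p, y) = g y"
      by (auto simp: v_def w_def rec_def)
  qed (use eqs in auto)
qed

text \<open>Let \<open>M\<close> be the maximum of \<open>norm (E x) + norm (F x)\<close> on the
  closed disc through the given point. Integrating the equations from the centre gives
  \<open>M \<le> 2 * s * K * M\<close> with \<open>2 * s * K < 1\<close>, hence
  \<open>M = 0\<close>.\<close>

lemma linear_ode_unique:
  fixes E F :: "complex \<Rightarrow> complex"
  assumes E: "\<And>x. x \<in> ball c r \<Longrightarrow> (E has_field_derivative a11 x * E x + a12 x * F x) (at x)"
    and F: "\<And>x. x \<in> ball c r \<Longrightarrow> (F has_field_derivative a21 x * E x + a22 x * F x) (at x)"
    and K: "\<And>x. x \<in> ball c r \<Longrightarrow> norm (a11 x) \<le> K" "\<And>x. x \<in> ball c r \<Longrightarrow> norm (a12 x) \<le> K"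
      "\<And>x. x \<in> ball c r \<Longrightarrow> norm (a21 x) \<le> K" "\<And>x. x \<in> ball c r \<Longrightarrow> norm (a22 x) \<le> K"
    and r: "2 * r * K \<le> 1" and init: "E c = 0" "F c = 0" and x: "x \<in> ball c r" and Kpos: "K > 0"
  shows "E x = 0 \<and> F x = 0"
proof -
  define s where "s = dist c x"
  have s: "s < r" "0 \<le> s" using x by (auto simp: s_def)
  have sub: "cball c s \<subseteq> ball c r" using s by auto
  have cont: "continuous_on (cball c s) (\<lambda>x. norm (E x) + norm (F x))"
  proof (intro continuous_intros)
    show "continuous_on (cball c s) E" "continuous_on (cball c s) F"
      using E F sub by (meson DERIV_continuous continuous_at_imp_continuous_on subsetD)+
  qed
  obtain z where z: "z \<in> cball c s" "\<And>y. y \<in> cball c s \<Longrightarrow> norm (E y) + norm (F y) \<le> norm (E z) + norm (F z)"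
    using continuous_attains_sup[OF _ _ cont] s(2) by force
  define M where "M = norm (E z) + norm (F z)"
  have M: "norm (E y) + norm (F y) \<le> M" if "y \<in> cball c s" for y using z(2)[OF that] by (simp add: M_def)
  have dbound: "norm (p * E y + q * F y) \<le> K * M" if "norm p \<le> K" "norm q \<le> K" "y \<in> cball c s" for p q y
  proof -
    have "norm (p * E y + q * F y) \<le> K * norm (E y) + K * norm (F y)"
      using norm_triangle_ineq[of "p * E y" "q * F y"] mult_right_mono[OF that(1), of "norm (E y)"]
        mult_right_mono[OF that(2), of "norm (F y)"] by (simp add: norm_mult)
    also have "\<dots> = K * (norm (E y) + norm (F y))" by (simp add: algebra_simps)
    also have "\<dots> \<le> K * M" using M[OF that(3)] Kpos by (intro mult_left_mono) auto
    finally show ?thesis .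
  qed
  have c: "c \<in> cball c s" using s by simp
  have "norm (E z - E c) \<le> K * M * norm (z - c)"
  proof (rule field_differentiable_bound[OF convex_cball _ _ z(1) c, where f' = "\<lambda>x. a11 x * E x + a12 x * F x"])
    fix y assume y: "y \<in> cball c s"
    then have yr: "y \<in> ball c r" using sub by blast
    show "(E has_field_derivative a11 y * E y + a12 y * F y) (at y within cball c s)"
      by (rule has_field_derivative_at_within[OF E[OF yr]])
    show "norm (a11 y * E y + a12 y * F y) \<le> K * M"
      by (rule dbound[OF K(1)[OF yr] K(2)[OF yr] y])
  qed
  moreover have "norm (F z - F c) \<le> K * M * norm (z - c)"
  proof (rule field_differentiable_bound[OF convex_cball _ _ z(1) c, where f' = "\<lambda>x. a21 x * E x + a22 x * F x"])
    fix y assume y: "y \<in> cball c s"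
    then have yr: "y \<in> ball c r" using sub by blast
    show "(F has_field_derivative a21 y * E y + a22 y * F y) (at y within cball c s)"
      by (rule has_field_derivative_at_within[OF F[OF yr]])
    show "norm (a21 y * E y + a22 y * F y) \<le> K * M"
      by (rule dbound[OF K(3)[OF yr] K(4)[OF yr] y])
  qed
  moreover have M0: "0 \<le> M" by (simp add: M_def)
  moreover have "K * M * norm (z - c) \<le> K * M * s"
    using z(1) Kpos M0 by (intro mult_left_mono) (auto simp: dist_norm norm_minus_commute)
  ultimately have "M \<le> 2 * (K * M * s)" using init by (simp add: M_def)
  then have "(1 - 2 * s * K) * M \<le> 0" by (simp add: algebra_simps)
  moreover have "2 * s * K < 1"
    using mult_strict_right_mono[OF s(1) Kpos] r by simp
  ultimately have "M \<le> 0" by (simp add: mult_le_0_iff)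
  then have "norm (E x) + norm (F x) \<le> 0" using M[of x] by (simp add: s_def)
  then have "norm (E x) = 0" "norm (F x) = 0" using norm_ge_zero[of "E x"] norm_ge_zero[of "F x"] by linarith+
  then show ?thesis by simp
qed

text \<open>A coefficient restricted to a line where the first coordinate is fixed is turned into a
  function of the first coordinate with an idle second one, so that the equation along
  \<open>x\<^sub>2\<close> becomes an instance of the one with a parameter.\<close>

lemma hol2_slice_swap:
  assumes u: "hol2 u S"
  shows "hol2 (\<lambda>z. u (c, fst z)) {z. (c, fst z) \<in> S}"
proof (rule hol2I)
  have "{z :: complex \<times> complex. (c, fst z) \<in> S} = (\<lambda>z. (c, fst z)) -` S" by auto
  moreover have "open ((\<lambda>z :: complex \<times> complex. (c, fst z)) -` S)" using hol2_open[OF u]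
    by (intro open_vimage) (auto intro!: continuous_intros)
  ultimately show "open {z :: complex \<times> complex. (c, fst z) \<in> S}" by simp
  show "continuous_on {z. (c, fst z) \<in> S} (\<lambda>z :: complex \<times> complex. u (c, fst z))"
    by (rule continuous_on_compose2[OF hol2_continuous[OF u]]) (auto intro!: continuous_intros)
  show "\<exists>d. ((\<lambda>w. u (c, fst (w, b))) has_field_derivative d) (at a)"
    if "(a, b) \<in> {z. (c, fst z) \<in> S}" for a b
    using hol2_has_derivative2[OF u, of c a] that by auto
qed (auto intro: exI[of _ 0])

text \<open>
  The system is solved first along \<open>x\<^sub>1 = fst p\<close> and then in the direction of \<open>x\<^sub>1\<close>, with \<open>x\<^sub>2\<close> as a parameter. By the
  integrability conditions the defect \<open>(E, F)\<close> in the \<open>x\<^sub>2\<close>-equations solves a homogeneous linear equation in \<open>x\<^sub>1\<close>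
  with initial value zero, hence vanishes.
\<close>

theorem linear_pfaffian_system:
  assumes a: "hol2 a11 S" "hol2 a12 S" "hol2 a21 S" "hol2 a22 S"
    and b: "hol2 b11 S" "hol2 b12 S" "hol2 b21 S" "hol2 b22 S"
    and p: "p \<in> S"
    and int: "\<And>z. z \<in> S \<Longrightarrow> pd2 a11 z - pd1 b11 z + a12 z * b21 z - b12 z * a21 z = 0"
      "\<And>z. z \<in> S \<Longrightarrow> pd2 a12 z - pd1 b12 z + a11 z * b12 z + a12 z * b22 z - b11 z * a12 z - b12 z * a22 z = 0"
      "\<And>z. z \<in> S \<Longrightarrow> pd2 a21 z - pd1 b21 z + a21 z * b11 z + a22 z * b21 z - b21 z * a11 z - b22 z * a21 z = 0"
      "\<And>z. z \<in> S \<Longrightarrow> pd2 a22 z - pd1 b22 z + a21 z * b12 z - b21 z * a12 z = 0"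
  obtains r v w where "r > 0" "bidisc p r \<subseteq> S" "hol2 v (bidisc p r)" "hol2 w (bidisc p r)"
    "\<forall>z\<in>bidisc p r. pd1 v z = a11 z * v z + a12 z * w z \<and> pd1 w z = a21 z * v z + a22 z * w z"
    "\<forall>z\<in>bidisc p r. pd2 v z = b11 z * v z + b12 z * w z \<and> pd2 w z = b21 z * v z + b22 z * w z"
    "v p = c" "w p = d"
proof -
  obtain R where R: "R > 0" "cbidisc p R \<subseteq> S" using cbidisc_in_open[OF hol2_open[OF a(1)] p] .
  \<comment> \<open>The base point of the equation along \<open>x\<^sub>2\<close>; the second entry
    belongs to the idle parameter.\<close>
  define q where "q = (snd p, 0 :: complex)"
  have qS: "cbidisc q R \<subseteq> {z. (fst p, fst z) \<in> S}"
    using R by (auto simp: cbidisc_def q_def)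
  obtain s V W where s: "s > 0" "s \<le> R" and VW: "hol2 V (bidisc q s)" "hol2 W (bidisc q s)"
    and Veq: "\<forall>z\<in>bidisc q s. pd1 V z = b11 (fst p, fst z) * V z + b12 (fst p, fst z) * W z"
      "\<forall>z\<in>bidisc q s. pd1 W z = b21 (fst p, fst z) * V z + b22 (fst p, fst z) * W z"
    and init: "\<forall>y\<in>ball (snd q) s. V (fst q, y) = c" "\<forall>y\<in>ball (snd q) s. W (fst q, y) = d"
    using linear_ode_with_parameter[OF b[THEN hol2_slice_swap] qS R(1), of "\<lambda>_. c" "max (norm c) (norm d)" "\<lambda>_. d"]
    by (auto intro: holomorphic_on_const)
  define f where "f y = V (y, 0)" for y
  define g where "g y = W (y, 0)" for y
  \<comment> \<open>On the closed disc of half the radius the initial functions are bounded, as the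
    parameter version requires.\<close>
  define t where "t = s / 2"
  have t: "t > 0" "t < s" "t \<le> R" using s by (auto simp: t_def)
  have inq: "(y, 0) \<in> bidisc q s" if "y \<in> ball (snd p) s" for y
    using that s by (auto simp: bidisc_def q_def)
  have fd: "(f has_field_derivative b11 (fst p, y) * f y + b12 (fst p, y) * g y) (at y)"
    "(g has_field_derivative b21 (fst p, y) * f y + b22 (fst p, y) * g y) (at y)"
    if "y \<in> ball (snd p) s" for y
    using hol2_has_derivative1[OF VW(1) inq[OF that]] hol2_has_derivative1[OF VW(2) inq[OF that]]
      Veq inq[OF that] by (auto simp: f_def[abs_def] g_def[abs_def])
  have fhol: "f holomorphic_on ball (snd p) s" "g holomorphic_on ball (snd p) s"
    unfolding holomorphic_on_open[OF open_ball] using fd by blast+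
  have fp: "f (snd p) = c" "g (snd p) = d"
    using init s by (auto simp: f_def g_def q_def)
  have sub: "cball (snd p) t \<subseteq> ball (snd p) s" using t by auto
  have "continuous_on (cball (snd p) t) f" "continuous_on (cball (snd p) t) g"
    using fhol sub by (meson continuous_on_subset holomorphic_on_imp_continuous_on)+
  then have "bounded (f ` cball (snd p) t)" "bounded (g ` cball (snd p) t)"
    by (auto intro!: compact_imp_bounded compact_continuous_image)
  then obtain M1 M2 where "\<forall>y\<in>cball (snd p) t. norm (f y) \<le> M1" "\<forall>y\<in>cball (snd p) t. norm (g y) \<le> M2"
    unfolding bounded_iff by auto
  then have M: "norm (f y) \<le> max M1 M2" "norm (g y) \<le> max M1 M2" if "y \<in> ball (snd p) t" for y
    using that by (force simp: le_max_iff_disj)+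
  have tS: "cbidisc p t \<subseteq> S" using R t by (auto simp: cbidisc_def)
  have fhol': "f holomorphic_on ball (snd p) t" "g holomorphic_on ball (snd p) t"
    using fhol t by (auto elim!: holomorphic_on_subset)
  obtain r v w where r: "r > 0" "r \<le> t" and vw: "hol2 v (bidisc p r)" "hol2 w (bidisc p r)"
    and eq1: "\<forall>z\<in>bidisc p r. pd1 v z = a11 z * v z + a12 z * w z"
      "\<forall>z\<in>bidisc p r. pd1 w z = a21 z * v z + a22 z * w z"
    and vinit: "\<forall>y\<in>ball (snd p) r. v (fst p, y) = f y" "\<forall>y\<in>ball (snd p) r. w (fst p, y) = g y"
    by (rule linear_ode_with_parameter[OF a tS t(1) fhol'(1) M(1) fhol'(2) M(2)]) blast+
  obtain K1 where K1: "\<And>z. z \<in> cbidisc p R \<Longrightarrow> norm (a11 z) \<le> K1" using hol2_bounded[OF a(1) R(2)] by blast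
  obtain K2 where K2: "\<And>z. z \<in> cbidisc p R \<Longrightarrow> norm (a12 z) \<le> K2" using hol2_bounded[OF a(2) R(2)] by blast
  obtain K3 where K3: "\<And>z. z \<in> cbidisc p R \<Longrightarrow> norm (a21 z) \<le> K3" using hol2_bounded[OF a(3) R(2)] by blast
  obtain K4 where K4: "\<And>z. z \<in> cbidisc p R \<Longrightarrow> norm (a22 z) \<le> K4" using hol2_bounded[OF a(4) R(2)] by blast
  define K where "K = max 1 (max (max K1 K2) (max K3 K4))"
  have K0: "0 < K" by (simp add: K_def)
  have K: "norm (a11 z) \<le> K" "norm (a12 z) \<le> K" "norm (a21 z) \<le> K" "norm (a22 z) \<le> K"
    if "z \<in> cbidisc p R" for z
    using K1[OF that] K2[OF that] K3[OF that] K4[OF that] by (auto simp: K_def)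
  \<comment> \<open>Small enough for uniqueness of the solution of the linear equation for the
    defect.\<close>
  define \<rho> where "\<rho> = min r (1 / (2 * K))"
  have \<rho>: "\<rho> > 0" "\<rho> \<le> r" "2 * \<rho> * K \<le> 1"
    using r K0 by (auto simp: \<rho>_def min_def field_simps)
  have sub_r: "bidisc p \<rho> \<subseteq> bidisc p r" by (rule bidisc_mono[OF \<rho>(2)])
  have sub_S: "bidisc p r \<subseteq> S" using R t r by (auto simp: cbidisc_def bidisc_def)
  define E where "E z = pd2 v z - (b11 z * v z + b12 z * w z)" for z
  define F where "F z = pd2 w z - (b21 z * v z + b22 z * w z)" for z
  let ?B = "bidisc p r"
  note bB = b[THEN hol2_subset[OF _ sub_S open_bidisc]] and aB = a[THEN hol2_subset[OF _ sub_S open_bidisc]]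
  have E: "E z = 0 \<and> F z = 0" if z: "z \<in> bidisc p \<rho>" for z
  proof -
    have Edef: "pd2 v z = E z + (b11 z * v z + b12 z * w z)" "pd2 w z = F z + (b21 z * v z + b22 z * w z)" for z
      by (simp_all add: E_def F_def)
    have pd_E: "pd1 E z = a11 z * E z + a12 z * F z" "pd1 F z = a21 z * E z + a22 z * F z"
      if z: "z \<in> ?B" for z
    proof -
      have zS: "z \<in> S" using z sub_S by blast
      have e1: "pd1 (pd2 v) z = pd2 (\<lambda>z. a11 z * v z + a12 z * w z) z"
        unfolding pd_commute[OF vw(1) z, symmetric]
        by (rule pd_cong(2)[OF open_bidisc _ z]) (use eq1 in blast)
      have e2: "pd1 (pd2 w) z = pd2 (\<lambda>z. a21 z * v z + a22 z * w z) z"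
        unfolding pd_commute[OF vw(2) z, symmetric]
        by (rule pd_cong(2)[OF open_bidisc _ z]) (use eq1 in blast)
      have neg: "pd1 (\<lambda>z. x z - y z) z = pd1 x z - pd1 y z" if "hol2 x ?B" "hol2 y ?B" for x y
        using pd_add(1)[OF that(1) hol2_minus[OF that(2)] z] pd_mult(1)[OF hol2_const[OF open_bidisc, of "-1"] that(2) z]
        by (simp add: pd_const)
      have "pd1 E z = pd1 (pd2 v) z - pd1 (\<lambda>z. b11 z * v z + b12 z * w z) z"
        unfolding E_def[abs_def] by (intro neg hol2_pd2 hol2_add hol2_mult vw bB)
      also have "pd1 (pd2 v) z = pd2 a11 z * v z + a11 z * pd2 v z + (pd2 a12 z * w z + a12 z * pd2 w z)"
        unfolding e1 by (simp add: pd_add(2)[OF hol2_mult[OF aB(1) vw(1)] hol2_mult[OF aB(2) vw(2)] z]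
            pd_mult(2)[OF aB(1) vw(1) z] pd_mult(2)[OF aB(2) vw(2) z])
      also have "pd1 (\<lambda>z. b11 z * v z + b12 z * w z) z =
          pd1 b11 z * v z + b11 z * pd1 v z + (pd1 b12 z * w z + b12 z * pd1 w z)"
        by (simp add: pd_add(1)[OF hol2_mult[OF bB(1) vw(1)] hol2_mult[OF bB(2) vw(2)] z]
            pd_mult(1)[OF bB(1) vw(1) z] pd_mult(1)[OF bB(2) vw(2) z])
      \<comment> \<open>Sorted by \<open>E\<close>, \<open>F\<close>, \<open>v\<close> and
        \<open>w\<close>, the factors of \<open>v\<close> and \<open>w\<close> are exactly the
        left-hand sides of the first two integrability conditions.\<close>
      finally have "pd1 E z = a11 z * E z + a12 z * F z +
        v z * (pd2 a11 z - pd1 b11 z + a12 z * b21 z - b12 z * a21 z) +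
        w z * (pd2 a12 z - pd1 b12 z + a11 z * b12 z + a12 z * b22 z - b11 z * a12 z - b12 z * a22 z)"
        unfolding Edef using eq1 z by (simp add: algebra_simps)
      then show "pd1 E z = a11 z * E z + a12 z * F z" using int(1,2)[OF zS] by simp
      have "pd1 F z = pd1 (pd2 w) z - pd1 (\<lambda>z. b21 z * v z + b22 z * w z) z"
        unfolding F_def[abs_def] by (intro neg hol2_pd2 hol2_add hol2_mult vw bB)
      also have "pd1 (pd2 w) z = pd2 a21 z * v z + a21 z * pd2 v z + (pd2 a22 z * w z + a22 z * pd2 w z)"
        unfolding e2 by (simp add: pd_add(2)[OF hol2_mult[OF aB(3) vw(1)] hol2_mult[OF aB(4) vw(2)] z]
            pd_mult(2)[OF aB(3) vw(1) z] pd_mult(2)[OF aB(4) vw(2) z])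
      also have "pd1 (\<lambda>z. b21 z * v z + b22 z * w z) z =
          pd1 b21 z * v z + b21 z * pd1 v z + (pd1 b22 z * w z + b22 z * pd1 w z)"
        by (simp add: pd_add(1)[OF hol2_mult[OF bB(3) vw(1)] hol2_mult[OF bB(4) vw(2)] z]
            pd_mult(1)[OF bB(3) vw(1) z] pd_mult(1)[OF bB(4) vw(2) z])
      finally have "pd1 F z = a21 z * E z + a22 z * F z +
        v z * (pd2 a21 z - pd1 b21 z + a21 z * b11 z + a22 z * b21 z - b21 z * a11 z - b22 z * a21 z) +
        w z * (pd2 a22 z - pd1 b22 z + a21 z * b12 z - b21 z * a12 z)"
        unfolding Edef using eq1 z by (simp add: algebra_simps)
      then show "pd1 F z = a21 z * E z + a22 z * F z" using int(3,4)[OF zS] by simp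
    qed
    have hE: "hol2 E ?B" "hol2 F ?B"
      unfolding E_def[abs_def] F_def[abs_def] by (intro hol2_diff hol2_pd2 hol2_add hol2_mult vw bB)+
    obtain x y where xy: "z = (x, y)" by (cases z)
    have y: "y \<in> ball (snd p) \<rho>" and x: "x \<in> ball (fst p) \<rho>" using z by (auto simp: xy bidisc_def)
    have inB: "(x, y) \<in> ?B" if "x \<in> ball (fst p) \<rho>" for x using that y \<rho> by (auto simp: bidisc_def)
    have inC: "(x, y) \<in> cbidisc p R" if "x \<in> ball (fst p) \<rho>" for x
      using that y \<rho> r t by (auto simp: cbidisc_def)
    have y_r: "y \<in> ball (snd p) r" and y_s: "y \<in> ball (snd p) s" using y \<rho> r t by auto
    have pB: "(fst p, y) \<in> ?B" using inB \<rho> by auto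
    have near: "eventually (\<lambda>w. w \<in> ball (snd p) r) (nhds y)"
      using y_r by (intro eventually_nhds_in_open) auto
    have "pd2 v (fst p, y) = b11 (fst p, y) * f y + b12 (fst p, y) * g y"
      using fd(1)[OF y_s] near vinit
      by (intro pd2_eqI) (auto elim!: has_field_derivative_transform_within_open[where S = "ball (snd p) r"] simp: y_r[simplified])
    moreover have "pd2 w (fst p, y) = b21 (fst p, y) * f y + b22 (fst p, y) * g y"
      using fd(2)[OF y_s] near vinit
      by (intro pd2_eqI) (auto elim!: has_field_derivative_transform_within_open[where S = "ball (snd p) r"] simp: y_r[simplified])
    ultimately have E0: "E (fst p, y) = 0" "F (fst p, y) = 0"
      using vinit y_r by (auto simp: E_def F_def)
    have "E (x, y) = 0 \<and> F (x, y) = 0"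
      by (rule linear_ode_unique[where c = "fst p" and r = \<rho> and K = K and E = "\<lambda>x. E (x, y)" and F = "\<lambda>x. F (x, y)"
            and ?a11.0 = "\<lambda>x. a11 (x, y)" and ?a12.0 = "\<lambda>x. a12 (x, y)" and ?a21.0 = "\<lambda>x. a21 (x, y)" and ?a22.0 = "\<lambda>x. a22 (x, y)"])
        (use hol2_has_derivative1[OF hE(1) inB] hol2_has_derivative1[OF hE(2) inB] pd_E inB K inC \<rho> E0 x K0 in auto)
    then show ?thesis by (simp add: xy)
  qed
  show ?thesis
  proof (rule that[OF \<rho>(1)])
    show "bidisc p \<rho> \<subseteq> S" using sub_r sub_S by blast
    show "hol2 v (bidisc p \<rho>)" "hol2 w (bidisc p \<rho>)"
      using vw sub_r open_bidisc hol2_subset by blast+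
    show "\<forall>z\<in>bidisc p \<rho>. pd1 v z = a11 z * v z + a12 z * w z \<and> pd1 w z = a21 z * v z + a22 z * w z"
      using eq1 sub_r by blast
    show "\<forall>z\<in>bidisc p \<rho>. pd2 v z = b11 z * v z + b12 z * w z \<and> pd2 w z = b21 z * v z + b22 z * w z"
      using E by (auto simp: E_def F_def)
    show "v p = c" "w p = d" using vinit fp r by (metis centre_in_ball prod.collapse)+
  qed
qed

section \<open>Expansions and reduction\<close>

subsection \<open>The differential field\<close>

lemma is_derivation_rat: "is_derivation rat_d1" "is_derivation rat_d2"
  by (simp_all add: is_derivation_def rat_d1_add rat_d1_mult rat_d2_add rat_d2_mult)

lemma bipoly_d_commute: "bipoly_d2 (bipoly_d1 p) = bipoly_d1 (bipoly_d2 p)"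
proof (rule poly_eqI)
  fix n
  have "pderiv (of_nat k * q) = of_nat k * pderiv q" for k and q :: "complex poly"
    by (simp add: pderiv_mult)
  then show "coeff (bipoly_d2 (bipoly_d1 p)) n = coeff (bipoly_d1 (bipoly_d2 p)) n"
    by (simp add: coeff_bipoly_d1 bipoly_d2_def coeff_pderiv del: of_nat_Suc)
qed

lemma rat_d_of_bipoly: "rat_d1 (Fract p 1) = Fract (bipoly_d1 p) 1" "rat_d2 (Fract p 1) = Fract (bipoly_d2 p) 1"
  using rat_d1_Fract[of 1 p] rat_d2_Fract[of 1 p]
  by (simp_all add: bipoly_d1_def bipoly_d2_def map_poly_1)

text \<open>For \<open>c = P / Q\<close> both compositions agree on the polynomials
  \<open>P = c * Q\<close> and \<open>Q\<close>. In the product rule the mixed terms are symmetric,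
  so what remains is the claim multiplied by \<open>Q\<close>.\<close>

lemma rat_d_commute: "rat_d2 (rat_d1 c) = rat_d1 (rat_d2 c)"
proof -
  obtain p q where c: "c = Fract p q" "q \<noteq> 0" by (cases c) auto
  define P Q where "P = Fract p 1" and "Q = Fract q 1"
  have Q0: "Q \<noteq> 0" using c(2) by (simp add: Q_def Zero_fract_def eq_fract)
  have cQ: "P = c * Q" using c by (simp add: P_def Q_def mult_fract eq_fract)
  have comm: "rat_d2 (rat_d1 P) = rat_d1 (rat_d2 P)" "rat_d2 (rat_d1 Q) = rat_d1 (rat_d2 Q)"
    by (simp_all add: P_def Q_def rat_d_of_bipoly bipoly_d_commute)
  have "rat_d2 (rat_d1 (c * Q)) = rat_d1 (rat_d2 (c * Q))" using comm(1) cQ by simp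
  then have "rat_d2 (rat_d1 c) * Q = rat_d1 (rat_d2 c) * Q"
    by (simp add: rat_d1_add rat_d1_mult rat_d2_add rat_d2_mult comm(2) algebra_simps)
  then show ?thesis using Q0 by simp
qed

definition vf_slope :: "bipoly \<Rightarrow> bipoly \<Rightarrow> ratfun" where
  "vf_slope X1 X2 = Fract X2 X1"

definition vf_rat :: "ratfun \<Rightarrow> ratfun \<Rightarrow> ratfun" where
  "vf_rat g c = rat_d1 c + g * rat_d2 c"

lemma is_derivation_vf_rat: "is_derivation (vf_rat g)"
  by (simp add: is_derivation_def vf_rat_def rat_d1_add rat_d1_mult rat_d2_add rat_d2_mult algebra_simps)

lemma vf_rat_commute: "vf_rat g (rat_d2 c) = rat_d2 (vf_rat g c) - rat_d2 g * rat_d2 c"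
  by (simp add: vf_rat_def rat_d2_add rat_d2_mult rat_d_commute)

subsection \<open>Differential polynomials and their ideals\<close>

lemma is_derivation_dpoly: "is_derivation dpoly_d1" "is_derivation dpoly_d2"
  by (simp_all add: is_derivation_def dpoly_d1_derivation dpoly_d2_derivation)

lemma dconst_add: "dconst (a + b) = dconst a + dconst b"
  and dconst_mult: "dconst (a * b) = dconst a * dconst b"
  and dconst_1: "dconst 1 = 1" and dconst_0: "dconst 0 = 0"
  by (simp_all add: dconst_def single_add mult_single)

lemma dconst_minus: "dconst (- a) = - dconst a"
  using dconst_add[of a "- a"] by (simp add: dconst_0 eq_neg_iff_add_eq_0 add.commute)

lemma dpoly_d_commute: "dpoly_d2 (dpoly_d1 A) = dpoly_d1 (dpoly_d2 A)"
proof (induction A rule: dpoly_induct[OF subset_UNIV])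
  case (2 \<theta>)
  then show ?case by (cases \<theta> rule: prod.exhaust) (simp add: dpoly_d1_derivation dpoly_d2_derivation)
qed (simp_all add: dpoly_d1_derivation dpoly_d2_derivation rat_d_commute algebra_simps)

definition vf_op :: "ratfun \<Rightarrow> dpoly \<Rightarrow> dpoly" where
  "vf_op g A = dpoly_d1 A + dconst g * dpoly_d2 A"

lemma is_derivation_vf_op: "is_derivation (vf_op g)"
  by (simp add: is_derivation_def vf_op_def dpoly_d1_derivation dpoly_d2_derivation algebra_simps)

lemma vf_op_commute: "vf_op g (dpoly_d2 A) = dpoly_d2 (vf_op g A) - dconst (rat_d2 g) * dpoly_d2 A"
  by (simp add: vf_op_def dpoly_d1_derivation dpoly_d2_derivation dpoly_d_commute)

lemma vf_op_dconst: "vf_op g (dconst c) = dconst (vf_rat g c)"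
  by (simp add: vf_op_def vf_rat_def dpoly_d1_derivation dpoly_d2_derivation dconst_add dconst_mult)

lemma
  assumes I: "differential_ideal I"
  shows dideal_0: "0 \<in> I" and dideal_add: "A \<in> I \<Longrightarrow> B \<in> I \<Longrightarrow> A + B \<in> I"
    and dideal_mult: "A \<in> I \<Longrightarrow> C * A \<in> I" and dideal_mult': "A \<in> I \<Longrightarrow> A * C \<in> I"
    and dideal_d1: "A \<in> I \<Longrightarrow> dpoly_d1 A \<in> I" and dideal_d2: "A \<in> I \<Longrightarrow> dpoly_d2 A \<in> I"
  using I mult.commute[of A C] unfolding differential_ideal_def by metis+

lemma dideal_minus: "differential_ideal I \<Longrightarrow> A \<in> I \<Longrightarrow> - A \<in> I"
  using dideal_mult[of I A "- 1"] by simp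

lemma dideal_diff: "differential_ideal I \<Longrightarrow> A \<in> I \<Longrightarrow> B \<in> I \<Longrightarrow> A - B \<in> I"
  using dideal_add[of I A "- B"] dideal_minus by simp

lemma dideal_vf_op: "differential_ideal I \<Longrightarrow> A \<in> I \<Longrightarrow> vf_op g A \<in> I"
  unfolding vf_op_def by (intro dideal_add dideal_d1 dideal_mult dideal_d2)

lemma differential_ideal_gen: "differential_ideal (diff_ideal_gen \<Sigma>)"
  unfolding diff_ideal_gen_def
  by (rule hull_in) (auto simp: differential_ideal_def)

lemma diff_ideal_gen_least: "\<Sigma> \<subseteq> I \<Longrightarrow> differential_ideal I \<Longrightarrow> diff_ideal_gen \<Sigma> \<subseteq> I"
  unfolding diff_ideal_gen_def by (rule hull_minimal)

lemma in_diff_ideal_gen: "A \<in> \<Sigma> \<Longrightarrow> A \<in> diff_ideal_gen \<Sigma>"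
  unfolding diff_ideal_gen_def by (rule subsetD[OF hull_subset])

lemma finite_occurring: "finite (occurring A)"
  by (simp add: occurring_def)

lemma occurring_add: "occurring (A + B) \<subseteq> occurring A \<union> occurring B"
  using Poly_Mapping.keys_add[of A B] by (auto simp: occurring_def)

lemma occurring_mult: "occurring (A * B) \<subseteq> occurring A \<union> occurring B"
proof
  fix \<theta> assume "\<theta> \<in> occurring (A * B)"
  then obtain m where m: "m \<in> Poly_Mapping.keys (A * B)" "\<theta> \<in> Poly_Mapping.keys m" by (auto simp: occurring_def)
  then obtain a b where "m = a + b" "a \<in> Poly_Mapping.keys A" "b \<in> Poly_Mapping.keys B"
    using keys_mult[of A B] by blast
  then show "\<theta> \<in> occurring A \<union> occurring B"
    using m(2) Poly_Mapping.keys_add[of a b] by (auto simp: occurring_def)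
qed

lemma occurring_dconst: "occurring (dconst c) = {}"
  by (simp add: occurring_def dconst_def)

lemma occurring_dvar: "occurring (dvar \<theta>) = {\<theta>}"
  by (simp add: occurring_def dvar_def)

lemma lookup_not_occurring: "\<theta> \<notin> occurring A \<Longrightarrow> Poly_Mapping.lookup m \<theta> \<noteq> 0 \<Longrightarrow> Poly_Mapping.lookup A m = 0"
  unfolding occurring_def by (metis UN_I in_keys_iff)

lemma occurring_minus: "occurring (- A) = occurring A"
  by (simp add: occurring_def keys_def)

lemma occurring_empty: "occurring A = {} \<Longrightarrow> \<exists>c. A = dconst c"
proof -
  assume "occurring A = {}"
  then have "m = 0" if "m \<in> Poly_Mapping.keys A" for m
    using that by (auto simp: occurring_def)
  then have "A = dconst (Poly_Mapping.lookup A 0)"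
    by (intro poly_mapping_eqI) (auto simp: dconst_def lookup_single when_def in_keys_iff)
  then show ?thesis by blast
qed

subsection \<open>Reduction modulo the operator\<close>

definition reduced :: "dpoly set" where
  "reduced = {A. occurring A \<subseteq> {0} \<times> UNIV}"

lemma reduced_add: "A \<in> reduced \<Longrightarrow> B \<in> reduced \<Longrightarrow> A + B \<in> reduced"
  and reduced_mult: "A \<in> reduced \<Longrightarrow> B \<in> reduced \<Longrightarrow> A * B \<in> reduced"
  and reduced_minus: "A \<in> reduced \<Longrightarrow> - A \<in> reduced"
  and reduced_dconst: "dconst c \<in> reduced" and reduced_dvar: "dvar (0, j) \<in> reduced"
  using occurring_add[of A B] occurring_mult[of A B]
  by (auto simp: reduced_def occurring_minus occurring_dconst occurring_dvar)

lemma reduced_induct [consumes 1, case_names const var add mult]: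
  assumes "A \<in> reduced" and "\<And>c. P (dconst c)" "\<And>j. P (dvar (0, j))"
    "\<And>A B. A \<in> reduced \<Longrightarrow> B \<in> reduced \<Longrightarrow> P A \<Longrightarrow> P B \<Longrightarrow> P (A + B)"
    "\<And>A B. A \<in> reduced \<Longrightarrow> B \<in> reduced \<Longrightarrow> P A \<Longrightarrow> P B \<Longrightarrow> P (A * B)"
  shows "P A"
proof -
  have "A \<in> reduced \<and> P A"
    using assms(1)[unfolded reduced_def mem_Collect_eq]
    by (induction A rule: dpoly_induct)
      (auto simp: assms reduced_dconst reduced_dvar reduced_add reduced_mult)
  then show ?thesis by blast
qed

lemma reduced_d2: "A \<in> reduced \<Longrightarrow> dpoly_d2 A \<in> reduced"
  by (induction A rule: reduced_induct)
    (simp_all add: dpoly_d2_derivation reduced_dconst reduced_dvar reduced_add reduced_mult)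

lemma vf_dpoly_monic:
  assumes "X1 \<noteq> 0" and I: "differential_ideal I" "vf_dpoly X1 X2 \<in> I"
  shows "dvar (1, 0) + dconst (vf_slope X1 X2) * dvar (0, 1) \<in> I"
proof -
  have "Fract 1 X1 * Fract X1 1 = 1" "Fract 1 X1 * Fract X2 1 = vf_slope X1 X2"
    using assms(1) by (simp_all add: vf_slope_def mult_fract One_fract_def eq_fract)
  then have "dconst (Fract 1 X1) * vf_dpoly X1 X2 = dconst 1 * dvar (1, 0) + dconst (vf_slope X1 X2) * dvar (0, 1)"
    unfolding vf_dpoly_def distrib_left mult.assoc[symmetric] dconst_mult[symmetric] by simp
  then show ?thesis using dideal_mult[OF I, of "dconst (Fract 1 X1)"] by (simp add: dconst_1)
qed

text \<open>Modulo the ideal, \<open>\<delta>\<^sub>1 y\<close> equals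
  \<open>- g \<delta>\<^sub>2 y\<close>. Applying \<open>\<delta>\<^sub>2\<close> repeatedly reduces
  every \<open>\<delta>\<^sub>1 \<delta>\<^sub>2\<^sup>j y\<close>, hence
  \<open>\<delta>\<^sub>1\<close> of any reduced polynomial, and induction on the number of
  \<open>\<delta>\<^sub>1\<close> reaches all derivatives.\<close>

lemma exists_reduced:
  assumes "X1 \<noteq> 0" and I: "differential_ideal I" "vf_dpoly X1 X2 \<in> I"
  shows "\<exists>B. B \<in> reduced \<and> A - B \<in> I"
proof -
  let ?Q = "\<lambda>A. \<exists>B. B \<in> reduced \<and> A - B \<in> I"
  have Q_red: "?Q A" if "A \<in> reduced" for A using that dideal_0[OF I(1)] by (intro exI[of _ A]) simp
  have Q_add: "?Q (A + A')" if QA: "?Q A" "?Q A'" for A A'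
  proof -
    obtain B B' where B: "B \<in> reduced" "A - B \<in> I" "B' \<in> reduced" "A' - B' \<in> I" using QA by blast
    then have "(A - B) + (A' - B') \<in> I" by (intro dideal_add[OF I(1)])
    also have "(A - B) + (A' - B') = (A + A') - (B + B')" by simp
    finally show ?thesis using reduced_add B by blast
  qed
  have Q_mult: "?Q (A * A')" if QA: "?Q A" "?Q A'" for A A'
  proof -
    obtain B B' where B: "B \<in> reduced" "A - B \<in> I" "B' \<in> reduced" "A' - B' \<in> I" using QA by blast
    then have "(A - B) * A' + B * (A' - B') \<in> I"
      by (intro dideal_add[OF I(1)] dideal_mult[OF I(1)] dideal_mult'[OF I(1)])
    also have "(A - B) * A' + B * (A' - B') = A * A' - B * B'" by (simp add: algebra_simps)
    finally show ?thesis using reduced_mult B by blast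
  qed
  define C where "C = - dconst (vf_slope X1 X2) * dvar (0, 1)"
  have "C \<in> reduced" unfolding C_def by (intro reduced_mult reduced_minus reduced_dconst reduced_dvar)
  have "dvar (1, 0) - C \<in> I"
    using vf_dpoly_monic[OF assms] by (simp add: C_def)
  have row1: "?Q (dvar (1, j))" for j
  proof -
    have "\<exists>B. B \<in> reduced \<and> dvar (1, j) - B \<in> I"
    proof (induction j)
      case 0
      then show ?case using \<open>C \<in> reduced\<close> \<open>dvar (1, 0) - C \<in> I\<close> by blast
    next
      case (Suc j)
      then obtain B where B: "B \<in> reduced" "dvar (1, j) - B \<in> I" by blast
      have "dpoly_d2 (dvar (1, j) - B) \<in> I" by (rule dideal_d2[OF I(1) B(2)])
      then show ?case using reduced_d2[OF B(1)]
        by (auto simp: derivation_diff[OF is_derivation_dpoly(2)] dpoly_d2_derivation)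
    qed
    then show ?thesis .
  qed
  have Q_d1_red: "?Q (dpoly_d1 A)" if "A \<in> reduced" for A
    using that
  proof (induction A rule: reduced_induct)
    case (const c)
    then show ?case unfolding dpoly_d1_derivation by (rule Q_red[OF reduced_dconst])
  next
    case (var j)
    then show ?case unfolding dpoly_d1_derivation using row1 by simp
  next
    case (add A B)
    then show ?case unfolding dpoly_d1_derivation by (intro Q_add)
  next
    case (mult A B)
    then show ?case unfolding dpoly_d1_derivation using Q_red by (intro Q_add Q_mult)
  qed
  have Q_var: "?Q (dvar (i, j))" for i j
  proof (induction i)
    case 0
    then show ?case by (rule Q_red[OF reduced_dvar])
  next
    case (Suc i)
    then obtain B where B: "B \<in> reduced" "dvar (i, j) - B \<in> I" by blast
    obtain B' where B': "B' \<in> reduced" "dpoly_d1 B - B' \<in> I" using Q_d1_red[OF B(1)] by blast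
    have "dpoly_d1 (dvar (i, j) - B) + (dpoly_d1 B - B') \<in> I"
      by (intro dideal_add[OF I(1)] dideal_d1[OF I(1)] B B')
    then have "dvar (Suc i, j) - B' \<in> I"
      by (simp add: derivation_diff[OF is_derivation_dpoly(1)] dpoly_d1_derivation)
    then show ?case using B' by blast
  qed
  show ?thesis
  proof (induction A rule: dpoly_induct[OF subset_UNIV])
    case (1 c)
    show ?case by (rule Q_red[OF reduced_dconst])
  next
    case (2 \<theta>)
    then show ?case using Q_var by (cases \<theta> rule: prod.exhaust) auto
  qed (intro Q_add Q_mult; assumption)+
qed

subsection \<open>Rank\<close>

lemma lower_deriv_linear: "lower_deriv \<theta> \<eta> \<or> \<theta> = \<eta> \<or> lower_deriv \<eta> \<theta>"
  and lower_deriv_trans: "lower_deriv \<theta> \<eta> \<Longrightarrow> lower_deriv \<eta> \<zeta> \<Longrightarrow> lower_deriv \<theta> \<zeta>"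
  and lower_deriv_asym: "lower_deriv \<theta> \<eta> \<Longrightarrow> \<not> lower_deriv \<eta> \<theta>"
  unfolding lower_deriv_def by (auto simp: prod_eq_iff)

lemma leader:
  assumes "occurring A \<noteq> {}"
  shows "leader A \<in> occurring A" "\<And>\<eta>. \<eta> \<in> occurring A \<Longrightarrow> \<eta> \<noteq> leader A \<Longrightarrow> lower_deriv \<eta> (leader A)"
proof -
  let ?P = "\<lambda>\<theta>. \<theta> \<in> occurring A \<and> (\<forall>\<eta>\<in>occurring A. \<eta> \<noteq> \<theta> \<longrightarrow> lower_deriv \<eta> \<theta>)"
  have "\<exists>\<theta>. \<theta> \<in> S \<and> (\<forall>\<eta>\<in>S. \<eta> \<noteq> \<theta> \<longrightarrow> lower_deriv \<eta> \<theta>)" if "finite S" "S \<noteq> {}" for S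
    using that
  proof (induction rule: finite_ne_induct)
    case (insert x F)
    then obtain \<theta> where "\<theta> \<in> F" "\<forall>\<eta>\<in>F. \<eta> \<noteq> \<theta> \<longrightarrow> lower_deriv \<eta> \<theta>" by blast
    then show ?case using lower_deriv_linear[of x \<theta>] lower_deriv_trans
      by (cases "lower_deriv x \<theta>") (blast intro: exI[of _ \<theta>], metis insert_iff)
  qed auto
  then have ex: "\<exists>\<theta>. ?P \<theta>" using finite_occurring assms by blast
  have unique: "\<theta> = \<theta>'" if "?P \<theta>" "?P \<theta>'" for \<theta> \<theta>'
    using that lower_deriv_asym by metis
  have "\<exists>!\<theta>. ?P \<theta>" by (rule ex_ex1I[OF ex unique])
  then have "?P (leader A)" unfolding leader_def by (rule theI')
  then show "leader A \<in> occurring A" "\<And>\<eta>. \<eta> \<in> occurring A \<Longrightarrow> \<eta> \<noteq> leader A \<Longrightarrow> lower_deriv \<eta> (leader A)"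
    by blast+
qed

lemma leader_eqI:
  assumes "\<theta> \<in> occurring A" "\<And>\<eta>. \<eta> \<in> occurring A \<Longrightarrow> \<eta> \<noteq> \<theta> \<Longrightarrow> lower_deriv \<eta> \<theta>"
  shows "leader A = \<theta>"
  using leader[of A] assms lower_deriv_asym by (metis empty_iff)

lemma dideal_constant_imp_UNIV:
  assumes "differential_ideal I" "A \<in> I" "A \<noteq> 0" "occurring A = {}"
  shows "I = UNIV"
proof -
  obtain c where c: "A = dconst c" using occurring_empty[OF assms(4)] by blast
  then have "c \<noteq> 0" using assms(3) by (auto simp: dconst_0)
  then have "dconst (inverse c) * A = 1"
    unfolding c by (simp add: dconst_1 flip: dconst_mult)
  then have "C \<in> I" for C using dideal_mult[OF assms(1,2), of "C * dconst (inverse c)"] by (simp add: mult.assoc)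
  then show ?thesis by blast
qed

text \<open>A nonzero reduced polynomial ranks below everything that involves a
  \<open>\<delta>\<^sub>1\<close>-derivative, so the lowest rank is found among the reduced
  elements: \<open>n\<close> is the least index for which some nonzero element involves only
  \<open>y\<^sub>0, \<dots>, y\<^sub>n\<close>. Two elements of lowest rank have the same leader,
  which makes the definite description in \<open>expansion_ord\<close> meaningful.\<close>

theorem expansion_order:
  assumes X1: "X1 \<noteq> 0" and \<Lambda>: "expansion X1 X2 \<Lambda>" "\<Lambda> \<noteq> UNIV"
  obtains n A where "expansion_ord \<Lambda> = enat n" "A \<in> \<Lambda>" "A \<noteq> 0" "occurring A \<subseteq> {0} \<times> {..n}"
    "\<And>B. B \<in> \<Lambda> \<Longrightarrow> B \<noteq> 0 \<Longrightarrow> \<not> occurring B \<subseteq> {0} \<times> {..<n}"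
proof -
  have I: "differential_ideal \<Lambda>" and sub: "diff_ideal_gen {vf_dpoly X1 X2} \<subset> \<Lambda>"
    using \<Lambda>(1) by (auto simp: expansion_def)
  have nonempty: "occurring B \<noteq> {}" if "B \<in> \<Lambda>" "B \<noteq> 0" for B
    using dideal_constant_imp_UNIV[OF I that] \<Lambda>(2) by blast
  let ?P = "\<lambda>n B. B \<in> \<Lambda> \<and> B \<noteq> 0 \<and> occurring B \<subseteq> {0} \<times> {..n}"
  have "\<exists>n B. ?P n B"
  proof -
    \<comment> \<open>Proper inclusion provides an element outside \<open>{X}\<close>; its reduction
      is then nonzero and still in \<open>\<Lambda>\<close>.\<close>
    obtain A where A: "A \<in> \<Lambda>" "A \<notin> diff_ideal_gen {vf_dpoly X1 X2}" using sub by blast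
    obtain B where B: "B \<in> reduced" "A - B \<in> diff_ideal_gen {vf_dpoly X1 X2}"
      using exists_reduced[OF X1 differential_ideal_gen] in_diff_ideal_gen by blast
    have "B \<noteq> 0" using A B by auto
    have "A - B \<in> \<Lambda>" using B sub by blast
    then have "A - (A - B) \<in> \<Lambda>" using dideal_diff[OF I A(1)] by blast
    then have "B \<in> \<Lambda>" by simp
    have "finite (snd ` occurring B)" using finite_occurring by simp
    then obtain n where "\<forall>x\<in>snd ` occurring B. x \<le> n" using finite_nat_set_iff_bounded_le by blast
    then have "occurring B \<subseteq> {0} \<times> {..n}" using B(1) by (force simp: reduced_def)
    then show ?thesis using \<open>B \<noteq> 0\<close> \<open>B \<in> \<Lambda>\<close> by blast
  qed
  define n where "n = (LEAST n. \<exists>B. ?P n B)"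
  have ex: "\<exists>B. ?P n B" unfolding n_def using \<open>\<exists>n B. ?P n B\<close> by (rule LeastI_ex)
  have least: "n \<le> k" if "?P k B" for k B unfolding n_def using that by (intro Least_le) blast
  have min: "\<not> occurring B \<subseteq> {0} \<times> {..<n}" if "B \<in> \<Lambda>" "B \<noteq> 0" for B
  proof
    assume occ: "occurring B \<subseteq> {0} \<times> {..<n}"
    then have "n \<noteq> 0" using nonempty[OF that] by auto
    then have "{..<n} = {..n - 1}" by auto
    then have "?P (n - 1) B" using that occ by simp
    then have "n \<le> n - 1" by (rule least)
    with \<open>n \<noteq> 0\<close> show False by simp
  qed
  have leader_n: "leader B = (0, n)" if "?P n B" for B
  proof (rule leader_eqI)
    from that have that: "B \<in> \<Lambda>" "B \<noteq> 0" "occurring B \<subseteq> {0} \<times> {..n}" by auto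
    have "\<not> occurring B \<subseteq> {0} \<times> {..<n}" by (rule min[OF that(1,2)])
    then obtain i j where ij: "(i, j) \<in> occurring B" "(i, j) \<notin> {0} \<times> {..<n}" by (metis subsetI surj_pair)
    moreover have "(i, j) \<in> {0} \<times> {..n}" using that(3) ij(1) by (rule subsetD)
    ultimately show "(0, n) \<in> occurring B" by (cases "j = n") auto
    fix \<eta> assume "\<eta> \<in> occurring B" and ne: "\<eta> \<noteq> (0, n)"
    then have "\<eta> \<in> {0} \<times> {..n}" using that(3) by (meson subsetD)
    then show "lower_deriv \<eta> (0, n)" using ne by (auto simp: lower_deriv_def)
  qed
  obtain A where A: "?P n A" and deg: "\<And>B. ?P n B \<Longrightarrow> degree_in (0, n) A \<le> degree_in (0, n) B"
    using ex exists_least_iff[of "\<lambda>d. \<exists>B. ?P n B \<and> degree_in (0, n) B = d"] by (metis not_le)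
  have lowest: "lowest_rank_in A \<Lambda>"
    unfolding lowest_rank_in_def
  proof (intro conjI ballI impI notI)
    fix B assume B: "B \<in> \<Lambda>" "B \<noteq> 0" and low: "lower_rank B A"
    have occ: "occurring B \<subseteq> {0} \<times> {..j}" if "leader B = (0, j)" for j
    proof
      fix \<eta> assume "\<eta> \<in> occurring B"
      then show "\<eta> \<in> {0} \<times> {..j}" using leader(2)[OF nonempty[OF B], of \<eta>] that
        by (cases "\<eta> = (0, j)"; cases \<eta> rule: prod.exhaust) (auto simp: lower_deriv_def)
    qed
    from low nonempty[OF B] consider "lower_deriv (leader B) (0, n)"
      | "leader B = (0, n)" "degree_in (0, n) B < degree_in (0, n) A"
      unfolding lower_rank_def leader_n[OF A] by blast
    then show False
    proof cases
      case 1
      then obtain j where j: "leader B = (0, j)" "j < n" by (cases "leader B" rule: prod.exhaust) (auto simp: lower_deriv_def)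
      then show False using least[where k = j and B = B] B occ[OF j(1)] by simp
    next
      case 2
      then show False using deg[of B] B occ[OF 2(1)] by auto
    qed
  qed (use A in auto)
  have ord: "expansion_ord \<Lambda> = enat n"
    unfolding expansion_ord_def
  proof (rule the_equality)
    show "\<exists>A. lowest_rank_in A \<Lambda> \<and>
        (if occurring A = {} then enat n = \<infinity> else \<exists>k. leader A = (0, k) \<and> enat n = enat k)"
      using lowest nonempty A leader_n[OF A] by (intro exI[of _ A]) auto
    fix r assume "\<exists>A. lowest_rank_in A \<Lambda> \<and>
        (if occurring A = {} then r = \<infinity> else \<exists>k. leader A = (0, k) \<and> r = enat k)"
    then obtain A' where A': "lowest_rank_in A' \<Lambda>"
      "if occurring A' = {} then r = \<infinity> else \<exists>k. leader A' = (0, k) \<and> r = enat k" by blast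
    then have in': "A' \<in> \<Lambda>" "A' \<noteq> 0" by (auto simp: lowest_rank_in_def)
    have "\<not> lower_rank A A'" "\<not> lower_rank A' A" using A' lowest A in' by (auto simp: lowest_rank_in_def)
    then have "leader A' = (0, n)"
      using lower_deriv_linear[of "leader A'" "(0, n)"] nonempty[OF in'] nonempty A leader_n[OF A]
      unfolding lower_rank_def by auto
    then show "r = enat n" using A'(2) nonempty[OF in'] by auto
  qed
  show thesis by (rule that[OF ord]) (use A min in auto)
qed

subsection \<open>Reduced differential polynomials as iterated polynomials\<close>

text \<open>Reads the polynomial variable as \<open>\<delta>\<^sub>2\<^sup>k y\<close> and the
  coefficients through \<open>\<psi>\<close>; iterated, it identifies
  \<open>K[y\<^sub>0][y\<^sub>1]\<dots>\<close> with the reduced differential polynomials.\<close>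

definition dpoly_ext :: "('a :: idom \<Rightarrow> dpoly) \<Rightarrow> nat \<Rightarrow> 'a poly \<Rightarrow> dpoly" where
  "dpoly_ext \<psi> k P = poly (map_poly \<psi> P) (dvar (0, k))"

text \<open>
  \<open>presents g I \<psi> D k\<close>: the homomorphism \<open>\<psi>\<close> identifies a ring with derivation \<open>D\<close> with the differential
  polynomials in \<open>\<delta>\<^sub>2\<^sup>j y\<close>, \<open>j < k\<close>, where \<open>D\<close> corresponds to \<open>\<delta>\<^sub>1 + g \<delta>\<^sub>2\<close> modulo \<open>I\<close>.
\<close>

definition presents :: "ratfun \<Rightarrow> dpoly set \<Rightarrow> ('a :: idom \<Rightarrow> dpoly) \<Rightarrow> ('a \<Rightarrow> 'a) \<Rightarrow> nat \<Rightarrow> bool" where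
  "presents g I \<psi> D k \<longleftrightarrow> is_derivation D \<and> \<psi> 1 = 1 \<and> (\<forall>x y. \<psi> (x + y) = \<psi> x + \<psi> y) \<and>
     (\<forall>x y. \<psi> (x * y) = \<psi> x * \<psi> y) \<and> (\<forall>x. \<psi> x = 0 \<longrightarrow> x = 0) \<and>
     (\<forall>A. occurring A \<subseteq> {0} \<times> {..<k} \<longleftrightarrow> (\<exists>x. A = \<psi> x)) \<and>
     (\<forall>x. vf_op g (\<psi> x) - \<psi> (D x) \<in> I)"

lemma presentsD:
  assumes "presents g I \<psi> D k"
  shows "is_derivation D" "\<psi> 0 = 0" "\<psi> 1 = 1" "\<psi> (x + y) = \<psi> x + \<psi> y" "\<psi> (x * y) = \<psi> x * \<psi> y"
    "\<psi> x = 0 \<Longrightarrow> x = 0" "occurring (\<psi> x) \<subseteq> {0} \<times> {..<k}"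
    "occurring A \<subseteq> {0} \<times> {..<k} \<Longrightarrow> \<exists>x. A = \<psi> x" "vf_op g (\<psi> x) - \<psi> (D x) \<in> I"
proof -
  note pr = assms[unfolded presents_def]
  show "is_derivation D" "\<psi> 1 = 1" "\<psi> (x * y) = \<psi> x * \<psi> y" "\<psi> x = 0 \<Longrightarrow> x = 0"
    "occurring A \<subseteq> {0} \<times> {..<k} \<Longrightarrow> \<exists>x. A = \<psi> x" "vf_op g (\<psi> x) - \<psi> (D x) \<in> I"
    using pr by simp_all
  show add: "\<psi> (x + y) = \<psi> x + \<psi> y" for x y using pr by simp
  show "\<psi> 0 = 0" using add[of 0 0] by simp
  have "occurring (\<psi> x) \<subseteq> {0} \<times> {..<k} \<longleftrightarrow> (\<exists>y. \<psi> x = \<psi> y)" using pr by simp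
  then show "occurring (\<psi> x) \<subseteq> {0} \<times> {..<k}" by auto
qed

lemma presents_dconst:
  assumes "differential_ideal I"
  shows "presents g I dconst (vf_rat g) 0"
  unfolding presents_def
proof (intro conjI allI impI is_derivation_vf_rat dconst_1 dconst_add dconst_mult)
  fix x show "dconst x = 0 \<Longrightarrow> x = 0" by (metis dconst_def lookup_single_eq lookup_zero)
  show "vf_op g (dconst x) - dconst (vf_rat g x) \<in> I" for x
    using dideal_0[OF assms] by (simp add: vf_op_dconst)
  show "occurring A \<subseteq> {0} \<times> {..<0} \<longleftrightarrow> (\<exists>x. A = dconst x)" for A
    using occurring_empty occurring_dconst by auto
qed

lemma lookup_mult_single: "Poly_Mapping.lookup ((A :: dpoly) * Poly_Mapping.single n 1) (m + n) = Poly_Mapping.lookup A m"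
  by (induction A rule: dpoly_single_induct)
    (simp_all add: mult_single lookup_single when_def lookup_add distrib_right)

text \<open>Adjoining one more derivative. Compatibility with the derivation needs checking only on
  the new variable, because both sides obey the product rule modulo the ideal.\<close>

lemma presents_ext:
  assumes pr: "presents g I \<psi> D k" and I: "differential_ideal I"
    and var: "vf_op g (dvar (0, k)) - (\<psi> a * dvar (0, k) + \<psi> b) \<in> I"
  shows "presents g I (dpoly_ext \<psi> k) (poly_ext D a b) (Suc k)"
proof -
  let ?\<theta> = "(0, k) :: nat \<times> nat"
  let ?\<Psi> = "dpoly_ext \<psi> k"
  note D = presentsD(1)[OF pr] and zero = presentsD(2)[OF pr] and one = presentsD(3)[OF pr]
    and add = presentsD(4)[OF pr] and mult = presentsD(5)[OF pr] and inj = presentsD(6)[OF pr]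
    and occI = presentsD(7)[OF pr] and occD = presentsD(8)[OF pr] and vf = presentsD(9)[OF pr]
  have \<Psi>_const: "?\<Psi> [:x:] = \<psi> x" for x by (simp add: dpoly_ext_def map_poly_pCons zero)
  have \<Psi>_pCons: "?\<Psi> (pCons x P) = \<psi> x + dvar ?\<theta> * ?\<Psi> P" for x P
    by (simp add: dpoly_ext_def map_poly_pCons zero)
  have \<Psi>_add: "?\<Psi> (P + Q) = ?\<Psi> P + ?\<Psi> Q" and \<Psi>_mult: "?\<Psi> (P * Q) = ?\<Psi> P * ?\<Psi> Q" for P Q
    unfolding dpoly_ext_def by (simp_all add: map_poly_hom[OF add mult])
  have \<Psi>_0: "?\<Psi> 0 = 0" by (simp add: dpoly_ext_def)
  have \<Psi>_X: "?\<Psi> [:0, 1:] = dvar ?\<theta>" by (simp add: \<Psi>_pCons \<Psi>_0 \<Psi>_const zero one)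
  have occ_\<Psi>: "occurring (?\<Psi> P) \<subseteq> {0} \<times> {..<Suc k}" for P
  proof (induction P)
    case 0
    then show ?case by (simp add: dpoly_ext_def occurring_def)
  next
    case (pCons x P)
    have "occurring (\<psi> x) \<subseteq> {0} \<times> {..<k}" by (rule occI)
    then show ?case
      unfolding \<Psi>_pCons
      using occurring_add[of "\<psi> x" "dvar ?\<theta> * ?\<Psi> P"] occurring_mult[of "dvar ?\<theta>" "?\<Psi> P"] pCons.IH
      unfolding occurring_dvar lessThan_Suc by blast
  qed
  have surj: "\<exists>P. A = ?\<Psi> P" if "occurring A \<subseteq> {0} \<times> {..<Suc k}" for A
    using that
  proof (induction A rule: dpoly_induct)
    case (const c)
    have "occurring (dconst c) \<subseteq> {0} \<times> {..<k}" by (simp add: occurring_dconst)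
    then obtain x where "dconst c = \<psi> x" using occD by metis
    then show ?case using \<Psi>_const by metis
  next
    case (var \<theta>)
    show ?case
    proof (cases "\<theta> = ?\<theta>")
      case True
      then show ?thesis using \<Psi>_X by metis
    next
      case False
      then have "occurring (dvar \<theta>) \<subseteq> {0} \<times> {..<k}" using var by (auto simp: occurring_dvar less_Suc_eq)
      then obtain x where "dvar \<theta> = \<psi> x" using occD by metis
      then show ?thesis using \<Psi>_const by metis
    qed
  next
    case (add A B)
    then show ?case using \<Psi>_add by metis
  next
    case (mult A B)
    then show ?case using \<Psi>_mult by metis
  qed
  \<comment> \<open>Injectivity: since \<open>\<psi>\<close> produces no \<open>y\<^sub>k\<close>,
    the exponent of \<open>y\<^sub>k\<close> in a monomial tells which coefficient of
    \<open>P\<close> it comes from.\<close>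
  have \<Psi>_lookup: "Poly_Mapping.lookup (?\<Psi> P) (m + Poly_Mapping.single ?\<theta> i) = Poly_Mapping.lookup (\<psi> (coeff P i)) m"
    if m: "Poly_Mapping.lookup m ?\<theta> = 0" for P m i
  proof (induction P arbitrary: i)
    case 0
    then show ?case by (simp add: dpoly_ext_def zero)
  next
    case (pCons x P)
    have X: "dvar ?\<theta> * ?\<Psi> P = ?\<Psi> P * Poly_Mapping.single (Poly_Mapping.single ?\<theta> 1) 1"
      by (simp add: dvar_def mult.commute)
    show ?case
    proof (cases i)
      case 0
      have "m \<notin> Poly_Mapping.keys (dvar ?\<theta> * ?\<Psi> P)"
      proof
        assume "m \<in> Poly_Mapping.keys (dvar ?\<theta> * ?\<Psi> P)"
        then obtain b where "m = Poly_Mapping.single ?\<theta> 1 + b"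
          using keys_mult[of "dvar ?\<theta>" "?\<Psi> P"] by (auto simp: dvar_def)
        then show False using m by (simp add: lookup_add)
      qed
      then show ?thesis using 0
        by (simp add: \<Psi>_pCons lookup_add in_keys_iff)
    next
      case (Suc j)
      have "occurring (\<psi> x) \<subseteq> {0} \<times> {..<k}" by (rule occI)
      then have "Poly_Mapping.lookup (\<psi> x) (m + Poly_Mapping.single ?\<theta> i) = 0"
        by (intro lookup_not_occurring[of ?\<theta>]) (auto simp: Suc lookup_add)
      moreover have "m + Poly_Mapping.single ?\<theta> i = (m + Poly_Mapping.single ?\<theta> j) + Poly_Mapping.single ?\<theta> 1"
        unfolding Suc by (simp add: add.assoc flip: single_add)
      ultimately show ?thesis
        unfolding \<Psi>_pCons lookup_add X
        using pCons.IH[of j] by (simp add: lookup_mult_single Suc del: One_nat_def)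
    qed
  qed
  have inj_\<Psi>: "P = 0" if "?\<Psi> P = 0" for P
  proof (rule poly_eqI)
    fix i
    have "Poly_Mapping.lookup (\<psi> (coeff P i)) m = 0" for m
    proof (cases "Poly_Mapping.lookup m ?\<theta> = 0")
      case True
      from \<Psi>_lookup[OF this, of P i] that show ?thesis by simp
    next
      case False
      have "occurring (\<psi> (coeff P i)) \<subseteq> {0} \<times> {..<k}" by (rule occI)
      then show ?thesis by (intro lookup_not_occurring[of ?\<theta>] False) auto
    qed
    then have "\<psi> (coeff P i) = 0" by (intro poly_mapping_eqI) simp
    then show "coeff P i = coeff 0 i" using inj by simp
  qed
  have vf_\<Psi>: "vf_op g (?\<Psi> P) - ?\<Psi> (poly_ext D a b P) \<in> I" for P
  proof (induction P)
    case 0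
    have "?\<Psi> 0 = 0" by (simp add: dpoly_ext_def)
    then show ?case using dideal_0[OF I] by (simp add: derivation_0[OF is_derivation_vf_op] poly_ext_def)
  next
    case (pCons x P)
    note E = is_derivation_poly_ext[OF D, of a b]
    have X: "pCons x P = [:x:] + [:0, 1:] * P" by simp
    have c2: "[:b, a:] = [:b:] + [:a:] * [:0, 1:]" by simp
    have "poly_ext D a b (pCons x P) = [:D x:] + ([:b, a:] * P + [:0, 1:] * poly_ext D a b P)"
      unfolding X derivation_add[OF E] derivation_mult[OF E] poly_ext_X[OF D] poly_ext_pCons_0[OF D] ..
    then have 1: "?\<Psi> (poly_ext D a b (pCons x P)) =
        \<psi> (D x) + ((\<psi> b + \<psi> a * dvar ?\<theta>) * ?\<Psi> P + dvar ?\<theta> * ?\<Psi> (poly_ext D a b P))"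
      unfolding c2 by (simp only: \<Psi>_add \<Psi>_mult \<Psi>_X \<Psi>_const)
    have 2: "vf_op g (?\<Psi> (pCons x P)) =
        vf_op g (\<psi> x) + (vf_op g (dvar ?\<theta>) * ?\<Psi> P + dvar ?\<theta> * vf_op g (?\<Psi> P))"
      unfolding \<Psi>_pCons
      by (simp only: derivation_add[OF is_derivation_vf_op] derivation_mult[OF is_derivation_vf_op])
    have "(vf_op g (\<psi> x) - \<psi> (D x)) + (vf_op g (dvar ?\<theta>) - (\<psi> a * dvar ?\<theta> + \<psi> b)) * ?\<Psi> P +
        dvar ?\<theta> * (vf_op g (?\<Psi> P) - ?\<Psi> (poly_ext D a b P)) \<in> I" (is "?E \<in> I")
      by (intro dideal_add[OF I] dideal_mult[OF I] dideal_mult'[OF I] vf var pCons.IH)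
    also have "?E = vf_op g (?\<Psi> (pCons x P)) - ?\<Psi> (poly_ext D a b (pCons x P))"
      unfolding 1 2 by (simp add: algebra_simps)
    finally show ?case .
  qed
  show ?thesis
    unfolding presents_def
  proof (intro conjI allI impI is_derivation_poly_ext D \<Psi>_add \<Psi>_mult inj_\<Psi> vf_\<Psi>)
    show "?\<Psi> 1 = 1" by (simp add: one_pCons \<Psi>_const one)
    show "occurring A \<subseteq> {0} \<times> {..<Suc k} \<longleftrightarrow> (\<exists>x. A = ?\<Psi> x)" for A using surj[of A] occ_\<Psi> by auto
  qed
qed

subsection \<open>The minimal relation\<close>

lemma dpoly_ext_simps:
  "\<psi> 0 = 0 \<Longrightarrow> dpoly_ext \<psi> k 0 = 0"
  "\<psi> 0 = 0 \<Longrightarrow> dpoly_ext \<psi> k (pCons x P) = \<psi> x + dvar (0, k) * dpoly_ext \<psi> k P"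
  by (simp_all add: dpoly_ext_def map_poly_pCons)

text \<open>The relations between the variables form the preimage \<open>J\<close> of the ideal, and
  the four claims are what the arguments on minimal relations require of it. No nonzero constant
  lies in \<open>J\<close> because \<open>k\<close> is minimal.\<close>

lemma presents_ideal:
  fixes \<psi> :: "'a :: idom \<Rightarrow> dpoly"
  assumes pr: "presents g I \<psi> D k" and pr': "presents g I (dpoly_ext \<psi> k) (poly_ext D a b) (Suc k)"
    and I: "differential_ideal I"
    and A: "A \<in> I" "A \<noteq> 0" "occurring A \<subseteq> {0} \<times> {..k}"
    and min: "\<And>B. B \<in> I \<Longrightarrow> B \<noteq> 0 \<Longrightarrow> \<not> occurring B \<subseteq> {0} \<times> {..<k}"
  defines "J \<equiv> {P. dpoly_ext \<psi> k P \<in> I}"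
  shows "P \<in> J \<Longrightarrow> Q \<in> J \<Longrightarrow> smult x P - smult y Q \<in> J"
    and "P \<in> J \<Longrightarrow> poly_ext D a b P \<in> J"
    and "\<exists>P\<in>J. P \<noteq> 0"
    and "[:x:] \<in> J \<Longrightarrow> x = 0"
proof -
  let ?\<Psi> = "dpoly_ext \<psi> k"
  note add = presentsD(4)[OF pr'] and mult = presentsD(5)[OF pr'] and surj = presentsD(8)[OF pr'] and vf = presentsD(9)[OF pr']
    and \<psi>0 = presentsD(2)[OF pr] and inj = presentsD(6)[OF pr] and occ = presentsD(7)[OF pr]
  have cJ: "[:x:] * P \<in> J" if "P \<in> J" for x P
    using that dideal_mult[OF I] by (simp add: J_def mult del: mult_pCons_left)
  show "smult x P - smult y Q \<in> J" if "P \<in> J" "Q \<in> J"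
  proof -
    have "?\<Psi> ([:x:] * P + [:- y:] * Q) \<in> I"
      using cJ[OF that(1), of x] cJ[OF that(2), of "- y"] dideal_add[OF I] by (simp add: J_def add del: mult_pCons_left)
    then show ?thesis by (simp add: J_def)
  qed
  show "poly_ext D a b P \<in> J" if "P \<in> J"
  proof -
    have "vf_op g (?\<Psi> P) - (vf_op g (?\<Psi> P) - ?\<Psi> (poly_ext D a b P)) \<in> I"
      using that by (intro dideal_diff[OF I] dideal_vf_op[OF I] vf) (simp add: J_def)
    then show ?thesis by (simp add: J_def)
  qed
  show "\<exists>P\<in>J. P \<noteq> 0"
  proof -
    obtain P where P: "A = ?\<Psi> P" using surj[of A] A(3) by (auto simp: lessThan_Suc_atMost)
    have "?\<Psi> 0 = 0" by (simp add: dpoly_ext_def)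
    then show ?thesis using P A by (intro bexI[of _ P]) (auto simp: J_def)
  qed
  show "x = 0" if "[:x:] \<in> J"
  proof -
    have "?\<Psi> [:x:] = \<psi> x" by (simp add: dpoly_ext_def map_poly_pCons \<psi>0)
    then have "\<psi> x \<in> I" using that by (simp add: J_def)
    then show ?thesis using min[of "\<psi> x"] occ[of x] inj[of x] by metis
  qed
qed

lemma presents_minimal_relation:
  fixes \<psi> :: "'a :: idom \<Rightarrow> dpoly"
  assumes pr: "presents g I \<psi> D k" and pr': "presents g I (dpoly_ext \<psi> k) (poly_ext D a b) (Suc k)"
    and I: "differential_ideal I"
    and A: "A \<in> I" "A \<noteq> 0" "occurring A \<subseteq> {0} \<times> {..k}"
    and min: "\<And>B. B \<in> I \<Longrightarrow> B \<noteq> 0 \<Longrightarrow> \<not> occurring B \<subseteq> {0} \<times> {..<k}"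
  obtains P where "dpoly_ext \<psi> k P \<in> I" "degree P \<noteq> 0"
    "\<forall>i. lead_coeff P * (D (coeff P i) + of_nat i * a * coeff P i + of_nat (Suc i) * b * coeff P (Suc i)) =
      (D (lead_coeff P) + of_nat (degree P) * a * lead_coeff P) * coeff P i"
proof -
  note J = presents_ideal[OF pr pr' I A min]
  let ?J = "{P. dpoly_ext \<psi> k P \<in> I}"
  define d where "d = (LEAST d. \<exists>P\<in>?J. P \<noteq> 0 \<and> degree P = d)"
  have "\<exists>d. \<exists>P\<in>?J. P \<noteq> 0 \<and> degree P = d" using J(3) by metis
  then have "\<exists>P\<in>?J. P \<noteq> 0 \<and> degree P = d" unfolding d_def by (rule LeastI_ex)
  then obtain P where P: "P \<in> ?J" "P \<noteq> 0" "degree P = d" by metis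
  have least: "degree P \<le> degree B" if "B \<in> ?J" "B \<noteq> 0" for B
    unfolding P(3) d_def using that by (intro Least_le bexI[of _ B]) simp_all
  note D = presentsD(1)[OF pr]
  show thesis
  proof (rule that[of P])
    show "degree P \<noteq> 0" using J(4) P by (metis degree_eq_zeroE pCons_0_0)
    show "dpoly_ext \<psi> k P \<in> I" using P(1) by simp
    show "\<forall>i. lead_coeff P * (D (coeff P i) + of_nat i * a * coeff P i + of_nat (Suc i) * b * coeff P (Suc i)) =
      (D (lead_coeff P) + of_nat (degree P) * a * lead_coeff P) * coeff P i"
      by (intro allI minimal_relation[OF D J(1,2) P(1) least])
  qed
qed

context
  fixes X1 X2 :: bipoly and I :: "dpoly set" and g c1 c2 c3 :: ratfun
  assumes X1: "X1 \<noteq> 0" and I: "differential_ideal I" "vf_dpoly X1 X2 \<in> I"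
  defines "g \<equiv> vf_slope X1 X2" and "c1 \<equiv> rat_d2 g" and "c2 \<equiv> rat_d2 c1" and "c3 \<equiv> rat_d2 c2"
begin

text \<open>Each equation is \<open>\<delta>\<^sub>2\<close> of the preceding one, rewritten by
  \<open>D \<delta>\<^sub>2 = \<delta>\<^sub>2 D - c1 \<delta>\<^sub>2\<close>; every such step adds
  another \<open>- c1\<close> to the leading factor.\<close>

lemma vf_op_dvar:
  "vf_op g (dvar (0, 0)) \<in> I"
  "vf_op g (dvar (0, 1)) - dconst (- c1) * dvar (0, 1) \<in> I"
  "vf_op g (dvar (0, 2)) - (dconst (- 2 * c1) * dvar (0, 2) + dconst (- c2) * dvar (0, 1)) \<in> I"
  "vf_op g (dvar (0, 3)) - (dconst (- 3 * c1) * dvar (0, 3) +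
     (dconst (- 3 * c2) * dvar (0, 2) + dconst (- c3) * dvar (0, 1))) \<in> I"
proof -
  note d2 = derivation_simps[OF is_derivation_dpoly(2)]
  define y0 y1 y2 y3 where "y0 = dvar (0, 0)" and "y1 = dvar (0, 1)" and "y2 = dvar (0, 2)" and "y3 = dvar (0, 3)"
  note y_defs = y0_def[symmetric] y1_def[symmetric] y2_def[symmetric] y3_def[symmetric]
  have suc: "dpoly_d2 y0 = y1" "dpoly_d2 y1 = y2" "dpoly_d2 y2 = y3"
    by (simp_all add: y0_def y1_def y2_def y3_def dpoly_d2_derivation numeral_2_eq_2 numeral_3_eq_3)
  have dc: "dpoly_d2 (dconst x) = dconst (rat_d2 x)" for x by (simp add: dpoly_d2_derivation)
  have num: "dconst (- 2 * x) = - 2 * dconst x" "dconst (- 3 * x) = - 3 * dconst x" for x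
  proof -
    have "dconst (numeral k) = numeral k" for k by (simp add: dconst_def)
    then show "dconst (- 2 * x) = - 2 * dconst x" "dconst (- 3 * x) = - 3 * dconst x"
      by (simp_all add: dconst_minus dconst_mult)
  qed
  show Y0: "vf_op g (dvar (0, 0)) \<in> I"
    using vf_dpoly_monic[OF X1 I] by (simp add: vf_op_def dpoly_d1_derivation dpoly_d2_derivation g_def)
  have "vf_op g y1 - dconst (- c1) * y1 = dpoly_d2 (vf_op g y0)"
    using vf_op_commute[of g y0] by (simp add: suc c1_def dconst_minus)
  then show Y1: "vf_op g (dvar (0, 1)) - dconst (- c1) * dvar (0, 1) \<in> I"
    using dideal_d2[OF I(1) Y0] by (simp only: y_defs)
  have "dpoly_d2 (vf_op g y1 - dconst (- c1) * y1) = dpoly_d2 (vf_op g y1) + dconst c2 * y1 + dconst c1 * y2"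
    by (simp add: dconst_minus d2 suc dc c2_def)
  then have "vf_op g y2 - (dconst (- 2 * c1) * y2 + dconst (- c2) * y1) = dpoly_d2 (vf_op g y1 - dconst (- c1) * y1)"
    using vf_op_commute[of g y1] unfolding num by (simp add: suc c1_def[symmetric] dconst_minus algebra_simps)
  then show Y2: "vf_op g (dvar (0, 2)) - (dconst (- 2 * c1) * dvar (0, 2) + dconst (- c2) * dvar (0, 1)) \<in> I"
    using dideal_d2[OF I(1) Y1] by (simp only: y_defs)
  have "dpoly_d2 (vf_op g y2 - (dconst (- 2 * c1) * y2 + dconst (- c2) * y1)) =
      dpoly_d2 (vf_op g y2) + 2 * dconst c2 * y2 + 2 * dconst c1 * y3 + dconst c3 * y1 + dconst c2 * y2"
    unfolding num by (simp add: dconst_minus d2 suc dc c3_def c2_def[symmetric] algebra_simps)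
  then have "vf_op g y3 - (dconst (- 3 * c1) * y3 + (dconst (- 3 * c2) * y2 + dconst (- c3) * y1)) =
      dpoly_d2 (vf_op g y2 - (dconst (- 2 * c1) * y2 + dconst (- c2) * y1))"
    using vf_op_commute[of g y2] unfolding num by (simp add: suc c1_def[symmetric] dconst_minus algebra_simps)
  then show "vf_op g (dvar (0, 3)) - (dconst (- 3 * c1) * dvar (0, 3) +
     (dconst (- 3 * c2) * dvar (0, 2) + dconst (- c3) * dvar (0, 1))) \<in> I"
    using dideal_d2[OF I(1) Y2] by (simp only: y_defs)
qed

text \<open>The derivations induced on \<open>K[y\<^sub>0]\<close> up to
  \<open>K[y\<^sub>0][y\<^sub>1][y\<^sub>2][y\<^sub>3]\<close>. Surplus brackets only embed
  constants; \<open>[:0, [:- c2:]:]\<close> is \<open>- c2 y\<^sub>1\<close>, and the last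
  inhomogeneous term is \<open>- c3 y\<^sub>1 - 3 c2 y\<^sub>2\<close>.\<close>

definition "ring_d1 = poly_ext (vf_rat g) 0 0"
definition "ring_d2 = poly_ext ring_d1 [:- c1:] 0"
definition "ring_d3 = poly_ext ring_d2 [:[:- 2 * c1:]:] [:0, [:- c2:]:]"
definition "ring_d4 = poly_ext ring_d3 [:[:[:- 3 * c1:]:]:] [:[:0, [:- c3:]:], [:[:- 3 * c2:]:]:]"

abbreviation "psi1 \<equiv> dpoly_ext dconst 0"
abbreviation "psi2 \<equiv> dpoly_ext psi1 1"
abbreviation "psi3 \<equiv> dpoly_ext psi2 2"
abbreviation "psi4 \<equiv> dpoly_ext psi3 3"

lemma presents_chain:
  "presents g I dconst (vf_rat g) 0" "presents g I psi1 ring_d1 1" "presents g I psi2 ring_d2 2"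
  "presents g I psi3 ring_d3 3" "presents g I psi4 ring_d4 4"
proof -
  have 0: "psi1 0 = 0" "psi2 0 = 0" "psi3 0 = 0" by (simp_all add: dpoly_ext_simps dconst_0)
  show p0: "presents g I dconst (vf_rat g) 0" by (rule presents_dconst[OF I(1)])
  have "presents g I psi1 ring_d1 (Suc 0)" unfolding ring_d1_def
    by (rule presents_ext[OF p0 I(1)]) (use vf_op_dvar(1) in \<open>simp add: dconst_0\<close>)
  then show p1: "presents g I psi1 ring_d1 1" by simp
  have "presents g I psi2 ring_d2 (Suc 1)" unfolding ring_d2_def
    by (rule presents_ext[OF p1 I(1)]) (use vf_op_dvar(2) in \<open>simp add: dpoly_ext_simps dconst_0\<close>)
  then show p2: "presents g I psi2 ring_d2 2" by (simp add: numeral_2_eq_2)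
  have "presents g I psi3 ring_d3 (Suc 2)" unfolding ring_d3_def
    by (rule presents_ext[OF p2 I(1)]) (use vf_op_dvar(3) in \<open>simp add: dpoly_ext_simps dconst_0 mult.commute\<close>)
  then show p3: "presents g I psi3 ring_d3 3" by (simp add: numeral_3_eq_3 numeral_2_eq_2)
  have "presents g I psi4 ring_d4 (Suc 3)" unfolding ring_d4_def
    by (rule presents_ext[OF p3 I(1)]) (use vf_op_dvar(4) in \<open>simp add: dpoly_ext_simps dconst_0 algebra_simps\<close>)
  then show "presents g I psi4 ring_d4 4" by simp
qed

lemma is_derivation_ring: "is_derivation ring_d1" "is_derivation ring_d2" "is_derivation ring_d3"
  unfolding ring_d1_def ring_d2_def ring_d3_def
  by (intro is_derivation_poly_ext is_derivation_vf_rat)+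

text \<open>Two nonzero coefficients of the minimal relation differ by their weights in
  \<open>y\<^sub>1\<close> only, and their quotient is a semi-invariant. The second alternative is a
  relation with a single term, which an ideal that is not radical may contain.\<close>

lemma order_one:
  assumes A: "A \<in> I" "A \<noteq> 0" "occurring A \<subseteq> {0} \<times> {..1}"
    and min: "\<And>B. B \<in> I \<Longrightarrow> B \<noteq> 0 \<Longrightarrow> \<not> occurring B \<subseteq> {0} \<times> {..<1}"
  shows "semi_invariant (vf_rat g) c1 \<or>
    (\<exists>B n. B \<noteq> 0 \<and> occurring B \<subseteq> {0} \<times> {..0} \<and> B * dvar (0, 1) ^ n \<in> I)"
proof -
  have "presents g I psi2 (poly_ext ring_d1 [:- c1:] 0) (Suc 1)"
    using presents_chain(3) by (simp add: ring_d2_def numeral_2_eq_2)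
  from presents_minimal_relation[OF presents_chain(2) this I(1) A min]
  obtain P where P: "psi2 P \<in> I" "degree P \<noteq> 0"
    and rel: "\<And>i. lead_coeff P * (ring_d1 (coeff P i) + of_nat i * [:- c1:] * coeff P i) =
      (ring_d1 (lead_coeff P) + of_nat (degree P) * [:- c1:] * lead_coeff P) * coeff P i" by auto
  let ?q = "lead_coeff P"
  have q0: "?q \<noteq> 0" using P(2) by auto
  show ?thesis
  proof (cases "\<exists>i<degree P. coeff P i \<noteq> 0")
    case True
    then obtain i where i: "i < degree P" "coeff P i \<noteq> 0" by blast
    have neg: "[:- c1:] = - [:c1:]" by simp
    have "?q * ring_d1 (coeff P i) - coeff P i * ring_d1 ?q =
        of_int (int i - int (degree P)) * [:c1:] * coeff P i * ?q"
      using rel[of i] unfolding neg by (simp add: algebra_simps)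
    then have "semi_invariant ring_d1 [:c1:]"
      unfolding semi_invariant_def using i q0
      by (intro exI[of _ "coeff P i"] exI[of _ ?q] exI[of _ "int i - int (degree P)"]) auto
    then show ?thesis
      using semi_invariant_constant_variable[OF is_derivation_vf_rat] unfolding ring_d1_def by blast
  next
    case False
    have "P = [:?q:] * [:0, 1:] ^ degree P"
    proof (rule poly_eqI)
      fix n
      have "[:?q:] * [:0, 1:] ^ degree P = monom ?q (degree P)" by (simp add: monom_altdef)
      then show "coeff P n = coeff ([:?q:] * [:0, 1:] ^ degree P) n"
        using False by (cases n "degree P" rule: linorder_cases) (auto simp: coeff_eq_0)
    qed
    moreover have hom: "psi2 (Q * R) = psi2 Q * psi2 R" "psi2 1 = 1" for Q R
      by (rule presentsD[OF presents_chain(3)])+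
    moreover have "psi2 ([:0, 1:] ^ n) = dvar (0, 1) ^ n" for n
    proof (induction n)
      case (Suc n)
      have "psi2 [:0, 1:] = dvar (0, 1)"
        using presentsD(3)[OF presents_chain(2)] by (simp add: dpoly_ext_simps dconst_0)
      then show ?case unfolding power_Suc hom(1) Suc by simp
    qed (simp only: power_0 hom(2))
    moreover have "psi2 [:?q:] = psi1 ?q" by (simp add: dpoly_ext_simps dconst_0)
    ultimately have "psi1 ?q * dvar (0, 1) ^ degree P \<in> I" using P(1) by metis
    moreover have "psi1 ?q \<noteq> 0"
      using presentsD(6)[OF presents_chain(2), of ?q] q0 by metis
    moreover have "occurring (psi1 ?q) \<subseteq> {0} \<times> {..<1}"
      by (rule presentsD(7)[OF presents_chain(2)])
    ultimately show ?thesis by (auto simp: lessThan_Suc_atMost)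
  qed
qed

text \<open>The minimal relation solves the equation of \<open>y\<^sub>2\<close>. Division by
  \<open>y\<^sub>1\<close> turns it into the equation of \<open>y\<^sub>2 / y\<^sub>1\<close>, whose
  coefficients lie in \<open>K\<close>; then \<open>y\<^sub>1\<close> and \<open>y\<^sub>0\<close>
  are eliminated from the solution.\<close>

lemma order_two:
  assumes A: "A \<in> I" "A \<noteq> 0" "occurring A \<subseteq> {0} \<times> {..2}"
    and min: "\<And>B. B \<in> I \<Longrightarrow> B \<noteq> 0 \<Longrightarrow> \<not> occurring B \<subseteq> {0} \<times> {..<2}"
  shows "quotient_solvable (vf_rat g) (- c1) (- c2) \<or> semi_invariant (vf_rat g) c1"
proof -
  have "presents g I psi3 (poly_ext ring_d2 [:[:- 2 * c1:]:] [:0, [:- c2:]:]) (Suc 2)"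
    using presents_chain(4) by (simp add: ring_d3_def numeral_3_eq_3 numeral_2_eq_2)
  note J = presents_ideal[OF presents_chain(3) this I(1) A min]
  obtain P where P: "P \<in> {P. psi3 P \<in> I}" "P \<noteq> 0" using J(3) by blast
  have "quotient_solvable ring_d2 [:[:- 2 * c1:]:] [:0, [:- c2:]:]"
    by (rule quotient_solvable_minimal_relation[OF is_derivation_ring(2) J(1,2) P J(4)])
  also have "[:0, [:- c2:]:] = [:[:- c2:]:] * [:0, 1:]" by simp
  finally have "quotient_solvable ring_d2 ([:[:- 2 * c1:]:] - [:[:- c1:]:]) [:[:- c2:]:]"
    by (rule quotient_solvable_divide[OF is_derivation_ring(2), rotated 2])
      (simp_all add: ring_d2_def poly_ext_X[OF is_derivation_ring(1)])
  also have "[:[:- 2 * c1:]:] - [:[:- c1:]:] = [:[:- c1:]:]" by simp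
  finally have "quotient_solvable (poly_ext ring_d1 (- [:c1:]) 0) [:[:- c1:]:] [:[:- c2:]:]"
    by (simp add: ring_d2_def)
  then have "quotient_solvable ring_d1 [:- c1:] [:- c2:] \<or> semi_invariant ring_d1 [:c1:]"
    by (rule quotient_solvable_homogeneous_variable[OF is_derivation_ring(1)])
  then show ?thesis
    using quotient_solvable_constant_variable[OF is_derivation_vf_rat]
      semi_invariant_constant_variable[OF is_derivation_vf_rat] unfolding ring_d1_def by blast
qed

text \<open>
  With \<open>s = y\<^sub>2 / y\<^sub>1\<close> the variable \<open>y\<^sub>3\<close> is replaced first by \<open>y\<^sub>3 / y\<^sub>1\<close> and then by \<open>2 y\<^sub>3 / y\<^sub>1 - 3 s\<^sup>2\<close>, whose derivative
  involves neither \<open>y\<^sub>1\<close> nor \<open>s\<close>.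
\<close>

lemma order_three:
  assumes A: "A \<in> I" "A \<noteq> 0" "occurring A \<subseteq> {0} \<times> {..3}"
    and min: "\<And>B. B \<in> I \<Longrightarrow> B \<noteq> 0 \<Longrightarrow> \<not> occurring B \<subseteq> {0} \<times> {..<3}"
  shows "quotient_solvable (vf_rat g) (- 2 * c1) (- 2 * c3) \<or>
    quotient_solvable (vf_rat g) (- c1) (- c2) \<or> semi_invariant (vf_rat g) c1"
proof -
  let ?l = "[:[:[:- 3 * c1:]:]:]" and ?m = "[:[:0, [:- c3:]:], [:[:- 3 * c2:]:]:]"
  let ?G = "poly_ext ring_d1 (- [:c1:]) (- [:c2:])"
  let ?F = "poly_ext ?G (- [:[:c1:]:]) 0"
  note G = is_derivation_poly_ext[OF is_derivation_ring(1), of "- [:c1:]" "- [:c2:]"]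
  note F = is_derivation_poly_ext[OF G, of "- [:[:c1:]:]" 0]
  have num: "- 2 * [:x:] = [:- 2 * x:]" for x :: "'a :: idom" by (simp add: numeral_poly)
  have "presents g I psi4 (poly_ext ring_d3 ?l ?m) (Suc 3)"
    using presents_chain(5) by (simp add: ring_d4_def)
  note J = presents_ideal[OF presents_chain(4) this I(1) A min]
  obtain P where P: "P \<in> {P. psi4 P \<in> I}" "P \<noteq> 0" using J(3) by blast
  have sol: "quotient_solvable ring_d3 ?l ?m"
    by (rule quotient_solvable_minimal_relation[OF is_derivation_ring(3) J(1,2) P J(4)])
  \<comment> \<open>Passage from \<open>K[y\<^sub>0][y\<^sub>1][y\<^sub>2]\<close> to
    \<open>K[y\<^sub>0][s][y\<^sub>1]\<close>.\<close>
  have "poly_swap (ring_d3 Q) = ?F (poly_swap Q)" for Q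
    using poly_swap_poly_ext[OF is_derivation_ring(1), of "[:c1:]" "[:c2:]" Q]
    unfolding num by (simp add: ring_d3_def ring_d2_def)
  from quotient_solvable_hom[OF poly_swap_add poly_swap_mult poly_swap_eq_0 this sol]
  have "quotient_solvable ?F (poly_swap ?l) (poly_swap ?m)" .
  also have "poly_swap ?l = ?l"
    by (simp add: poly_swap_pCons map_poly_pCons)
  also have "poly_swap ?m = [:[:[:- c3:], [:- 3 * c2:]:]:] * [:0, 1:]"
    by (simp add: poly_swap_pCons map_poly_pCons)
  finally have "quotient_solvable ?F (?l - [:[:[:- c1:]:]:]) [:[:[:- c3:], [:- 3 * c2:]:]:]"
    by (rule quotient_solvable_divide[OF F, rotated 2]) (simp, subst poly_ext_X[OF G], simp)
  also have "?l - [:[:[:- c1:]:]:] = [:[:[:- 2 * c1:]:]:]" by simp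
  finally have "quotient_solvable ?F [:[:[:- 2 * c1:]:]:] [:[:[:- 2 * c3:]:]:]"
  \<comment> \<open>The shift is \<open>- 3 s\<^sup>2\<close>: as
    \<open>D (s\<^sup>2) = - 2 c1 s\<^sup>2 - 2 c2 s\<close>, it cancels the term
    \<open>- 6 c2 s\<close> of the doubled equation and leaves the factor \<open>- 2 c1\<close>
    unchanged.\<close>
  proof (rule quotient_solvable_shift[OF F, where k = 2 and s = "[:[:0, 0, [:- 3:]:]:]"])
    show "?F 2 = 0" by (rule derivation_numeral[OF F])
    have d3: "ring_d1 [:- 3:] = 0"
      using derivation_minus[OF is_derivation_ring(1), of 3] derivation_numeral[OF is_derivation_ring(1), of "num.Bit1 num.One"]
      by (simp add: numeral_poly)
    have GG: "?G [:0, 0, [:- 3:]:] = [:0, [:6 * c2:], [:6 * c1:]:]"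
      by (rule poly_eqI) (simp add: coeff_poly_ext[OF is_derivation_ring(1)] coeff_pCons
          derivation_0[OF is_derivation_ring(1)] d3 numeral_poly mult.commute split: nat.splits)
    have "?F [:[:0, 0, [:- 3:]:]:] = [:[:0, [:6 * c2:], [:6 * c1:]:]:]"
      unfolding poly_ext_pCons_0[OF G] GG by (rule refl)
    then show "2 * [:[:[:- c3:], [:- 3 * c2:]:]:] + ?F [:[:0, 0, [:- 3:]:]:] -
        [:[:[:- 2 * c1:]:]:] * [:[:0, 0, [:- 3:]:]:] = [:[:[:- 2 * c3:]:]:]"
      by (simp add: numeral_poly)
  qed
  then have "quotient_solvable ?G [:[:- 2 * c1:]:] [:[:- 2 * c3:]:] \<or> semi_invariant ?G [:[:c1:]:]"
    by (rule quotient_solvable_homogeneous_variable[OF G])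
  then have "quotient_solvable ring_d1 [:- 2 * c1:] [:- 2 * c3:] \<or>
      quotient_solvable ring_d1 [:- c1:] [:- c2:] \<or> semi_invariant ring_d1 [:c1:]"
  proof
    assume "quotient_solvable ?G [:[:- 2 * c1:]:] [:[:- 2 * c3:]:]"
    then have "quotient_solvable ?G [:- 2 * [:c1:]:] [:- 2 * [:c3:]:]" unfolding num .
    from riccati_affine_variable[OF is_derivation_ring(1) this] show ?thesis unfolding num by simp
  next
    assume "semi_invariant ?G [:[:c1:]:]"
    from semi_invariant_affine_variable[OF is_derivation_ring(1) this] show ?thesis by auto
  qed
  then show ?thesis
    using quotient_solvable_constant_variable[OF is_derivation_vf_rat]
      semi_invariant_constant_variable[OF is_derivation_vf_rat] unfolding ring_d1_def by blast
qed

end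

section \<open>Construction of first integrals\<close>

subsection \<open>Linear Pfaffian systems with rational coefficients\<close>

lemma rat_val_minus:
  assumes "rat_regular c z"
  shows "rat_val (- c) z = - rat_val c z" "rat_regular (- c) z"
proof -
  obtain p q where c: "c = Fract p q" "q \<noteq> 0" "eval2 q z \<noteq> 0" "rat_val c z = eval2 p z / eval2 q z"
    using rat_regularE[OF assms] .
  have e: "- c = Fract (- p) q" using c by simp
  show "rat_val (- c) z = - rat_val c z"
    unfolding c(4) e by (subst rat_val_Fract[OF c(3)]) simp
  show "rat_regular (- c) z" unfolding e by (rule rat_regular_Fract[OF c(3)])
qed

lemma rat_val_diff:
  assumes "rat_regular c z" "rat_regular d z"
  shows "rat_val (c - d) z = rat_val c z - rat_val d z" "rat_regular (c - d) z"
  using rat_val_add[OF assms(1) rat_val_minus(2)[OF assms(2)]] rat_val_minus(1)[OF assms(2)] by simp_all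

lemmas rat_hom = rat_val_add rat_val_mult rat_val_minus rat_val_diff

definition rat_const :: "complex \<Rightarrow> ratfun" where
  "rat_const k = Fract [:[:k:]:] 1"

lemma rat_val_const [simp]: "rat_val (rat_const k) z = k" "rat_regular (rat_const k) z"
  unfolding rat_const_def rat_val_of_bipoly by (simp_all add: eval2_def rat_val_of_bipoly(2))

lemma rat_const_0: "rat_const 0 = 0"
  by (simp add: rat_const_def Zero_fract_def)

definition regular_set :: "ratfun set \<Rightarrow> (complex \<times> complex) set" where
  "regular_set C = {z. \<forall>c\<in>C. rat_regular c z}"

lemma open_regular_set:
  assumes "finite C"
  shows "open (regular_set C)"
proof -
  have "regular_set C = (\<Inter>c\<in>C. {z \<in> UNIV. rat_regular c z})" by (auto simp: regular_set_def)
  then show ?thesis using assms by (auto intro!: open_INT open_rat_regular[OF open_UNIV, simplified])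
qed

lemma regular_set_nonempty:
  assumes "finite C" "c \<noteq> 0"
  obtains p where "p \<in> regular_set C" "rat_val c p \<noteq> 0"
proof -
  have "eventually (\<lambda>z. (\<forall>c\<in>C. rat_regular c z) \<and> rat_val c z \<noteq> 0) (generic UNIV)"
    by (intro eventually_conj eventually_ball_finite assms ballI eventually_rat_regular eventually_rat_nonzero)
  then obtain p where "(\<forall>c\<in>C. rat_regular c p) \<and> rat_val c p \<noteq> 0"
    using generic_exists[OF _ open_UNIV] by blast
  then show ?thesis using that[of p] by (simp add: regular_set_def)
qed

lemma rational_pfaffian_system:
  assumes int: "rat_d2 a11 - rat_d1 b11 + a12 * b21 - b12 * a21 = 0"
      "rat_d2 a12 - rat_d1 b12 + a11 * b12 + a12 * b22 - b11 * a12 - b12 * a22 = 0"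
      "rat_d2 a21 - rat_d1 b21 + a21 * b11 + a22 * b21 - b21 * a11 - b22 * a21 = 0"
      "rat_d2 a22 - rat_d1 b22 + a21 * b12 - b21 * a12 = 0"
    and C: "finite C" "{a11, a12, a21, a22, b11, b12, b21, b22} \<subseteq> C" and p: "p \<in> regular_set C"
  obtains r v w where "r > 0" "bidisc p r \<subseteq> regular_set C" "hol2 v (bidisc p r)" "hol2 w (bidisc p r)"
    "\<forall>z\<in>bidisc p r. pd1 v z = rat_val a11 z * v z + rat_val a12 z * w z \<and>
       pd1 w z = rat_val a21 z * v z + rat_val a22 z * w z"
    "\<forall>z\<in>bidisc p r. pd2 v z = rat_val b11 z * v z + rat_val b12 z * w z \<and>
       pd2 w z = rat_val b21 z * v z + rat_val b22 z * w z"
    "v p = c" "w p = d"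
proof -
  let ?S = "regular_set C"
  have reg: "rat_regular x z" if "z \<in> ?S" "x \<in> {a11, a12, a21, a22, b11, b12, b21, b22}" for x z
    using that C(2) by (auto simp: regular_set_def)
  have hol: "hol2 (rat_val x) ?S" if "x \<in> {a11, a12, a21, a22, b11, b12, b21, b22}" for x
    by (rule hol2_rat_val[OF open_regular_set[OF C(1)]]) (rule reg[OF _ that])
  show ?thesis
  proof (rule linear_pfaffian_system[of "rat_val a11" ?S "rat_val a12" "rat_val a21" "rat_val a22"
        "rat_val b11" "rat_val b12" "rat_val b21" "rat_val b22" p c d])
    fix z assume z: "z \<in> ?S"
    note regs = reg[OF z, of a11] reg[OF z, of a12] reg[OF z, of a21] reg[OF z, of a22]
      reg[OF z, of b11] reg[OF z, of b12] reg[OF z, of b21] reg[OF z, of b22]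
    show "pd2 (rat_val a11) z - pd1 (rat_val b11) z + rat_val a12 z * rat_val b21 z - rat_val b12 z * rat_val a21 z = 0"
      using arg_cong[OF int(1), of "\<lambda>c. rat_val c z"] regs by (simp add: rat_hom pd_rat_val)
    show "pd2 (rat_val a12) z - pd1 (rat_val b12) z + rat_val a11 z * rat_val b12 z + rat_val a12 z * rat_val b22 z
        - rat_val b11 z * rat_val a12 z - rat_val b12 z * rat_val a22 z = 0"
      using arg_cong[OF int(2), of "\<lambda>c. rat_val c z"] regs by (simp add: rat_hom pd_rat_val)
    show "pd2 (rat_val a21) z - pd1 (rat_val b21) z + rat_val a21 z * rat_val b11 z + rat_val a22 z * rat_val b21 z
        - rat_val b21 z * rat_val a11 z - rat_val b22 z * rat_val a21 z = 0"
      using arg_cong[OF int(3), of "\<lambda>c. rat_val c z"] regs by (simp add: rat_hom pd_rat_val)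
    show "pd2 (rat_val a22) z - pd1 (rat_val b22) z + rat_val a21 z * rat_val b12 z - rat_val b21 z * rat_val a12 z = 0"
      using arg_cong[OF int(4), of "\<lambda>c. rat_val c z"] regs by (simp add: rat_hom pd_rat_val)
  qed (use hol p that in auto)
qed

section \<open>First integrals from rational solutions\<close>

lemma not_constant_on:
  assumes "open S" "p \<in> S" "pd2 u p \<noteq> 0"
  shows "\<not> u constant_on S"
proof
  assume "u constant_on S"
  then obtain c where "\<And>z. z \<in> S \<Longrightarrow> u z = c" unfolding constant_on_def by blast
  then have "pd2 u p = pd2 (\<lambda>_. c) p" by (intro pd_cong(2)[OF assms(1) _ assms(2)])
  with assms(3) show False by (simp add: pd_const)
qed

lemma vf_slope_val:
  assumes "X1 \<noteq> 0" "rat_regular (vf_slope X1 X2) z"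
  shows "eval2 X1 z * rat_val (vf_slope X1 X2) z = eval2 X2 z"
proof -
  have "Fract X1 1 * vf_slope X1 X2 = Fract X2 1"
    using assms(1) by (simp add: vf_slope_def mult_fract eq_fract)
  then have "rat_val (Fract X1 1 * vf_slope X1 X2) z = eval2 X2 z" by (simp add: rat_val_of_bipoly)
  then show ?thesis using rat_val_mult(1)[OF rat_val_of_bipoly(2) assms(2), of X1] by (simp add: rat_val_of_bipoly)
qed

lemma first_integral_bidiscI:
  assumes X1: "X1 \<noteq> 0" and r: "r > 0" and \<omega>: "hol2 \<omega> (bidisc p r)" and nz: "pd2 \<omega> p \<noteq> 0"
    and reg: "\<And>z. z \<in> bidisc p r \<Longrightarrow> rat_regular (vf_slope X1 X2) z"
    and eq: "\<And>z. z \<in> bidisc p r \<Longrightarrow> pd1 \<omega> z = - (rat_val (vf_slope X1 X2) z * pd2 \<omega> z)"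
  shows "first_integral_on X1 X2 \<omega> (bidisc p r)"
proof -
  have p: "p \<in> bidisc p r" by (rule centre_in_bidisc[OF r])
  have "eval2 X1 z * pd1 \<omega> z + eval2 X2 z * pd2 \<omega> z = 0" if z: "z \<in> bidisc p r" for z
    unfolding eq[OF z] vf_slope_val[OF X1 reg[OF z], symmetric] by simp
  then show ?thesis
    unfolding first_integral_on_def nonconst_analytic_on_def
    using hol2_imp_analytic2[OF \<omega>] not_constant_on[OF open_bidisc p nz] p open_bidisc connected_bidisc by auto
qed

text \<open>A system for \<open>\<omega>\<close> and \<open>f = \<delta>\<^sub>2 \<omega>\<close>
  with \<open>\<delta>\<^sub>1 \<omega> = - g f\<close> and \<open>\<delta>\<^sub>2 f = t f\<close>;
  equality of the mixed derivatives of \<open>\<omega>\<close> dictates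
  \<open>\<delta>\<^sub>1 f\<close>, and that of \<open>f\<close> is the assumption on
  \<open>t\<close>. The set \<open>C\<close> lets a caller demand that further rational functions be
  regular on the polydisc.\<close>

lemma first_integral_logarithmic:
  fixes X1 X2 :: bipoly
  assumes X1: "X1 \<noteq> 0" and C: "finite C"
  defines "g \<equiv> vf_slope X1 X2"
  assumes t: "vf_rat g t = - rat_d2 g * t - rat_d2 (rat_d2 g)"
  obtains \<omega> p r where "first_integral_on X1 X2 \<omega> (bidisc p r)" "r > 0" "pd2 \<omega> p \<noteq> 0"
    "bidisc p r \<subseteq> regular_set (C \<union> {g, t, rat_d2 g})" "hol2 \<omega> (bidisc p r)"
    "\<forall>z\<in>bidisc p r. pd2 (pd2 \<omega>) z = rat_val t z * pd2 \<omega> z"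
    "\<forall>z\<in>bidisc p r. pd1 (pd2 \<omega>) z = - rat_val (rat_d2 g + g * t) z * pd2 \<omega> z"
proof -
  note d = derivation_simps[OF is_derivation_rat(1)] derivation_simps[OF is_derivation_rat(2)]
  define C' where "C' = C \<union> {g, t, rat_d2 g} \<union> {0, - g, - (rat_d2 g + g * t), 1}"
  have fin: "finite C'" using C by (simp add: C'_def)
  obtain p where p: "p \<in> regular_set C'" using regular_set_nonempty[OF fin, of 1] by auto
  have key: "rat_d1 t = - rat_d2 g * t - rat_d2 (rat_d2 g) - g * rat_d2 t"
    using t by (simp add: vf_rat_def algebra_simps)
  obtain r \<omega> f where r: "r > 0" "bidisc p r \<subseteq> regular_set C'" "hol2 \<omega> (bidisc p r)" "hol2 f (bidisc p r)"
    and 1: "\<forall>z\<in>bidisc p r. pd1 \<omega> z = rat_val 0 z * \<omega> z + rat_val (- g) z * f z \<and>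
       pd1 f z = rat_val 0 z * \<omega> z + rat_val (- (rat_d2 g + g * t)) z * f z"
    and 2: "\<forall>z\<in>bidisc p r. pd2 \<omega> z = rat_val 0 z * \<omega> z + rat_val 1 z * f z \<and>
       pd2 f z = rat_val 0 z * \<omega> z + rat_val t z * f z"
    and init: "\<omega> p = 0" "f p = 1"
  \<comment> \<open>The initial value 1 for \<open>f\<close> ensures that \<open>\<omega>\<close> is
    not constant.\<close>
  proof (rule rational_pfaffian_system[where C = C' and p = p and c = 0 and d = 1])
    show "rat_d2 0 - rat_d1 0 + - g * 0 - 1 * 0 = (0 :: ratfun)" by (simp add: d)
    show "rat_d2 (- g) - rat_d1 1 + 0 * 1 + - g * t - 0 * - g - 1 * - (rat_d2 g + g * t) = 0"
      by (simp add: d)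
    show "rat_d2 0 - rat_d1 0 + 0 * 0 + - (rat_d2 g + g * t) * 0 - 0 * 0 - t * 0 = (0 :: ratfun)" by (simp add: d)
    show "rat_d2 (- (rat_d2 g + g * t)) - rat_d1 t + 0 * 1 - 0 * - g = 0"
      by (simp add: d key algebra_simps)
  qed (use fin p in \<open>auto simp: C'_def\<close>)
  have sub: "bidisc p r \<subseteq> regular_set (C \<union> {g, t, rat_d2 g})"
    using r(2) by (auto simp: regular_set_def C'_def)
  have reg: "rat_regular g z" "rat_regular t z" "rat_regular (rat_d2 g) z" if "z \<in> bidisc p r" for z
    using sub that by (auto simp: regular_set_def)
  have pd2\<omega>: "pd2 \<omega> z = f z" if "z \<in> bidisc p r" for z using 2 that by simp
  have pin: "p \<in> bidisc p r" by (rule centre_in_bidisc[OF r(1)])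
  show ?thesis
  proof (rule that[OF _ r(1) _ sub r(3)])
    show nz: "pd2 \<omega> p \<noteq> 0" using pd2\<omega>[OF pin] init by simp
    show "first_integral_on X1 X2 \<omega> (bidisc p r)"
    proof (rule first_integral_bidiscI[OF X1 r(1) r(3) nz])
      show "pd1 \<omega> z = - (rat_val (vf_slope X1 X2) z * pd2 \<omega> z)" if "z \<in> bidisc p r" for z
        using 1 pd2\<omega> that reg(1)[OF that] by (simp add: rat_val_minus g_def[symmetric])
    qed (use reg in \<open>auto simp: g_def\<close>)
    show "\<forall>z\<in>bidisc p r. pd2 (pd2 \<omega>) z = rat_val t z * pd2 \<omega> z"
    proof
      fix z assume z: "z \<in> bidisc p r"
      have "pd2 (pd2 \<omega>) z = pd2 f z" by (rule pd_cong(2)[OF open_bidisc pd2\<omega> z])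
      then show "pd2 (pd2 \<omega>) z = rat_val t z * pd2 \<omega> z" using 2 z by simp
    qed
    show "\<forall>z\<in>bidisc p r. pd1 (pd2 \<omega>) z = - rat_val (rat_d2 g + g * t) z * pd2 \<omega> z"
    proof
      fix z assume z: "z \<in> bidisc p r"
      have "pd1 (pd2 \<omega>) z = pd1 f z" by (rule pd_cong(1)[OF open_bidisc pd2\<omega> z])
      then show "pd1 (pd2 \<omega>) z = - rat_val (rat_d2 g + g * t) z * pd2 \<omega> z"
        using 1 z pd2\<omega>[OF z] reg[OF z] by (simp add: rat_val_minus rat_hom)
    qed
  qed
qed

lemma pd_power_eigen:
  assumes f: "hol2 f S" and z: "z \<in> S"
  shows "pd1 f z = l * f z \<Longrightarrow> pd1 (\<lambda>z. f z ^ n) z = of_nat n * l * f z ^ n"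
    "pd2 f z = l * f z \<Longrightarrow> pd2 (\<lambda>z. f z ^ n) z = of_nat n * l * f z ^ n"
proof (induction n)
  case (Suc n)
  { case 1
    then show ?case using Suc.IH(1) pd_mult(1)[OF f hol2_power[OF f, of n] z] by (simp add: algebra_simps)
  next
    case 2
    then show ?case using Suc.IH(2) pd_mult(2)[OF f hol2_power[OF f, of n] z] by (simp add: algebra_simps) }
qed (simp_all add: pd_const)

text \<open>For the first integral belonging to the logarithmic derivative \<open>t\<close> of the
  n-th root of \<open>\<beta>\<close>, both partial derivatives of
  \<open>(\<delta>\<^sub>2 \<omega>)\<^sup>n / \<beta>\<close> vanish, so the quotient is a
  constant.\<close>

lemma first_integral_radical:
  fixes X1 X2 :: bipoly
  assumes X1: "X1 \<noteq> 0"
  defines "g \<equiv> vf_slope X1 X2"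
  assumes semi: "semi_invariant (vf_rat g) (rat_d2 g)"
  shows "\<exists>\<omega> \<Omega>. first_integral_on X1 X2 \<omega> \<Omega> \<and> (\<exists>n::nat. n > 0 \<and> rational_on (\<lambda>z. (pd2 \<omega> z) ^ n) \<Omega>)"
proof -
  obtain \<beta> n where \<beta>: "\<beta> \<noteq> 0" "n > (0 :: nat)" "vf_rat g \<beta> = - of_nat n * rat_d2 g * \<beta>"
    using semi_invariant_field[OF is_derivation_vf_rat semi] by metis
  define t where "t = rat_d2 \<beta> / (of_nat n * \<beta>)"
  have t: "vf_rat g t = - rat_d2 g * t - rat_d2 (rat_d2 g)"
    unfolding t_def by (rule log_derivative_solution[OF is_derivation_vf_rat is_derivation_rat(2) vf_rat_commute \<beta>])
  \<comment> \<open>Working with the inverse in \<open>K\<close> turns the quotient into a product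
    and spares the discussion of zeros of \<open>\<beta>\<close>.\<close>
  define \<alpha> where "\<alpha> = inverse \<beta>"
  have \<alpha>\<beta>: "\<alpha> * \<beta> = 1" using \<beta>(1) by (simp add: \<alpha>_def)
  have d\<beta>: "rat_d2 \<beta> = of_nat n * t * \<beta>" using \<beta>(1,2) by (simp add: t_def)
  have d1\<beta>: "rat_d1 \<beta> = - of_nat n * (rat_d2 g + g * t) * \<beta>"
    using \<beta>(3) d\<beta> by (simp add: vf_rat_def algebra_simps eq_neg_iff_add_eq_0)
  have inv: "d \<alpha> = - x * \<alpha>" if "is_derivation d" "d \<beta> = x * \<beta>" for d x
  proof -
    have "d (\<alpha> * \<beta>) = 0" unfolding \<alpha>\<beta> by (rule derivation_1[OF that(1)])
    then have "d \<alpha> * \<beta> = - x * \<alpha> * \<beta>"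
      by (simp add: derivation_mult[OF that(1)] that(2) eq_neg_iff_add_eq_0 mult_ac)
    then show ?thesis using \<beta>(1) by (metis mult_cancel_right)
  qed
  have d\<alpha>: "rat_d2 \<alpha> = - (of_nat n * t) * \<alpha>" by (rule inv[OF is_derivation_rat(2) d\<beta>])
  have d1\<alpha>: "rat_d1 \<alpha> = - (- of_nat n * (rat_d2 g + g * t)) * \<alpha>" by (rule inv[OF is_derivation_rat(1) d1\<beta>])
  obtain \<omega> p r where \<omega>: "first_integral_on X1 X2 \<omega> (bidisc p r)" "r > 0"
    and sub: "bidisc p r \<subseteq> regular_set ({\<alpha>, \<beta>} \<union> {g, t, rat_d2 g})" and hol: "hol2 \<omega> (bidisc p r)"
    and e2: "\<And>z. z \<in> bidisc p r \<Longrightarrow> pd2 (pd2 \<omega>) z = rat_val t z * pd2 \<omega> z"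
    and e1: "\<And>z. z \<in> bidisc p r \<Longrightarrow> pd1 (pd2 \<omega>) z = - rat_val (rat_d2 g + g * t) z * pd2 \<omega> z"
  proof (rule first_integral_logarithmic[OF X1, of "{\<alpha>, \<beta>}" X2 t])
    show "vf_rat (vf_slope X1 X2) t = - rat_d2 (vf_slope X1 X2) * t - rat_d2 (rat_d2 (vf_slope X1 X2))"
      using t by (simp add: g_def)
  qed (auto simp: g_def)
  let ?B = "bidisc p r"
  have reg: "rat_regular \<alpha> z" "rat_regular \<beta> z" "rat_regular g z" "rat_regular t z" "rat_regular (rat_d2 g) z"
    if "z \<in> ?B" for z using sub that by (auto simp: regular_set_def)
  have regn: "rat_regular (of_nat k) z" "rat_val (of_nat k) z = of_nat k" for k z
    by (induction k) (simp_all add: rat_hom rat_regular_0 rat_regular_1)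
  have h\<alpha>: "hol2 (rat_val \<alpha>) ?B" by (rule hol2_rat_val[OF open_bidisc reg(1)])
  note hf = hol2_pd2[OF hol]
  have "(\<lambda>z. pd2 \<omega> z ^ n * rat_val \<alpha> z) constant_on ?B"
  proof (rule hol2_constant[OF _ connected_bidisc])
    show "hol2 (\<lambda>z. pd2 \<omega> z ^ n * rat_val \<alpha> z) ?B" by (intro hol2_mult hol2_power hf h\<alpha>)
    fix z assume z: "z \<in> ?B"
    note regs = reg[OF z] regn
    have "pd1 (rat_val \<alpha>) z = of_nat n * rat_val (rat_d2 g + g * t) z * rat_val \<alpha> z"
      using regs by (simp add: pd_rat_val d1\<alpha> rat_hom)
    then show "pd1 (\<lambda>z. pd2 \<omega> z ^ n * rat_val \<alpha> z) z = 0"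
      using pd_mult(1)[OF hol2_power[OF hf] h\<alpha> z, of n] pd_power_eigen(1)[OF hf z e1[OF z], of n] by simp
    have "pd2 (rat_val \<alpha>) z = - of_nat n * rat_val t z * rat_val \<alpha> z"
      using regs by (simp add: pd_rat_val d\<alpha> rat_hom)
    then show "pd2 (\<lambda>z. pd2 \<omega> z ^ n * rat_val \<alpha> z) z = 0"
      using pd_mult(2)[OF hol2_power[OF hf] h\<alpha> z, of n] pd_power_eigen(2)[OF hf z e2[OF z], of n] by simp
  qed
  then obtain k where k: "\<And>z. z \<in> ?B \<Longrightarrow> pd2 \<omega> z ^ n * rat_val \<alpha> z = k" unfolding constant_on_def by blast
  have "pd2 \<omega> z ^ n = rat_val (rat_const k * \<beta>) z" if z: "z \<in> ?B" for z
  proof -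
    have "rat_val \<alpha> z * rat_val \<beta> z = 1"
      using rat_val_mult(1)[OF reg(1,2)[OF z]] \<alpha>\<beta> by simp
    then have "pd2 \<omega> z ^ n = k * rat_val \<beta> z"
      unfolding k[OF z, symmetric] by (simp add: mult.assoc)
    then show ?thesis using rat_val_mult(1)[OF rat_val_const(2) reg(2)[OF z], of k] by simp
  qed
  then have "rational_on (\<lambda>z. (pd2 \<omega> z) ^ n) ?B"
    unfolding rational_on_def using centre_in_bidisc[OF \<omega>(2)] by blast
  then show ?thesis using \<omega>(1) \<beta>(2) by blast
qed

lemma first_integral_exponential:
  fixes X1 X2 :: bipoly
  assumes X1: "X1 \<noteq> 0"
  defines "g \<equiv> vf_slope X1 X2"
  assumes t: "vf_rat g t = - rat_d2 g * t - rat_d2 (rat_d2 g)"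
  shows "\<exists>\<omega> \<Omega>. first_integral_on X1 X2 \<omega> \<Omega> \<and>
           rational_on (\<lambda>z. (pd2 ^^ 2) \<omega> z / pd2 \<omega> z) {z \<in> \<Omega>. pd2 \<omega> z \<noteq> 0}"
proof -
  obtain \<omega> p r where \<omega>: "first_integral_on X1 X2 \<omega> (bidisc p r)" "r > 0" "pd2 \<omega> p \<noteq> 0"
    and e2: "\<forall>z\<in>bidisc p r. pd2 (pd2 \<omega>) z = rat_val t z * pd2 \<omega> z"
    by (rule first_integral_logarithmic[OF X1 finite.emptyI t[unfolded g_def]])
  have "(pd2 ^^ 2) \<omega> z / pd2 \<omega> z = rat_val t z" if "z \<in> bidisc p r" "pd2 \<omega> z \<noteq> 0" for z
    using that e2 by (simp add: numeral_2_eq_2)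
  then have "rational_on (\<lambda>z. (pd2 ^^ 2) \<omega> z / pd2 \<omega> z) {z \<in> bidisc p r. pd2 \<omega> z \<noteq> 0}"
    unfolding rational_on_def using \<omega>(3) centre_in_bidisc[OF \<omega>(2)] by blast
  then show ?thesis using \<omega>(1) by blast
qed

text \<open>A first integral is obtained as a quotient of two solutions \<open>v\<close> of \<open>\<delta>\<^sub>2\<^sup>2 v = - (t / 4) v\<close>.\<close>

lemma first_integral_projective:
  fixes X1 X2 :: bipoly
  assumes X1: "X1 \<noteq> 0"
  defines "g \<equiv> vf_slope X1 X2"
  assumes t: "vf_rat g t = - 2 * rat_d2 g * t - 2 * rat_d2 (rat_d2 (rat_d2 g))"
  shows "\<exists>\<omega> \<Omega>. first_integral_on X1 X2 \<omega> \<Omega> \<and>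
           rational_on
             (\<lambda>z. (2 * pd2 \<omega> z * (pd2 ^^ 3) \<omega> z - 3 * ((pd2 ^^ 2) \<omega> z)\<^sup>2) / (pd2 \<omega> z)\<^sup>2)
             {z \<in> \<Omega>. pd2 \<omega> z \<noteq> 0}"
proof -
  \<comment> \<open>The solutions behave like \<open>(\<delta>\<^sub>2 \<omega>)\<close> to the
    power \<open>- 1 / 2\<close>, hence \<open>D v = (c1 / 2) v\<close>, which explains
    \<open>\<kappa>\<close>. Quotients of solutions of
    \<open>\<delta>\<^sub>2\<^sup>2 v = - \<tau> v\<close> have \<open>4 * \<tau>\<close> as twice
    their Schwarzian derivative.\<close>
  define \<kappa> \<tau> where "\<kappa> = rat_d2 g / 2" and "\<tau> = t / 4"
  have \<kappa>: "rat_d2 g = 2 * \<kappa>" and \<tau>: "t = 4 * \<tau>" by (simp_all add: \<kappa>_def \<tau>_def)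
  note d = derivation_simps[OF is_derivation_rat(1)] derivation_simps[OF is_derivation_rat(2)]
  have "4 * vf_rat g \<tau> = 4 * (- 4 * \<kappa> * \<tau> - rat_d2 (rat_d2 \<kappa>))"
    using t unfolding \<tau> \<kappa>
    by (simp add: derivation_mult[OF is_derivation_vf_rat] derivation_numeral[OF is_derivation_vf_rat] d)
  then have "vf_rat g \<tau> = - 4 * \<kappa> * \<tau> - rat_d2 (rat_d2 \<kappa>)"
    by (rule mult_left_cancel[THEN iffD1, rotated]) simp
  then have key: "rat_d1 \<tau> = - 4 * \<kappa> * \<tau> - rat_d2 (rat_d2 \<kappa>) - g * rat_d2 \<tau>"
    by (simp add: vf_rat_def eq_diff_eq)
  define C where "C = {g, \<tau>, \<kappa>, - g, rat_d2 \<kappa> + g * \<tau>, - \<kappa>, 0, 1, - \<tau>}"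
  have int: "rat_d2 \<kappa> - rat_d1 0 + - g * - \<tau> - 1 * (rat_d2 \<kappa> + g * \<tau>) = 0"
      "rat_d2 (- g) - rat_d1 1 + \<kappa> * 1 + - g * 0 - 0 * - g - 1 * - \<kappa> = 0"
      "rat_d2 (rat_d2 \<kappa> + g * \<tau>) - rat_d1 (- \<tau>) + (rat_d2 \<kappa> + g * \<tau>) * 0 + - \<kappa> * - \<tau>
         - - \<tau> * \<kappa> - 0 * (rat_d2 \<kappa> + g * \<tau>) = 0"
      "rat_d2 (- \<kappa>) - rat_d1 0 + (rat_d2 \<kappa> + g * \<tau>) * 1 - - \<tau> * - g = 0"
    by (simp_all add: d \<kappa> key algebra_simps)
  have fin: "finite C" by (simp add: C_def)
  obtain p where p: "p \<in> regular_set C" using regular_set_nonempty[OF fin, of 1] by auto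
  have sol: "\<exists>r v w. r > 0 \<and> bidisc p r \<subseteq> regular_set C \<and> hol2 v (bidisc p r) \<and> hol2 w (bidisc p r) \<and>
      (\<forall>z\<in>bidisc p r. pd1 v z = rat_val \<kappa> z * v z + rat_val (- g) z * w z \<and>
        pd2 v z = w z \<and> pd2 w z = - rat_val \<tau> z * v z) \<and> v p = a \<and> w p = b" for a b
  proof -
    obtain r v w where vw: "r > 0" "bidisc p r \<subseteq> regular_set C" "hol2 v (bidisc p r)" "hol2 w (bidisc p r)"
      "\<forall>z\<in>bidisc p r. pd1 v z = rat_val \<kappa> z * v z + rat_val (- g) z * w z \<and>
         pd1 w z = rat_val (rat_d2 \<kappa> + g * \<tau>) z * v z + rat_val (- \<kappa>) z * w z"
      "\<forall>z\<in>bidisc p r. pd2 v z = rat_val 0 z * v z + rat_val 1 z * w z \<and>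
         pd2 w z = rat_val (- \<tau>) z * v z + rat_val 0 z * w z" "v p = a" "w p = b"
      by (rule rational_pfaffian_system[OF int fin _ p]) (auto simp: C_def)
    have "rat_regular \<tau> z" if "z \<in> bidisc p r" for z
      using vw(2) that by (auto simp: regular_set_def C_def)
    with vw show ?thesis by (intro exI[of _ r] exI[of _ v] exI[of _ w]) (auto simp: rat_val_minus)
  qed
  \<comment> \<open>Initial data \<open>(1, 0)\<close> and \<open>(0, 1)\<close>: the denominator is
    nonzero near \<open>p\<close>, and the Wronskian is 1 at \<open>p\<close>.\<close>
  obtain r1 v w where v: "r1 > 0" "bidisc p r1 \<subseteq> regular_set C" "hol2 v (bidisc p r1)" "hol2 w (bidisc p r1)"
    and v_eq: "\<And>z. z \<in> bidisc p r1 \<Longrightarrow> pd1 v z = rat_val \<kappa> z * v z + rat_val (- g) z * w z"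
      "\<And>z. z \<in> bidisc p r1 \<Longrightarrow> pd2 v z = w z" "\<And>z. z \<in> bidisc p r1 \<Longrightarrow> pd2 w z = - rat_val \<tau> z * v z"
    and v_init: "v p = 1" "w p = 0"
    using sol[of 1 0] by blast
  obtain r2 x y where x: "r2 > 0" "bidisc p r2 \<subseteq> regular_set C" "hol2 x (bidisc p r2)" "hol2 y (bidisc p r2)"
    and x_eq: "\<And>z. z \<in> bidisc p r2 \<Longrightarrow> pd1 x z = rat_val \<kappa> z * x z + rat_val (- g) z * y z"
      "\<And>z. z \<in> bidisc p r2 \<Longrightarrow> pd2 x z = y z" "\<And>z. z \<in> bidisc p r2 \<Longrightarrow> pd2 y z = - rat_val \<tau> z * x z"
    and x_init: "x p = 0" "y p = 1"
    using sol[of 0 1] by blast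
  define N where "N = {z \<in> bidisc p r1 \<inter> bidisc p r2. v z \<noteq> 0}"
  have "N = (bidisc p r1 \<inter> bidisc p r2) \<inter> v -` (- {0})" by (auto simp: N_def)
  moreover have "open ((bidisc p r1 \<inter> bidisc p r2) \<inter> v -` (- {0}))"
    by (rule continuous_open_preimage)
      (auto intro: open_bidisc open_Compl continuous_on_subset[OF hol2_continuous[OF v(3)]])
  ultimately have N: "open N" by simp
  have pN: "p \<in> N" using centre_in_bidisc v(1) x(1) v_init by (simp add: N_def)
  obtain r where r: "r > 0" "bidisc p r \<subseteq> N" using bidisc_in_open[OF N pN] .
  let ?B = "bidisc p r"
  have B: "z \<in> bidisc p r1" "z \<in> bidisc p r2" "v z \<noteq> 0" if "z \<in> ?B" for z
    using that r(2) by (auto simp: N_def)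
  have pB: "p \<in> ?B" by (rule centre_in_bidisc[OF r(1)])
  have reg: "rat_regular g z" "rat_regular \<tau> z" if "z \<in> ?B" for z
    using v(2) B(1)[OF that] by (auto simp: regular_set_def C_def)
  have sub: "?B \<subseteq> bidisc p r1" "?B \<subseteq> bidisc p r2" using B by auto
  note hv = hol2_subset[OF v(3) sub(1) open_bidisc] and hw = hol2_subset[OF v(4) sub(1) open_bidisc]
    and hx = hol2_subset[OF x(3) sub(2) open_bidisc] and hy = hol2_subset[OF x(4) sub(2) open_bidisc]
  \<comment> \<open>The Wronskian of the two solutions in \<open>x\<^sub>2\<close>; it does not
    depend on \<open>x\<^sub>2\<close>, and
    \<open>\<delta>\<^sub>2 \<omega> = W / v\<^sup>2\<close>.\<close>
  define W where "W z = v z * y z + (- 1) * (x z * w z)" for z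
  have hW: "hol2 W ?B" unfolding W_def[abs_def]
    by (intro hol2_add hol2_mult hol2_const hv hw hx hy open_bidisc)
  have pW: "pd2 W z = 0" if z: "z \<in> ?B" for z
  proof -
    note hxw = hol2_mult[OF hx hw] and hvy = hol2_mult[OF hv hy]
    have "pd2 W z = pd2 (\<lambda>z. v z * y z) z + pd2 (\<lambda>z. (- 1) * (x z * w z)) z"
      unfolding W_def[abs_def] by (rule pd_add(2)[OF hvy hol2_mult[OF hol2_const[OF open_bidisc] hxw] z])
    then show ?thesis
      using B[OF z] unfolding pd_mult(2)[OF hol2_const[OF open_bidisc] hxw z] pd_mult(2)[OF hx hw z]
        pd_mult(2)[OF hv hy z]
      by (simp add: pd_const v_eq x_eq algebra_simps)
  qed
  define \<omega> where "\<omega> z = x z / v z" for z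
  have h\<omega>: "hol2 \<omega> ?B" unfolding \<omega>_def[abs_def] by (rule hol2_divide[OF hx hv B(3)])
  have \<omega>1: "pd2 \<omega> z = W z / (v z * v z)" if z: "z \<in> ?B" for z
    unfolding \<omega>_def[abs_def] pd_divide(2)[where S = ?B, OF hx hv z B(3)[OF z]]
    using B[OF z] by (simp add: v_eq x_eq W_def algebra_simps)
  have \<omega>2: "pd2 (pd2 \<omega>) z = (- 2) * (W z * w z) / (v z * (v z * v z))" if z: "z \<in> ?B" for z
  proof -
    have nz: "v z * v z \<noteq> 0" using B[OF z] by simp
    have "pd2 (pd2 \<omega>) z = pd2 (\<lambda>z. W z / (v z * v z)) z" by (rule pd_cong(2)[OF open_bidisc \<omega>1 z])
    also have "\<dots> = (- 2) * (W z * w z) / (v z * (v z * v z))"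
      unfolding pd_divide(2)[where S = ?B, OF hW hol2_mult[OF hv hv] z nz] pd_mult(2)[OF hv hv z]
      using B[OF z] by (simp add: v_eq pW[OF z] field_simps)
    finally show ?thesis .
  qed
  have \<omega>3: "pd2 (pd2 (pd2 \<omega>)) z = (2 * rat_val \<tau> z * W z * v z * v z + 6 * W z * w z * w z) / (v z ^ 4)" if z: "z \<in> ?B" for z
  proof -
    note hv3 = hol2_mult[OF hv hol2_mult[OF hv hv]] and hWw = hol2_mult[OF hW hw]
    have nz: "v z * (v z * v z) \<noteq> 0" using B[OF z] by simp
    have "pd2 (pd2 (pd2 \<omega>)) z = pd2 (\<lambda>z. (- 2) * (W z * w z) / (v z * (v z * v z))) z"
      by (rule pd_cong(2)[OF open_bidisc \<omega>2 z])
    also have "\<dots> = (2 * rat_val \<tau> z * W z * v z * v z + 6 * W z * w z * w z) / (v z ^ 4)"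
      unfolding pd_divide(2)[where S = ?B, OF hol2_mult[OF hol2_const[OF open_bidisc] hWw] hv3 z nz]
        pd_mult(2)[OF hol2_const[OF open_bidisc] hWw z] pd_mult(2)[OF hW hw z]
        pd_mult(2)[OF hv hol2_mult[OF hv hv] z] pd_mult(2)[OF hv hv z]
      using B[OF z] by (simp add: v_eq pW[OF z] pd_const field_simps power4_eq_xxxx)
    finally show ?thesis .
  qed
  have "first_integral_on X1 X2 \<omega> ?B"
  proof (rule first_integral_bidiscI[OF X1 r(1) h\<omega>])
    show nz: "pd2 \<omega> p \<noteq> 0" using \<omega>1[OF pB] v_init x_init by (simp add: W_def)
    show "rat_regular (vf_slope X1 X2) z" if "z \<in> ?B" for z using reg(1)[OF that] by (simp add: g_def)
    show "pd1 \<omega> z = - (rat_val (vf_slope X1 X2) z * pd2 \<omega> z)" if z: "z \<in> ?B" for z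
    proof -
      have num: "pd1 x z * v z - x z * pd1 v z = - (rat_val g z * W z)"
        using B[OF z] reg[OF z] by (simp add: v_eq x_eq rat_val_minus W_def algebra_simps)
      show ?thesis
        unfolding \<omega>1[OF z] unfolding \<omega>_def[abs_def] pd_divide(1)[where S = ?B, OF hx hv z B(3)[OF z]]
          g_def[symmetric] num by simp
    qed
  qed
  moreover have "rational_on (\<lambda>z. (2 * pd2 \<omega> z * (pd2 ^^ 3) \<omega> z - 3 * ((pd2 ^^ 2) \<omega> z)\<^sup>2) / (pd2 \<omega> z)\<^sup>2)
      {z \<in> ?B. pd2 \<omega> z \<noteq> 0}"
    unfolding rational_on_def
  proof (intro conjI exI[of _ t] ballI impI)
    have "pd2 \<omega> p \<noteq> 0" using \<omega>1[OF pB] v_init x_init by (simp add: W_def)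
    then show "{z \<in> ?B. pd2 \<omega> z \<noteq> 0} \<noteq> {}" using pB by blast
    fix z assume "z \<in> {z \<in> ?B. pd2 \<omega> z \<noteq> 0}"
    then have z: "z \<in> ?B" and nz: "pd2 \<omega> z \<noteq> 0" by auto
    then have W0: "W z \<noteq> 0" using \<omega>1[OF z] by auto
    have t_val: "rat_val t z = 4 * rat_val \<tau> z"
    proof -
      have "t = \<tau> + \<tau> + (\<tau> + \<tau>)" unfolding \<tau> by simp
      then have "rat_val t z = rat_val (\<tau> + \<tau> + (\<tau> + \<tau>)) z" by (rule arg_cong)
      also have "\<dots> = 4 * rat_val \<tau> z"
        using reg(2)[OF z] rat_val_add[OF reg(2)[OF z] reg(2)[OF z]] by (simp only: rat_val_add) simp
      finally show ?thesis .
    qed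
    show "(2 * pd2 \<omega> z * (pd2 ^^ 3) \<omega> z - 3 * ((pd2 ^^ 2) \<omega> z)\<^sup>2) / (pd2 \<omega> z)\<^sup>2 = rat_val t z"
      unfolding t_val numeral_3_eq_3 numeral_2_eq_2 funpow.simps o_def id_def
      unfolding \<omega>3[OF z] \<omega>2[OF z] \<omega>1[OF z]
      using B(3)[OF z] W0 by (simp add: field_simps power4_eq_xxxx power2_eq_square numeral_2_eq_2[symmetric])
  qed
  ultimately show ?thesis by blast
qed

subsection \<open>Orders of expansions\<close>

lemma hol2_zero: "hol2 (\<lambda>z. 0) UNIV"
  by (rule hol2_const[OF open_UNIV])

lemma gen_subset_annihilator:
  assumes "hol2 u S" "\<And>z. z \<in> S \<Longrightarrow> eval2 X1 z * pd1 u z + eval2 X2 z * pd2 u z = 0"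
  shows "diff_ideal_gen {vf_dpoly X1 X2} \<subseteq> annihilator u S"
  using vf_in_annihilator_iff[OF assms(1)] assms(2)
  by (intro diff_ideal_gen_least differential_ideal_annihilator[OF assms(1)]) auto

text \<open>That \<open>{X}\<close> is a proper ideal is seen from the zero function, which
  satisfies every equation of \<open>{X}\<close> but not the equation 1 = 0.\<close>

lemma nontrivial_expansion_UNIV: "nontrivial_expansion X1 X2 UNIV"
proof -
  have "diff_ideal_gen {vf_dpoly X1 X2} \<subseteq> annihilator (\<lambda>z. 0) UNIV"
    by (rule gen_subset_annihilator[OF hol2_zero]) (simp add: pd_const)
  moreover have "dconst 1 \<notin> annihilator (\<lambda>z. 0) UNIV"
    by (rule one_not_in_annihilator) auto
  ultimately have "diff_ideal_gen {vf_dpoly X1 X2} \<subset> UNIV" by blast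
  then show ?thesis unfolding nontrivial_expansion_def expansion_def
    by (simp add: differential_ideal_def)
qed

lemma expansion_ord_UNIV: "expansion_ord UNIV = \<infinity>"
proof -
  have 1: "occurring 1 = {}" using occurring_dconst[of 1] by (simp add: dconst_1)
  have low: "occurring A = {}" if "lowest_rank_in A UNIV" for A
    using that 1 unfolding lowest_rank_in_def lower_rank_def by (metis UNIV_I one_neq_zero)
  have "lowest_rank_in 1 UNIV" unfolding lowest_rank_in_def lower_rank_def using 1 by simp
  then show ?thesis unfolding expansion_ord_def
    by (intro the_equality) (use 1 low in \<open>auto intro!: exI[of _ 1]\<close>)
qed

lemma operator_ord_le: "nontrivial_expansion X1 X2 \<Lambda> \<Longrightarrow> operator_ord X1 X2 \<le> expansion_ord \<Lambda>"
  unfolding operator_ord_def by (intro Least_le) blast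

lemma hol2_if_nonconst_analytic: "nonconst_analytic_on \<omega> \<Omega> \<Longrightarrow> hol2 \<omega> \<Omega>"
  unfolding nonconst_analytic_on_def by (auto intro: analytic2_imp_hol2)

text \<open>The least order is attained because the unit ideal is always a candidate; a finite value
  shows that the minimal expansion is not the unit ideal and hence has a non-constant
  solution.\<close>

lemma operator_ord_attained:
  assumes "X1 \<noteq> 0" "operator_ord X1 X2 = enat n"
  obtains \<Lambda> \<omega> \<Omega> A where "differential_ideal \<Lambda>" "vf_dpoly X1 X2 \<in> \<Lambda>" "diff_ideal_gen {vf_dpoly X1 X2} \<subset> \<Lambda>"
    "nonconst_analytic_on \<omega> \<Omega>" "\<Lambda> \<subseteq> annihilator \<omega> \<Omega>"
    "A \<in> \<Lambda>" "A \<noteq> 0" "occurring A \<subseteq> {0} \<times> {..n}"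
    "\<And>B. B \<in> \<Lambda> \<Longrightarrow> B \<noteq> 0 \<Longrightarrow> \<not> occurring B \<subseteq> {0} \<times> {..<n}"
proof -
  have "\<exists>r \<Lambda>. nontrivial_expansion X1 X2 \<Lambda> \<and> expansion_ord \<Lambda> = r"
    by (rule exI, rule exI, rule conjI[OF nontrivial_expansion_UNIV refl])
  from LeastI_ex[OF this] obtain \<Lambda> where \<Lambda>: "nontrivial_expansion X1 X2 \<Lambda>" "expansion_ord \<Lambda> = enat n"
    unfolding operator_ord_def[symmetric] assms(2) by (elim exE conjE)
  have ne: "\<Lambda> \<noteq> UNIV"
  proof
    assume "\<Lambda> = UNIV"
    then show False using \<Lambda>(2) expansion_ord_UNIV by simp
  qed
  have e: "expansion X1 X2 \<Lambda>" using \<Lambda>(1) by (simp add: nontrivial_expansion_def)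
  obtain \<omega> \<Omega> where \<omega>: "nonconst_analytic_on \<omega> \<Omega>" "\<And>A. A \<in> \<Lambda> \<Longrightarrow> satisfies_on \<omega> A \<Omega>"
    using conjunct2[OF \<Lambda>(1)[unfolded nontrivial_expansion_def]] ne by metis
  obtain k A where A: "expansion_ord \<Lambda> = enat k" "A \<in> \<Lambda>" "A \<noteq> 0" "occurring A \<subseteq> {0} \<times> {..k}"
    and min: "\<And>B. B \<in> \<Lambda> \<Longrightarrow> B \<noteq> 0 \<Longrightarrow> \<not> occurring B \<subseteq> {0} \<times> {..<k}"
    by (rule expansion_order[OF assms(1) e ne]) blast
  have k: "k = n" using A(1) \<Lambda>(2) by simp
  show thesis
  proof (rule that[OF _ _ _ \<omega>(1) _ A(2,3)])
    show "differential_ideal \<Lambda>" and sub: "diff_ideal_gen {vf_dpoly X1 X2} \<subset> \<Lambda>"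
      using e by (auto simp: expansion_def)
    then show "vf_dpoly X1 X2 \<in> \<Lambda>" using in_diff_ideal_gen[of "vf_dpoly X1 X2"] by auto
    show "\<Lambda> \<subseteq> annihilator \<omega> \<Omega>"
      using \<omega>(2) annihilator_iff_satisfies[OF hol2_if_nonconst_analytic[OF \<omega>(1)]] by blast
    show "occurring A \<subseteq> {0} \<times> {..n}" using A(4) unfolding k .
    show "\<not> occurring B \<subseteq> {0} \<times> {..<n}" if "B \<in> \<Lambda>" "B \<noteq> 0" for B
      using min[OF that] unfolding k .
  qed
qed

lemma annihilator_nontrivial_expansion:
  assumes \<omega>: "nonconst_analytic_on \<omega> \<Omega>" and sub: "diff_ideal_gen {vf_dpoly X1 X2} \<subset> annihilator \<omega> \<Omega>"
  shows "nontrivial_expansion X1 X2 (annihilator \<omega> \<Omega>)" "annihilator \<omega> \<Omega> \<noteq> UNIV"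
proof -
  note h = hol2_if_nonconst_analytic[OF \<omega>]
  show "nontrivial_expansion X1 X2 (annihilator \<omega> \<Omega>)"
    unfolding nontrivial_expansion_def expansion_def
    using differential_ideal_annihilator[OF h] sub \<omega> annihilator_iff_satisfies[OF h] by blast
  have "dconst 1 \<notin> annihilator \<omega> \<Omega>"
    by (rule one_not_in_annihilator) (use \<omega> in \<open>auto simp: nonconst_analytic_on_def\<close>)
  then show "annihilator \<omega> \<Omega> \<noteq> UNIV" by blast
qed

text \<open>If \<open>\<delta>\<^sub>2 \<omega>\<close> vanished identically, so would
  \<open>X1 \<delta>\<^sub>1 \<omega>\<close>, and \<open>\<omega>\<close> would be constant because
  \<open>X1\<close> is nonzero generically.\<close>

lemma first_integral_pd2_nonzero:
  assumes X1: "X1 \<noteq> 0" and \<omega>: "nonconst_analytic_on \<omega> \<Omega>"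
    and eq: "\<And>z. z \<in> \<Omega> \<Longrightarrow> eval2 X1 z * pd1 \<omega> z + eval2 X2 z * pd2 \<omega> z = 0"
  obtains p where "p \<in> \<Omega>" "pd2 \<omega> p \<noteq> 0"
proof (rule ccontr)
  assume "\<not> thesis"
  then have 2: "pd2 \<omega> z = 0" if "z \<in> \<Omega>" for z using that \<open>\<And>p. p \<in> \<Omega> \<Longrightarrow> pd2 \<omega> p \<noteq> 0 \<Longrightarrow> thesis\<close> by blast
  note h = hol2_if_nonconst_analytic[OF \<omega>]
  have "eventually (\<lambda>z. pd1 \<omega> z = 0) (generic \<Omega>)"
    unfolding eventually_generic using X1 eq 2 by (intro exI[of _ X1]) force
  from generic_zero_imp_zero[OF this hol2_open[OF h] subset_refl hol2_continuous[OF hol2_pd1[OF h]]]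
  have "\<omega> constant_on \<Omega>"
    using \<omega> by (intro hol2_constant[OF h] 2) (auto simp: nonconst_analytic_on_def)
  then show False using \<omega> by (simp add: nonconst_analytic_on_def)
qed

lemma eventually_generic_subset:
  "eventually P (generic S) \<Longrightarrow> T \<subseteq> S \<Longrightarrow> eventually P (generic T)"
  unfolding eventually_generic by blast

lemma eventually_diff_op_power:
  "eventually (\<lambda>z. diff_op (A ^ n) u z = diff_op A u z ^ n) (generic S)"
proof (induction n)
  case 0
  then show ?case using diff_op_dconst[of 1 u] by (simp add: dconst_1)
next
  case (Suc n)
  then show ?case using eventually_diff_op_mult[of A "A ^ n" u S] by eventually_elim simp
qed

text \<open>
  Otherwise \<open>order_one\<close> yields \<open>B y\<^sub>1\<^sup>n \<in> \<Lambda>\<close> with \<open>B\<close> of order zero. On a polydisc where \<open>\<delta>\<^sub>2 \<omega>\<close> has no zeros \<open>B\<close> annihilates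
  \<open>\<omega>\<close>, so that the annihilator of \<open>\<omega>\<close> there is a nontrivial expansion of order zero.
\<close>

theorem order_one_semi_invariant:
  assumes X1: "X1 \<noteq> 0" and ord: "operator_ord X1 X2 = 1"
  shows "semi_invariant (vf_rat (vf_slope X1 X2)) (rat_d2 (vf_slope X1 X2))"
proof (rule ccontr)
  assume no: "\<not> ?thesis"
  have ord': "operator_ord X1 X2 = enat 1" using ord by (simp add: one_enat_def)
  obtain \<Lambda> \<omega> \<Omega> A where \<Lambda>: "differential_ideal \<Lambda>" "vf_dpoly X1 X2 \<in> \<Lambda>" "diff_ideal_gen {vf_dpoly X1 X2} \<subset> \<Lambda>"
    and \<omega>: "nonconst_analytic_on \<omega> \<Omega>" "\<Lambda> \<subseteq> annihilator \<omega> \<Omega>"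
    and A: "A \<in> \<Lambda>" "A \<noteq> 0" "occurring A \<subseteq> {0} \<times> {..1}"
    and min: "\<And>B. B \<in> \<Lambda> \<Longrightarrow> B \<noteq> 0 \<Longrightarrow> \<not> occurring B \<subseteq> {0} \<times> {..<1}"
    by (rule operator_ord_attained[OF X1 ord']) blast
  obtain B n where B: "B \<noteq> 0" "occurring B \<subseteq> {0} \<times> {..0}" "B * dvar (0, 1) ^ n \<in> \<Lambda>"
    using order_one[OF X1 \<Lambda>(1,2) A min] no by blast
  note h = hol2_if_nonconst_analytic[OF \<omega>(1)]
  have eq: "eval2 X1 z * pd1 \<omega> z + eval2 X2 z * pd2 \<omega> z = 0" if "z \<in> \<Omega>" for z
    using vf_in_annihilator_iff[OF h] \<Lambda>(2) \<omega>(2) that by blast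
  obtain p where p: "p \<in> \<Omega>" "pd2 \<omega> p \<noteq> 0" using first_integral_pd2_nonzero[OF X1 \<omega>(1) eq] .
  have "open (\<Omega> \<inter> pd2 \<omega> -` (- {0}))"
    by (rule continuous_open_preimage[OF hol2_continuous[OF hol2_pd2[OF h]] hol2_open[OF h]]) auto
  then obtain r where r: "r > 0" "bidisc p r \<subseteq> \<Omega> \<inter> pd2 \<omega> -` (- {0})"
    using bidisc_in_open[of "\<Omega> \<inter> pd2 \<omega> -` (- {0})" p] p by auto
  let ?B = "bidisc p r"
  have sub: "?B \<subseteq> \<Omega>" and nz: "\<And>z. z \<in> ?B \<Longrightarrow> pd2 \<omega> z \<noteq> 0" using r(2) by auto
  have ann: "annihilator \<omega> \<Omega> \<subseteq> annihilator \<omega> ?B"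
    unfolding annihilator_def using eventually_generic_subset[OF _ sub] by blast
  have B_ann: "B \<in> annihilator \<omega> ?B"
  proof -
    have "eventually (\<lambda>z. diff_op (B * dvar (0, 1) ^ n) \<omega> z = 0) (generic ?B)"
      using B(3) \<omega>(2) ann unfolding annihilator_def by blast
    then have "eventually (\<lambda>z. diff_op B \<omega> z = 0) (generic ?B)"
      using eventually_diff_op_mult[of B "dvar (0, 1) ^ n" \<omega> ?B] eventually_diff_op_power[of "dvar (0, 1)" n \<omega> ?B]
        eventually_generic_in[of ?B]
      by eventually_elim (use nz in \<open>auto simp: diff_op_dvar\<close>)
    then show ?thesis by (simp add: annihilator_def)
  qed
  have pB: "p \<in> ?B" by (rule centre_in_bidisc[OF r(1)])
  have nonconst: "nonconst_analytic_on \<omega> ?B"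
    unfolding nonconst_analytic_on_def
    using open_bidisc connected_bidisc pB hol2_imp_analytic2[OF hol2_subset[OF h sub open_bidisc]]
      not_constant_on[OF open_bidisc pB p(2)] by blast
  have "diff_ideal_gen {vf_dpoly X1 X2} \<subset> annihilator \<omega> ?B" using \<Lambda>(3) \<omega>(2) ann by blast
  note E = annihilator_nontrivial_expansion[OF nonconst this]
  have e: "expansion X1 X2 (annihilator \<omega> ?B)" using E(1) by (simp add: nontrivial_expansion_def)
  obtain k where k: "expansion_ord (annihilator \<omega> ?B) = enat k"
    and mink: "\<And>B. B \<in> annihilator \<omega> ?B \<Longrightarrow> B \<noteq> 0 \<Longrightarrow> \<not> occurring B \<subseteq> {0} \<times> {..<k}"
    by (rule expansion_order[OF X1 e E(2)]) blast
  have "k = 0"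
  proof (rule ccontr)
    assume "k \<noteq> 0"
    then have "{0 :: nat} \<times> {..0 :: nat} \<subseteq> {0} \<times> {..<k}" by auto
    then show False using mink[OF B_ann B(1)] B(2) by blast
  qed
  then have "operator_ord X1 X2 \<le> 0" using operator_ord_le[OF E(1)] k by (simp add: zero_enat_def)
  then show False using ord by simp
qed

section \<open>The cases of order zero and of infinite order\<close>

lemma rational_first_integral:
  assumes X1: "X1 \<noteq> 0" and c: "vf_rat (vf_slope X1 X2) c = 0" "\<And>k. c \<noteq> rat_const k"
  shows "\<exists>\<omega> \<Omega>. first_integral_on X1 X2 \<omega> \<Omega> \<and> rational_on \<omega> \<Omega>"
proof -
  let ?g = "vf_slope X1 X2"
  define C where "C = {?g, c}"
  have fin: "finite C" by (simp add: C_def)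
  obtain p where p: "p \<in> regular_set C" using regular_set_nonempty[OF fin, of 1] by auto
  obtain r where r: "r > 0" "bidisc p r \<subseteq> regular_set C" using bidisc_in_open[OF open_regular_set[OF fin] p] .
  let ?B = "bidisc p r"
  have reg: "rat_regular ?g z" "rat_regular c z" if "z \<in> ?B" for z
    using r(2) that by (auto simp: C_def regular_set_def)
  have h: "hol2 (rat_val c) ?B" by (rule hol2_rat_val[OF open_bidisc reg(2)])
  have pB: "p \<in> ?B" by (rule centre_in_bidisc[OF r(1)])
  have "\<not> rat_val c constant_on ?B"
  proof
    assume "rat_val c constant_on ?B"
    then obtain k where k: "\<And>z. z \<in> ?B \<Longrightarrow> rat_val c z = k" unfolding constant_on_def by blast
    have "c - rat_const k \<noteq> 0" using c(2)[of k] by simp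
    then have "eventually (\<lambda>z. rat_val (c - rat_const k) z \<noteq> 0) (generic ?B)" by (rule eventually_rat_nonzero)
    then obtain z where z: "z \<in> ?B" "rat_val (c - rat_const k) z \<noteq> 0"
      using generic_exists[OF _ open_bidisc, of _ ?B p r] pB by blast
    then show False using rat_val_diff(1)[OF reg(2)[OF z(1)] rat_val_const(2), of k] k[OF z(1)] by simp
  qed
  moreover have "eval2 X1 z * pd1 (rat_val c) z + eval2 X2 z * pd2 (rat_val c) z = 0" if z: "z \<in> ?B" for z
  proof -
    have "rat_val (vf_rat ?g c) z = pd1 (rat_val c) z + rat_val ?g z * pd2 (rat_val c) z"
      unfolding vf_rat_def using reg[OF z] by (simp add: rat_hom pd_rat_val)
    then have 1: "pd1 (rat_val c) z = - (rat_val ?g z * pd2 (rat_val c) z)"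
      unfolding c(1) by (simp add: eq_neg_iff_add_eq_0)
    show ?thesis unfolding 1 vf_slope_val[OF X1 reg(1)[OF z], symmetric] by simp
  qed
  ultimately have "first_integral_on X1 X2 (rat_val c) ?B"
    unfolding first_integral_on_def nonconst_analytic_on_def
    using open_bidisc connected_bidisc pB hol2_imp_analytic2[OF h] by blast
  moreover have "rational_on (rat_val c) ?B" unfolding rational_on_def using pB by blast
  ultimately show ?thesis by blast
qed

lemma eventually_diff_op_const_coeffs:
  "eventually (\<lambda>z. diff_op (dpoly_ext dconst 0 (map_poly rat_const p)) u z = poly p (u z)) (generic S)"
proof (induction p)
  case 0
  then show ?case by (simp add: dpoly_ext_def)
next
  case (pCons k p)
  have ext: "dpoly_ext dconst 0 (map_poly rat_const (pCons k p)) =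
      dconst (rat_const k) + dvar (0, 0) * dpoly_ext dconst 0 (map_poly rat_const p)"
    by (simp add: map_poly_pCons rat_const_0 dpoly_ext_simps dconst_0)
  show ?case
    unfolding ext using pCons.IH eventually_diff_op_mult[of "dvar (0, 0)" "dpoly_ext dconst 0 (map_poly rat_const p)" u S]
      eventually_diff_op_add[of "dconst (rat_const k)" "dvar (0, 0) * dpoly_ext dconst 0 (map_poly rat_const p)" u S]
    by eventually_elim (simp add: diff_op_dconst diff_op_dvar)
qed

theorem order_zero_rational:
  assumes X1: "X1 \<noteq> 0" and ord: "operator_ord X1 X2 = 0"
  shows "\<exists>\<omega> \<Omega>. first_integral_on X1 X2 \<omega> \<Omega> \<and> rational_on \<omega> \<Omega>"
proof -
  let ?g = "vf_slope X1 X2"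
  have ord': "operator_ord X1 X2 = enat 0" using ord by (simp add: zero_enat_def)
  obtain \<Lambda> \<omega> \<Omega> A where \<Lambda>: "differential_ideal \<Lambda>" "vf_dpoly X1 X2 \<in> \<Lambda>"
    and \<omega>: "nonconst_analytic_on \<omega> \<Omega>" "\<Lambda> \<subseteq> annihilator \<omega> \<Omega>"
    and A: "A \<in> \<Lambda>" "A \<noteq> 0" "occurring A \<subseteq> {0} \<times> {..0}"
    and min: "\<And>B. B \<in> \<Lambda> \<Longrightarrow> B \<noteq> 0 \<Longrightarrow> \<not> occurring B \<subseteq> {0} \<times> {..<0}"
    by (rule operator_ord_attained[OF X1 ord']) blast
  note chain = presents_chain[OF X1 \<Lambda>]
  have p1: "presents ?g \<Lambda> (dpoly_ext dconst 0) (poly_ext (vf_rat ?g) 0 0) (Suc 0)"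
    by (rule presents_ext[OF chain(1) \<Lambda>(1)]) (use vf_op_dvar(1)[OF X1 \<Lambda>] in \<open>simp add: dconst_0\<close>)
  obtain P where P: "dpoly_ext dconst 0 P \<in> \<Lambda>" "degree P \<noteq> 0"
    and rel: "\<And>i. lead_coeff P * vf_rat ?g (coeff P i) = vf_rat ?g (lead_coeff P) * coeff P i"
    using presents_minimal_relation[OF chain(1) p1 \<Lambda>(1) A min] by auto
  define l where "l = lead_coeff P"
  have l0: "l \<noteq> 0" using P(2) by (auto simp: l_def)
  have zero: "vf_rat ?g (coeff P i / l) = 0" for i
  proof -
    have "coeff P i = (coeff P i / l) * l" using l0 by simp
    then have "vf_rat ?g (coeff P i) = vf_rat ?g (coeff P i / l) * l + (coeff P i / l) * vf_rat ?g l"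
      using derivation_mult[OF is_derivation_vf_rat, of ?g "coeff P i / l" l] by simp
    then have "l * vf_rat ?g (coeff P i) = l * l * vf_rat ?g (coeff P i / l) + vf_rat ?g l * coeff P i"
      using l0 by (simp add: algebra_simps)
    then have "l * l * vf_rat ?g (coeff P i / l) = 0" using rel[of i] by (simp add: l_def)
    then show ?thesis using l0 by simp
  qed
  show ?thesis
  proof (cases "\<exists>i. \<forall>k. coeff P i / l \<noteq> rat_const k")
    case True
    then show ?thesis using rational_first_integral[OF X1 zero] by blast
  next
    case False
    then obtain k where k: "\<And>i. coeff P i / l = rat_const (k i)" by metis
    \<comment> \<open>All coefficients of the monic relation being complex numbers, it is a
      polynomial in one variable that vanishes at every value of \<open>\<omega>\<close>.\<close>
    define p where "p = (\<Sum>i\<le>degree P. monom (k i) i)"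
    have cp: "coeff p i = (if i \<le> degree P then k i else 0)" for i
      by (simp add: p_def coeff_sum)
    define Q where "Q = map_poly rat_const p"
    have "P = [:l:] * Q"
    proof (rule poly_eqI)
      fix i
      have "coeff P i = l * rat_const (k i)" using k[of i] l0 by (simp add: field_simps)
      then show "coeff P i = coeff ([:l:] * Q) i"
        by (cases "i \<le> degree P") (simp_all add: Q_def coeff_map_poly rat_const_0 cp coeff_eq_0)
    qed
    then have "dpoly_ext dconst 0 P = dconst l * dpoly_ext dconst 0 Q"
      using presentsD(5)[OF p1, of "[:l:]" Q] by (simp add: dpoly_ext_simps dconst_0)
    then have "dconst (inverse l) * dpoly_ext dconst 0 P = dconst (inverse l * l) * dpoly_ext dconst 0 Q"
      by (simp add: dconst_mult mult.assoc)
    then have "dpoly_ext dconst 0 Q = dconst (inverse l) * dpoly_ext dconst 0 P"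
      using l0 by (simp add: dconst_1)
    then have "dpoly_ext dconst 0 Q \<in> annihilator \<omega> \<Omega>"
      using dideal_mult[OF \<Lambda>(1) P(1)] \<omega>(2) by auto
    then have "eventually (\<lambda>z. poly p (\<omega> z) = 0) (generic \<Omega>)"
      using eventually_diff_op_const_coeffs[of p \<omega> \<Omega>] unfolding annihilator_def mem_Collect_eq Q_def
      by eventually_elim simp
    moreover note h = hol2_if_nonconst_analytic[OF \<omega>(1)]
    moreover have cont: "continuous_on \<Omega> (\<lambda>z. poly p (\<omega> z))"
      by (intro continuous_intros hol2_continuous[OF h])
    ultimately have "poly p (\<omega> z) = 0" if "z \<in> \<Omega>" for z
      using generic_zero_imp_zero[OF _ hol2_open[OF h] subset_refl cont that] by blast
    then have sub: "\<omega> ` \<Omega> \<subseteq> {x. poly p x = 0}" by auto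
    have "k (degree P) \<noteq> 0"
    proof
      assume "k (degree P) = 0"
      then have "l / l = 0" using k[of "degree P"] by (simp add: l_def rat_const_0)
      then show False using l0 by simp
    qed
    then have "p \<noteq> 0" using cp[of "degree P"] by auto
    then have "finite (\<omega> ` \<Omega>)" using poly_roots_finite finite_subset[OF sub] by blast
    then have "\<omega> constant_on \<Omega>"
      using \<omega>(1) hol2_continuous[OF h]
      by (intro continuous_finite_range_constant) (auto simp: nonconst_analytic_on_def)
    then show ?thesis using \<omega>(1) by (simp add: nonconst_analytic_on_def)
  qed
qed

theorem order_infinite:
  assumes X1: "X1 \<noteq> 0" and ord: "operator_ord X1 X2 = \<infinity>" and \<omega>: "first_integral_on X1 X2 \<omega> \<Omega>"
    and A: "A \<notin> diff_ideal_gen {vf_dpoly X1 X2}" "satisfies_on \<omega> A \<Omega>"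
  shows False
proof -
  have n: "nonconst_analytic_on \<omega> \<Omega>" and eq: "\<And>z. z \<in> \<Omega> \<Longrightarrow> eval2 X1 z * pd1 \<omega> z + eval2 X2 z * pd2 \<omega> z = 0"
    using \<omega> by (auto simp: first_integral_on_def)
  note h = hol2_if_nonconst_analytic[OF n]
  have "A \<in> annihilator \<omega> \<Omega>" using A(2) annihilator_iff_satisfies[OF h] by blast
  then have "diff_ideal_gen {vf_dpoly X1 X2} \<subset> annihilator \<omega> \<Omega>"
    using gen_subset_annihilator[OF h eq] A(1) by blast
  note E = annihilator_nontrivial_expansion[OF n this]
  have "expansion X1 X2 (annihilator \<omega> \<Omega>)" using E(1) by (simp add: nontrivial_expansion_def)
  then obtain k where "expansion_ord (annihilator \<omega> \<Omega>) = enat k"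
    by (rule expansion_order[OF X1 _ E(2)])
  then show False using operator_ord_le[OF E(1)] ord by simp
qed

text \<open>The second alternative is no exception: a semi-invariant yields the required
  \<open>t\<close> as its logarithmic derivative divided by the exponent.\<close>

lemma order_two_solution:
  fixes X1 X2 :: bipoly
  assumes X1: "X1 \<noteq> 0"
  defines "g \<equiv> vf_slope X1 X2"
  assumes dis: "quotient_solvable (vf_rat g) (- rat_d2 g) (- rat_d2 (rat_d2 g)) \<or>
    semi_invariant (vf_rat g) (rat_d2 g)"
  obtains t where "vf_rat g t = - rat_d2 g * t - rat_d2 (rat_d2 g)"
  using dis
proof
  assume "quotient_solvable (vf_rat g) (- rat_d2 g) (- rat_d2 (rat_d2 g))"
  then obtain t where "vf_rat g t = - rat_d2 g * t + - rat_d2 (rat_d2 g)"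
    by (rule quotient_solvable_field[OF is_derivation_vf_rat])
  then show thesis using that[of t] by simp
next
  assume "semi_invariant (vf_rat g) (rat_d2 g)"
  then obtain \<beta> n where "\<beta> \<noteq> 0" "n > (0 :: nat)" "vf_rat g \<beta> = - of_nat n * rat_d2 g * \<beta>"
    by (rule semi_invariant_field[OF is_derivation_vf_rat])
  from log_derivative_solution[OF is_derivation_vf_rat is_derivation_rat(2) vf_rat_commute this]
  show thesis by (rule that)
qed

theorem theorem6:
  fixes X1 X2 :: "complex poly poly"
  assumes "X1 \<noteq> 0"
  shows
    "(operator_ord X1 X2 = 0 \<longrightarrow>
        (\<exists>\<omega> \<Omega>. first_integral_on X1 X2 \<omega> \<Omega> \<and> rational_on \<omega> \<Omega>)) \<and>
     (operator_ord X1 X2 = 1 \<longrightarrow>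
        (\<exists>\<omega> \<Omega>. first_integral_on X1 X2 \<omega> \<Omega> \<and>
           (\<exists>n::nat. n > 0 \<and> rational_on (\<lambda>z. (pd2 \<omega> z) ^ n) \<Omega>))) \<and>
     (operator_ord X1 X2 = 2 \<longrightarrow>
        (\<exists>\<omega> \<Omega>. first_integral_on X1 X2 \<omega> \<Omega> \<and>
           rational_on (\<lambda>z. (pd2 ^^ 2) \<omega> z / pd2 \<omega> z) {z \<in> \<Omega>. pd2 \<omega> z \<noteq> 0})) \<and>
     (operator_ord X1 X2 = 3 \<longrightarrow>
        (\<exists>\<omega> \<Omega>. first_integral_on X1 X2 \<omega> \<Omega> \<and>
           rational_on
             (\<lambda>z. (2 * pd2 \<omega> z * (pd2 ^^ 3) \<omega> z - 3 * ((pd2 ^^ 2) \<omega> z)\<^sup>2) / (pd2 \<omega> z)\<^sup>2)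
             {z \<in> \<Omega>. pd2 \<omega> z \<noteq> 0})) \<and>
     (operator_ord X1 X2 = \<infinity> \<longrightarrow>
        \<not> (\<exists>\<omega> \<Omega> A. first_integral_on X1 X2 \<omega> \<Omega> \<and>
             A \<notin> diff_ideal_gen {vf_dpoly X1 X2} \<and> satisfies_on \<omega> A \<Omega>))"
proof (intro conjI impI)
  let ?g = "vf_slope X1 X2"
  note X1 = \<open>X1 \<noteq> 0\<close>
  show "\<exists>\<omega> \<Omega>. first_integral_on X1 X2 \<omega> \<Omega> \<and> rational_on \<omega> \<Omega>" if "operator_ord X1 X2 = 0"
    by (rule order_zero_rational[OF X1 that])
  show "\<exists>\<omega> \<Omega>. first_integral_on X1 X2 \<omega> \<Omega> \<and> (\<exists>n::nat. n > 0 \<and> rational_on (\<lambda>z. (pd2 \<omega> z) ^ n) \<Omega>)"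
    if "operator_ord X1 X2 = 1"
    by (rule first_integral_radical[OF X1 order_one_semi_invariant[OF X1 that]])
  show "\<exists>\<omega> \<Omega>. first_integral_on X1 X2 \<omega> \<Omega> \<and>
      rational_on (\<lambda>z. (pd2 ^^ 2) \<omega> z / pd2 \<omega> z) {z \<in> \<Omega>. pd2 \<omega> z \<noteq> 0}"
    if ord: "operator_ord X1 X2 = 2"
  proof -
    have "operator_ord X1 X2 = enat 2" using ord by (simp add: numeral_eq_enat)
    then obtain \<Lambda> A where "differential_ideal \<Lambda>" "vf_dpoly X1 X2 \<in> \<Lambda>"
      "A \<in> \<Lambda>" "A \<noteq> 0" "occurring A \<subseteq> {0} \<times> {..2}"
      "\<And>B. B \<in> \<Lambda> \<Longrightarrow> B \<noteq> 0 \<Longrightarrow> \<not> occurring B \<subseteq> {0} \<times> {..<2}"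
      by (rule operator_ord_attained[OF X1]) blast
    from order_two[OF X1 this]
    obtain t where "vf_rat ?g t = - rat_d2 ?g * t - rat_d2 (rat_d2 ?g)"
      by (rule order_two_solution[OF X1])
    then show ?thesis by (rule first_integral_exponential[OF X1])
  qed
  show "\<exists>\<omega> \<Omega>. first_integral_on X1 X2 \<omega> \<Omega> \<and>
      rational_on (\<lambda>z. (2 * pd2 \<omega> z * (pd2 ^^ 3) \<omega> z - 3 * ((pd2 ^^ 2) \<omega> z)\<^sup>2) / (pd2 \<omega> z)\<^sup>2)
        {z \<in> \<Omega>. pd2 \<omega> z \<noteq> 0}"
    if ord: "operator_ord X1 X2 = 3"
  proof -
    have "operator_ord X1 X2 = enat 3" using ord by (simp add: numeral_eq_enat)
    then obtain \<Lambda> A where "differential_ideal \<Lambda>" "vf_dpoly X1 X2 \<in> \<Lambda>"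
      "A \<in> \<Lambda>" "A \<noteq> 0" "occurring A \<subseteq> {0} \<times> {..3}"
      "\<And>B. B \<in> \<Lambda> \<Longrightarrow> B \<noteq> 0 \<Longrightarrow> \<not> occurring B \<subseteq> {0} \<times> {..<3}"
      by (rule operator_ord_attained[OF X1]) blast
    from order_three[OF X1 this]
    have "\<exists>t. vf_rat ?g t = - 2 * rat_d2 ?g * t - 2 * rat_d2 (rat_d2 (rat_d2 ?g))"
    proof
      assume "quotient_solvable (vf_rat ?g) (- 2 * rat_d2 ?g) (- 2 * rat_d2 (rat_d2 (rat_d2 ?g)))"
      then obtain t where "vf_rat ?g t = - 2 * rat_d2 ?g * t + - 2 * rat_d2 (rat_d2 (rat_d2 ?g))"
        by (rule quotient_solvable_field[OF is_derivation_vf_rat])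
      then show ?thesis by (intro exI[of _ t]) simp
    next
      \<comment> \<open>The elimination stopped early with a solution of the order-two type; its
        Riccati expression is the desired Schwarzian.\<close>
      assume "quotient_solvable (vf_rat ?g) (- rat_d2 ?g) (- rat_d2 (rat_d2 ?g)) \<or>
        semi_invariant (vf_rat ?g) (rat_d2 ?g)"
      then obtain t where "vf_rat ?g t = - rat_d2 ?g * t - rat_d2 (rat_d2 ?g)"
        by (rule order_two_solution[OF X1])
      from riccati_solution[OF is_derivation_vf_rat is_derivation_rat(2) vf_rat_commute this]
      show ?thesis by (rule exI)
    qed
    then obtain t where "vf_rat ?g t = - 2 * rat_d2 ?g * t - 2 * rat_d2 (rat_d2 (rat_d2 ?g))" by (rule exE)
    then show ?thesis by (rule first_integral_projective[OF X1])
  qed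
  show "\<not> (\<exists>\<omega> \<Omega> A. first_integral_on X1 X2 \<omega> \<Omega> \<and>
      A \<notin> diff_ideal_gen {vf_dpoly X1 X2} \<and> satisfies_on \<omega> A \<Omega>)" if "operator_ord X1 X2 = \<infinity>"
    using order_infinite[OF X1 that] by metis
qed

end
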